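(* Let $G$ be the bounded domain whose boundary is $\mathcal L_+$, the loop around $0$ of the lemniscate $\{z\in\mathbb{C}: |z(z+1)|=1/4\}$. Let $W(z)=1+z$, $w(z)=|1+z|$, $Q(z)=-\log|1+z|$, and let $s_n((1+z)^{-n})$ denote the $n$-th order Taylor polynomial about $0$ of the function $z\mapsto(1+z)^{-n}$. The following hold. 1) For each $z\in\overline G\setminus\{-1/2\}$, as $n\to\infty$, $$1-(1+z)^n s_n((1+z)^{-n})=\frac{(-1)^{n+1}z}{\sqrt{n\pi}\,(2z+1)}\,(4z(1+z))^n\left(1+O\!\left(\frac1n\right)\right).$$ 2) Let $\tilde s_n((1+z)^{-n})$ be the constant multiple of $s_n((1+z)^{-n})$ with leading coefficient $1$. Then the sequence of monic polynomials $\tilde s_n((1+z)^{-n})$ is asymptotically extremal for $\overline G$ and the weight $w$, that is, $$\lim_{n\to\infty}\left(\|(1+z)^n\tilde s_n((1+z)^{-n})\|^*_{\overline G}\right)^{1/n}=\exp(-F_{\overline G,Q})=\frac14.$$ 3) Let $\nu_n=\frac1n\sum_{j=1}^n\delta_{z_{nj}}$ be the normalized counting measure of the zeros $z_{n1},\dots,z_{nn}$ of $s_n((1+z)^{-n})$. Then $\nu_n\to\mu^{\overline G,Q}$ (weak-* convergence of measures) as $n\to\infty$. 4) The pair $(G,1+z)$ is an approximation pair which is maximal, in the sense that for any domain $H$ containing $\overline G$, $(H,1+z)$ is not an approximation pair.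
   Context: The lemniscate $\{z\in\mathbb{C}:|z(z+1)|=1/4\}$ consists of two loops meeting at $-1/2$: $\mathcal L_+$ surrounds $0$ and $\mathcal L_-$ surrounds $-1$. For a probability measure $\tau$ supported in $\overline G$, the weighted energy is $$I^w(\tau)=\int\int\log\frac{1}{|z-t|}\,d\tau(t)\,d\tau(z)+2\int Q\,d\tau .$$ $\mu^{\overline G,Q}$ is the unique probability measure on $\overline G$ minimizing $I^w$, and $F_{\overline G,Q}:=I^w(\mu^{\overline G,Q})-\int Q\,d\mu^{\overline G,Q}$. For a function $f$ on a compact set $K$, $\|f\|_K^*=\inf\{L:\ |f(z)|\le L \text{ q.e. on } K\}$, where q.e. (quasi-everywhere) means except on a set of logarithmic capacity zero. Zeros of polynomials are counted with multiplicity. Approximation pair: for $G\subset\mathbb{C}$ open and $W$ a non-vanishing holomorphic function in $G$, $(G,W)$ is an approximation pair if for every $f$ holomorphic in $G$ and every compact $K\subset G$ there exist polynomials $P_n\in\mathbb{C}[z]$ with $\deg P_n\le n$ such that $\sup_K|f-W^nP_n|\to 0$ as $n\to\infty$. *)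

theory Defs
  imports "HOL-Complex_Analysis.Complex_Analysis" "HOL-Probability.Probability"
begin

definition lemniscate :: "complex set" where
  "lemniscate = {z. cmod (z * (z + 1)) = 1/4}"

text \<open>
  If \<open>Re z = -1/2\<close> and \<open>y = Im z\<close>, then \<open>\<bar>z(z + 1)\<bar> = y\<^sup>2 + 1/4\<close>. So the lemniscate meets this
  line only at \<open>-1/2\<close>, and the two loops are its parts in the two closed half-planes.
\<close>

definition lemniscate_plus :: "complex set" where
  "lemniscate_plus = {z \<in> lemniscate. - 1/2 \<le> Re z}"

definition lemniscate_minus :: "complex set" where
  "lemniscate_minus = {z \<in> lemniscate. Re z \<le> - 1/2}"

lemma cmod_on_symmetry_axis:
  assumes "Re z = - 1/2"
  shows "cmod (z * (z + 1)) = (Im z)\<^sup>2 + 1/4"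
proof -
  have "z * (z + 1) = of_real (- ((Im z)\<^sup>2 + 1/4))"
    using assms by (simp add: complex_eq_iff power2_eq_square algebra_simps)
  then show ?thesis
    by (simp only: norm_of_real abs_minus_cancel) simp
qed

lemma lemniscate_loops_meet: "lemniscate_plus \<inter> lemniscate_minus = {- 1/2}"
proof -
  have "z = - 1/2" if "z \<in> lemniscate_plus \<inter> lemniscate_minus" for z
  proof -
    have "Re z = - 1/2"
      using that by (auto simp: lemniscate_plus_def lemniscate_minus_def)
    with cmod_on_symmetry_axis[OF this] that show ?thesis
      by (auto simp: lemniscate_plus_def lemniscate_def complex_eq_iff)
  qed
  moreover have "cmod ((- 1/2) * ((- 1/2) + 1)) = 1/4"
    by (simp add: norm_mult norm_divide)
  ultimately show ?thesis
    by (auto simp: lemniscate_plus_def lemniscate_minus_def lemniscate_def)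
qed

lemma ex_lemniscate_domain:
  "\<exists>G. open G \<and> connected G \<and> bounded G \<and> frontier G = lemniscate_plus \<and> 0 \<in> G"
proof -
  define g :: "complex \<Rightarrow> complex" where "g = (\<lambda>u. (csqrt u - 1) / 2)"
  define G where "G = {z. cmod (z * (z + 1)) < 1/4 \<and> - 1/2 < Re z}"
  have key: "z * (z + 1) = ((2*z + 1)\<^sup>2 - 1) / 4" for z :: complex
    by (simp add: power2_eq_square field_simps)
  have cm: "cmod (z * (z + 1)) = dist 1 ((2*z + 1)\<^sup>2) / 4" for z :: complex
    unfolding key by (simp add: norm_divide dist_norm norm_minus_commute)
  have g_eq: "g ((2*z + 1)\<^sup>2) = z" if "- 1/2 < Re z \<or> z = - 1/2" for z
  proof -
    have "csqrt ((2*z + 1)\<^sup>2) = 2*z + 1"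
      using that by (intro csqrt_square) auto
    then show ?thesis by (simp add: g_def)
  qed
  have g_inv: "(2 * g u + 1)\<^sup>2 = u" for u
  proof -
    have "2 * g u + 1 = csqrt u" by (simp add: g_def field_simps)
    then show ?thesis by simp
  qed
  have Re_pos: "0 < Re u" if "u \<in> ball 1 1" for u :: complex
    using that abs_Re_le_cmod[of "1 - u"] by (auto simp: dist_norm)
  have Re_g: "- 1/2 < Re (g u)" if "u \<in> ball 1 1" for u
  proof -
    have "0 < Re (csqrt u)"
      using Re_pos[OF that] by (simp add: add_nonneg_pos)
    then show ?thesis by (simp add: g_def)
  qed
  have img: "G = g ` ball 1 1"
  proof
    show "G \<subseteq> g ` ball 1 1"
    proof
      fix z assume z: "z \<in> G"
      then have "(2*z + 1)\<^sup>2 \<in> ball 1 1" using cm[of z] by (simp add: G_def)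
      moreover have "g ((2*z + 1)\<^sup>2) = z" using z by (intro g_eq) (simp add: G_def)
      ultimately show "z \<in> g ` ball 1 1" by (metis imageI)
    qed
    show "g ` ball 1 1 \<subseteq> G"
    proof
      fix z assume "z \<in> g ` ball 1 1"
      then obtain u where u: "u \<in> ball 1 1" "z = g u" by auto
      then have "dist 1 ((2*z + 1)\<^sup>2) < 1" by (simp only: g_inv mem_ball)
      then have "cmod (z * (z + 1)) < 1/4" unfolding cm by linarith
      with Re_g u show "z \<in> G" by (simp add: G_def)
    qed
  qed
  have "continuous (at u within cball 1 1) csqrt" if "u \<in> cball 1 1" for u :: complex
  proof (cases "u = 0")
    case True
    have "((\<lambda>x. sqrt (cmod x)) \<longlongrightarrow> sqrt (cmod 0)) (at 0 within cball 1 1)"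
      by (intro tendsto_intros)
    then have "((\<lambda>x. cmod (csqrt x)) \<longlongrightarrow> 0) (at 0 within cball 1 1)"
      by simp
    then show ?thesis
      using True by (simp add: continuous_within tendsto_norm_zero_cancel)
  next
    case False
    have "u \<notin> \<real>\<^sub>\<le>\<^sub>0"
    proof
      assume "u \<in> \<real>\<^sub>\<le>\<^sub>0"
      then obtain r where r: "u = of_real r" "r \<le> 0"
        by (rule nonpos_Reals_cases)
      have "1 - u = of_real (1 - r)"
        using r by simp
      then have "cmod (1 - u) = \<bar>1 - r\<bar>"
        by (simp only: norm_of_real)
      moreover have "cmod (1 - u) \<le> 1"
        using that by (simp add: dist_norm)
      ultimately have "r = 0" using r by linarith
      with r False show False by simp
    qed
    then show ?thesis by (rule continuous_within_csqrt)
  qed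
  then have "continuous_on (cball 1 1) csqrt"
    by (simp add: continuous_on_eq_continuous_within)
  then have cont: "continuous_on (cball 1 1) g"
    unfolding g_def by (intro continuous_intros) auto
  have "open G"
    unfolding G_def by (intro open_Collect_conj open_Collect_less continuous_intros)
  moreover have "connected G"
    unfolding img by (intro connected_continuous_image continuous_on_subset[OF cont]) auto
  moreover have "bounded G"
  proof -
    have "bounded (g ` cball 1 1)"
      by (intro compact_imp_bounded compact_continuous_image cont) auto
    then show ?thesis
      unfolding img by (rule bounded_subset) auto
  qed
  moreover have "frontier G = lemniscate_plus"
  proof
    have "closed {z. cmod (z * (z + 1)) \<le> 1/4 \<and> - 1/2 \<le> Re z}"
      by (intro closed_Collect_conj closed_Collect_le continuous_intros)
    then have cl: "closure G \<subseteq> {z. cmod (z * (z + 1)) \<le> 1/4 \<and> - 1/2 \<le> Re z}"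
      by (intro closure_minimal) (auto simp: G_def)
    show "frontier G \<subseteq> lemniscate_plus"
    proof
      fix z assume "z \<in> frontier G"
      then have z: "cmod (z * (z + 1)) \<le> 1/4" "- 1/2 \<le> Re z" "z \<notin> G"
        using cl \<open>open G\<close> by (auto simp: frontier_def interior_open)
      have "1/4 \<le> cmod (z * (z + 1))"
      proof (cases "Re z = - 1/2")
        case True
        then show ?thesis using cmod_on_symmetry_axis[OF True] by simp
      next
        case False
        then show ?thesis using z by (auto simp: G_def)
      qed
      with z show "z \<in> lemniscate_plus"
        by (simp add: lemniscate_plus_def lemniscate_def)
    qed
    show "lemniscate_plus \<subseteq> frontier G"
    proof
      fix z assume z: "z \<in> lemniscate_plus"
      have z': "- 1/2 < Re z \<or> z = - 1/2"
      proof (cases "- 1/2 < Re z")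
        case False
        then have "z \<in> lemniscate_plus \<inter> lemniscate_minus"
          using z by (simp add: lemniscate_plus_def lemniscate_minus_def)
        then show ?thesis by (simp add: lemniscate_loops_meet)
      qed simp
      have "(2*z + 1)\<^sup>2 \<in> cball 1 1"
        using z cm[of z] by (simp add: lemniscate_plus_def lemniscate_def)
      then have "z \<in> g ` cball 1 1"
        using g_eq[OF z'] by (metis imageI)
      also have "g ` cball 1 1 \<subseteq> closure G"
      proof -
        have "g ` closure (ball 1 1) \<subseteq> closure G"
        proof (rule image_closure_subset)
          show "continuous_on (closure (ball 1 1)) g" using cont by simp
          show "g ` ball 1 1 \<subseteq> closure G" using img closure_subset by metis
        qed simp
        then show ?thesis by simp
      qed
      finally show "z \<in> frontier G"
        using z \<open>open G\<close>
        by (auto simp: frontier_def interior_open G_def lemniscate_plus_def lemniscate_def)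
    qed
  qed
  moreover have "0 \<in> G"
    by (simp add: G_def)
  ultimately show ?thesis by blast
qed

text \<open>
  Extended integral: it may be infinite, which the Bochner integral cannot express. It is only
  meaningful if the positive or the negative part has finite integral.
\<close>

definition ext_integral :: "'a measure \<Rightarrow> ('a \<Rightarrow> ereal) \<Rightarrow> ereal" where
  "ext_integral M f =
     enn2ereal (\<integral>\<^sup>+ x. e2ennreal (f x) \<partial>M) - enn2ereal (\<integral>\<^sup>+ x. e2ennreal (- f x) \<partial>M)"

text \<open>The case distinction is needed since \<open>ln 0 = 0\<close> in HOL.\<close>

definition log_kernel :: "complex \<Rightarrow> complex \<Rightarrow> ereal" where
  "log_kernel z t = (if z = t then \<infinity> else ereal (ln (1 / cmod (z - t))))"

definition log_energy :: "complex measure \<Rightarrow> ereal" where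
  "log_energy \<tau> = ext_integral \<tau> (\<lambda>z. ext_integral \<tau> (\<lambda>t. log_kernel z t))"

definition prob_measures_on :: "complex set \<Rightarrow> complex measure set" where
  "prob_measures_on E = {\<tau>. prob_space \<tau> \<and> sets \<tau> = sets borel \<and> emeasure \<tau> E = 1}"

definition weighted_energy :: "(complex \<Rightarrow> real) \<Rightarrow> complex measure \<Rightarrow> ereal" where
  "weighted_energy Q \<tau> = log_energy \<tau> + 2 * ext_integral \<tau> (\<lambda>z. ereal (Q z))"

definition equilibrium_measure :: "complex set \<Rightarrow> (complex \<Rightarrow> real) \<Rightarrow> complex measure" where
  "equilibrium_measure E Q =
     (THE \<mu>. \<mu> \<in> prob_measures_on E \<and>
        (\<forall>\<tau>\<in>prob_measures_on E. weighted_energy Q \<mu> \<le> weighted_energy Q \<tau>))"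

definition robin_constant :: "complex set \<Rightarrow> (complex \<Rightarrow> real) \<Rightarrow> ereal" where
  "robin_constant E Q =
     weighted_energy Q (equilibrium_measure E Q) -
     ext_integral (equilibrium_measure E Q) (\<lambda>z. ereal (Q z))"

text \<open>Inner logarithmic capacity; for Borel sets it is the usual capacity.\<close>

definition log_capacity :: "complex set \<Rightarrow> ereal" where
  "log_capacity E =
     (case (INF K\<in>{K. compact K \<and> K \<subseteq> E}. INF \<tau>\<in>prob_measures_on K. log_energy \<tau>) of
        ereal v \<Rightarrow> ereal (exp (- v)) | PInfty \<Rightarrow> 0 | MInfty \<Rightarrow> \<infinity>)"

definition quasi_everywhere :: "complex set \<Rightarrow> (complex \<Rightarrow> bool) \<Rightarrow> bool" where
  "quasi_everywhere K P \<longleftrightarrow> log_capacity {z\<in>K. \<not> P z} = 0"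

definition star_norm :: "complex set \<Rightarrow> (complex \<Rightarrow> complex) \<Rightarrow> real" where
  "star_norm K f = Inf {L. quasi_everywhere K (\<lambda>z. cmod (f z) \<le> L)}"

definition taylor_poly :: "nat \<Rightarrow> (complex \<Rightarrow> complex) \<Rightarrow> complex poly" where
  "taylor_poly n f = (\<Sum>k\<le>n. monom ((deriv ^^ k) f 0 / fact k) k)"

text \<open>
  The measure \<open>1/n\<close> times the sum of the unit point masses at the zeros of \<open>p\<close>, where each zero
  \<open>z\<close> is repeated \<open>order z p\<close> times. The \<open>distr\<close> only restricts the \<open>\<sigma>\<close>-algebra to Borel sets.
\<close>

definition zero_counting_measure :: "nat \<Rightarrow> complex poly \<Rightarrow> complex measure" where
  "zero_counting_measure n p =
     distr (point_measure {z. poly p z = 0} (\<lambda>z. ennreal (real (order z p) / real n)))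
       borel (\<lambda>z. z)"

text \<open>
  Convergence against bounded continuous functions. For probability measures, as
  here, this coincides with weak-* convergence tested on continuous functions of compact support.
\<close>

definition weak_star_conv :: "(nat \<Rightarrow> complex measure) \<Rightarrow> complex measure \<Rightarrow> bool" where
  "weak_star_conv \<nu> \<mu> \<longleftrightarrow>
     (\<forall>f::complex \<Rightarrow> real. continuous_on UNIV f \<longrightarrow> bounded (range f) \<longrightarrow>
        (\<lambda>n. LINT z|\<nu> n. f z) \<longlonglongrightarrow> (LINT z|\<mu>. f z))"

definition approximation_pair :: "complex set \<Rightarrow> (complex \<Rightarrow> complex) \<Rightarrow> bool" where
  "approximation_pair G W \<longleftrightarrow>
     open G \<and> W holomorphic_on G \<and> (\<forall>z\<in>G. W z \<noteq> 0) \<and>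
     (\<forall>f K. f holomorphic_on G \<longrightarrow> compact K \<longrightarrow> K \<subseteq> G \<longrightarrow>
        (\<exists>P :: nat \<Rightarrow> complex poly. (\<forall>n. degree (P n) \<le> n) \<and>
           uniform_limit K (\<lambda>n z. W z ^ n * poly (P n) z) f sequentially))"

end

theory Submission
  imports Defs "HOL-Computational_Algebra.Fundamental_Theorem_Algebra"
begin

text \<open>
  Put \<open>u = 4 z (z + 1)\<close>. This map sends the closed region bounded by the right loop
  homeomorphically, and its interior conformally, onto the unit disc; the inverse is
  \<open>g(u) = (sqrt (1 + u) - 1) / 2\<close>. Most steps of the proof become simple in the variable \<open>u\<close>.

  \<^bold>\<open>Remainder.\<close> \<open>(1 + z)^(-n)\<close> satisfies \<open>n y + (1 + z) y' = 0\<close>, and its Taylor polynomial \<open>s\<close>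
  satisfies the same equation up to its top term. Hence the derivative of \<open>1 - (1 + z)^n s(z)\<close> is a
  constant multiple of \<open>z^n (1 + z)^(n - 1)\<close>. The region is star-shaped about \<open>0\<close> and \<open>|z (z + 1)|\<close>
  increases along its radii; integration along radii gives the uniform bound
  \<open>taylor_defect_bound\<close>. Integration along the preimage of a radius of the disc, once by parts,
  together with Wallis's product for the central binomial coefficient gives the pointwise
  asymptotics \<open>taylor_defect_asymptotics\<close>.

  \<^bold>\<open>Equilibrium measure.\<close> It is the harmonic measure at \<open>0\<close>, that is, the image of normalized arc
  length under \<open>g\<close>. From \<open>4 (z - g(v)) (z + 1 + g(v)) = u - v\<close> and the mean value property its
  logarithmic potential at \<open>z\<close> equals \<open>ln 4 + ln |1 + z|\<close> on the whole closed region
  (\<open>loop_potential\<close>), so that potential plus \<open>Q\<close> is constant there. That this makes it the unique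
  minimizer follows from positive definiteness of the logarithmic kernel on differences of
  probability measures (\<open>energy_principle\<close>): the kernel is a mixture of Gaussians, a Gaussian is
  the convolution of two Gaussians, so the energy of a difference is an integral of squares of
  Gaussian averages; if it vanishes, all averages of one width agree, and by the Stone-Weierstrass
  theorem so do the measures.

  \<^bold>\<open>Norms.\<close> \<open>(1 + z)^n s(z)\<close> is \<open>1\<close> at \<open>0\<close> and at most \<open>1 + 2 n\<close> on the region, while the leading
  coefficient of \<open>s\<close> is half of the central binomial coefficient in modulus. Since discs have
  positive capacity, exceptional sets cannot lower the norm below the value at \<open>0\<close>.

  \<^bold>\<open>Zeros.\<close> Newton's identities bound the power sums of the zeros independently of \<open>n\<close>, so all
  moments of the zero counting measures tend to those of the harmonic measure. On the loop every
  continuous function is nearly the real part of a polynomial in \<open>u\<close>, so these moments suffice once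
  nearly all zeros are close to the loop. This holds because the Enestroem-Kakeya theorem puts them
  into discs shrinking to \<open>|z| \<le> 1/2\<close>, the remainder bound keeps them off compact subsets of the
  interior, and the product of the values \<open>|u|\<close> at the zeros grows only linearly.

  \<^bold>\<open>Approximation.\<close> A holomorphic function on the interior is a power series in \<open>u\<close>, hence a limit
  of polynomials, and \<open>(1 + z)^n\<close> times the Taylor polynomial of order \<open>n - d\<close> tends to \<open>1\<close> on compact
  subsets. The pair is maximal since a larger domain contains points \<open>-1/2 - \<delta>\<close> inside the left loop; there the
  maximum principle outside the right loop forces weighted polynomials that tend to \<open>1\<close> on the loop
  to tend to \<open>0\<close>.
\<close>

section \<open>The region enclosed by the right loop\<close>

text \<open>
  The half-plane selects one of the two components of \<open>|z (z + 1)| < 1/4\<close>: on the line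
  \<open>Re z = -1/2\<close> one has \<open>|z (z + 1)| \<ge> 1/4\<close>, with equality only at \<open>-1/2\<close>.
\<close>

definition loop_interior :: "complex set" where
  "loop_interior = {z. cmod (z * (z + 1)) < 1/4 \<and> - 1/2 < Re z}"

definition loop_region :: "complex set" where
  "loop_region = {z. cmod (z * (z + 1)) \<le> 1/4 \<and> - 1/2 \<le> Re z}"

text \<open>
  Compare real and imaginary parts separately. For \<open>x = Re z\<close> the difference of the real parts is
  \<open>(1 + x) - r (1 + r x) = (1 - r) (1 + x (1 + r))\<close>, and \<open>1 + x (1 + r)\<close> is at least \<open>1 - (1 + r)/2\<close>.
  The half-plane is essential: between \<open>-1/2\<close> and \<open>-1\<close> on the real axis \<open>|z (z + 1)|\<close> decreases again.
\<close>

lemma radial_monotone: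
  assumes "- 1/2 \<le> Re z" "0 \<le> r" "r \<le> 1"
  shows "r * cmod (1 + of_real r * z) \<le> cmod (1 + z)"
proof (rule power2_le_imp_le)
  define x y where "x = Re z" and "y = Im z"
  have x: "- 1/2 \<le> x" using assms by (simp add: x_def)
  have A: "(r * cmod (1 + of_real r * z))\<^sup>2 = r\<^sup>2 * ((1 + r * x)\<^sup>2 + (r * y)\<^sup>2)"
    by (simp add: power_mult_distrib cmod_power2 x_def y_def)
  have B: "(cmod (1 + z))\<^sup>2 = (1 + x)\<^sup>2 + y\<^sup>2"
    by (simp add: cmod_power2 x_def y_def)
  have "r^4 \<le> 1" using assms by (simp add: power_le_one)
  then have y4: "r^4 * y\<^sup>2 \<le> y\<^sup>2" by (simp add: mult_left_le_one_le)
  have lin: "r + r * r * x \<le> 1 + x"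
  proof -
    have "0 \<le> (1 - r) * (1 + x * (1 + r))"
    proof (rule mult_nonneg_nonneg)
      have "x * (1 + r) \<ge> (- 1/2) * (1 + r)" using x assms by (intro mult_right_mono) auto
      then show "0 \<le> 1 + x * (1 + r)" using assms by (simp add: field_simps)
    qed (use assms in simp)
    then show ?thesis by (simp add: algebra_simps)
  qed
  have "0 \<le> 1 + r * x"
  proof -
    have "- 1/2 * 1 \<le> r * x"
    proof (cases "x \<ge> 0")
      case False
      then have "r * x \<ge> 1 * x" using assms by (intro mult_right_mono_neg) auto
      with x show ?thesis by simp
    next
      case True
      then have "0 \<le> r * x" using assms by simp
      then show ?thesis by simp
    qed
    then show ?thesis by simp
  qed
  then have "0 \<le> r * (1 + r * x)" using assms by simp
  moreover have "r * (1 + r * x) \<le> 1 + x" using lin by (simp add: algebra_simps)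
  ultimately have "(r * (1 + r * x))\<^sup>2 \<le> (1 + x)\<^sup>2" by (intro power_mono)
  with y4 show "(r * cmod (1 + of_real r * z))\<^sup>2 \<le> (cmod (1 + z))\<^sup>2"
    unfolding A B by (simp add: power_mult_distrib algebra_simps power2_eq_square power4_eq_xxxx)
qed simp

lemma cmod_product_radial:
  assumes "- 1/2 \<le> Re z" "0 \<le> r" "r \<le> 1"
  shows "cmod (of_real r * z * (of_real r * z + 1)) \<le> cmod (z * (z + 1))"
proof -
  have "cmod (of_real r * z * (of_real r * z + 1)) = cmod z * (r * cmod (1 + of_real r * z))"
    using assms by (simp add: norm_mult add.commute)
  also have "\<dots> \<le> cmod z * cmod (1 + z)"
    by (intro mult_left_mono radial_monotone assms) auto
  finally show ?thesis by (simp add: norm_mult add.commute)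
qed

lemma Re_scaled_ge:
  fixes z :: complex
  assumes "- 1/2 \<le> Re z" "0 \<le> r" "r \<le> 1"
  shows "- 1/2 \<le> r * Re z"
proof (cases "Re z \<ge> 0")
  case False
  then have "r * Re z \<ge> 1 * Re z" using assms by (intro mult_right_mono_neg) auto
  then show ?thesis using assms by simp
next
    case True
    then have "0 \<le> r * Re z" using assms by simp
    then show ?thesis by simp
  qed

lemma loop_region_radial:
  assumes "z \<in> loop_region" "0 \<le> r" "r \<le> 1"
  shows "of_real r * z \<in> loop_region"
  using cmod_product_radial[of z r] Re_scaled_ge[of z r] assms
  by (auto simp: loop_region_def)

lemma loop_interior_radial:
  assumes "z \<in> loop_interior" "0 \<le> r" "r \<le> 1"
  shows "of_real r * z \<in> loop_interior"
proof -
  have "- 1/2 < r * Re z"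
  proof (cases "Re z \<ge> 0")
    case False
    then have "r * Re z \<ge> 1 * Re z" using assms by (intro mult_right_mono_neg) auto
    then show ?thesis using assms by (simp add: loop_interior_def)
  next
    case True
    then have "0 \<le> r * Re z" using assms by simp
    then show ?thesis by simp
  qed
  then show ?thesis
    using cmod_product_radial[of z r] assms by (auto simp: loop_interior_def)
qed

lemma one_plus_ge_half:
  assumes "- 1/2 \<le> Re z"
  shows "1/2 \<le> cmod (1 + z)"
  using complex_Re_le_cmod[of "1 + z"] assms by simp

lemma loop_region_norm:
  assumes "z \<in> loop_region"
  shows "cmod z \<le> 1/2" "1/2 \<le> cmod (1 + z)" "cmod (1 + z) \<le> 3/2"
proof -
  show *: "1/2 \<le> cmod (1 + z)"
    using assms one_plus_ge_half by (simp add: loop_region_def)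
  have "cmod z * (1/2) \<le> cmod z * cmod (1 + z)" using * by (intro mult_left_mono) auto
  also have "\<dots> \<le> 1/4" using assms by (simp add: loop_region_def norm_mult add.commute)
  finally show "cmod z \<le> 1/2" by simp
  then show "cmod (1 + z) \<le> 3/2" using norm_triangle_ineq[of 1 z] by simp
qed

lemma square_of_affine: "(2 * z + 1)\<^sup>2 = 1 + 4 * (z * (z + 1))" for z :: complex
  by (simp add: power2_eq_square algebra_simps)

text \<open>
  For \<open>s = 2 z + 1\<close> both \<open>Re s\<close> and \<open>Re (s^2)\<close> are nonnegative, so \<open>s\<close> lies in the sector
  \<open>|Im s| \<le> Re s\<close>. Two points of this sector have nonnegative inner product, so
  \<open>|s - s'|^2 \<le> |s|^2 + |s'|^2 \<le> 4\<close>. Diameter at most \<open>1\<close> makes the logarithmic kernel nonnegative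
  on the region, and energies become nonnegative integrals.
\<close>

lemma loop_region_diam:
  assumes "z \<in> loop_region" "t \<in> loop_region"
  shows "cmod (z - t) \<le> 1"
proof -
  have key: "\<bar>Im (2*z+1)\<bar> \<le> Re (2*z+1) \<and> (cmod (2*z+1))\<^sup>2 \<le> 2" if "z \<in> loop_region" for z
  proof -
    have "cmod (4 * (z * (z+1))) \<le> 1" using that by (simp add: loop_region_def norm_mult)
    moreover have "- cmod (4 * (z * (z+1))) \<le> Re (4 * (z * (z+1)))"
      using abs_Re_le_cmod[of "4 * (z * (z+1))"] by linarith
    ultimately have "0 \<le> Re (1 + 4 * (z * (z+1)))" and n: "cmod (1 + 4 * (z * (z+1))) \<le> 2"
      using norm_triangle_ineq[of 1 "4 * (z * (z+1))"] by auto
    from this(1) have "0 \<le> Re ((2*z+1)\<^sup>2)" unfolding square_of_affine .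
    then have "(Im (2*z+1))\<^sup>2 \<le> (Re (2*z+1))\<^sup>2" by (simp only: Re_power2)
    then have "\<bar>Im (2*z+1)\<bar> \<le> \<bar>Re (2*z+1)\<bar>" by (simp only: abs_le_square_iff)
    moreover have "Re (2*z+1) \<ge> 0" using that by (simp add: loop_region_def)
    ultimately show ?thesis using n by (simp flip: norm_power square_of_affine)
  qed
  define a b where "a = 2*z+1" and "b = 2*t+1"
  have "\<bar>Im a\<bar> * \<bar>Im b\<bar> \<le> Re a * Re b"
    using key[OF assms(1)] key[OF assms(2)] unfolding a_def b_def by (intro mult_mono) auto
  then have "0 \<le> Re a * Re b + Im a * Im b"
    using abs_le_D2[of "Im a * Im b" "Re a * Re b"] by (simp add: abs_mult)
  then have "(cmod (a - b))\<^sup>2 \<le> (cmod a)\<^sup>2 + (cmod b)\<^sup>2"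
    by (simp add: cmod_power2 power2_diff algebra_simps)
  also have "\<dots> \<le> 4" using key[OF assms(1)] key[OF assms(2)] unfolding a_def b_def by simp
  finally have "(cmod (a - b))\<^sup>2 \<le> 2\<^sup>2" by simp
  then have "cmod (a - b) \<le> 2" by (rule power2_le_imp_le) simp
  moreover have "a - b = of_real 2 * (z - t)" by (simp add: a_def b_def)
  ultimately have "cmod (of_real 2 * (z - t)) \<le> 2" by metis
  then show ?thesis unfolding norm_mult norm_of_real by simp
qed

lemma loop_region_right_of_axis:
  assumes "z \<in> loop_region" "z \<noteq> - 1/2"
  shows "- 1/2 < Re z"
proof -
  have "Re z \<noteq> - 1/2"
  proof
    assume *: "Re z = - 1/2"
    with cmod_on_symmetry_axis[OF this] assms(1) have "z = - 1/2"
      by (auto simp: loop_region_def complex_eq_iff)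
    with assms(2) show False by simp
  qed
  then show ?thesis using assms(1) by (simp add: loop_region_def)
qed

lemma compact_in_loop_interior:
  assumes K: "compact K" "K \<subseteq> loop_interior"
  obtains r where "0 \<le> r" "r < 1" "\<And>z. z \<in> K \<Longrightarrow> 4 * cmod (z * (z + 1)) \<le> r"
proof (cases "K = {}")
  case True
  then show ?thesis using that[of 0] by simp
next
  case False
  have "continuous_on K (\<lambda>z. 4 * cmod (z * (z + 1)))" by (intro continuous_intros)
  then obtain z0 where "z0 \<in> K" "\<forall>z\<in>K. 4 * cmod (z * (z + 1)) \<le> 4 * cmod (z0 * (z0 + 1))"
    using continuous_attains_sup[OF K(1) False] by blast
  moreover have "4 * cmod (z0 * (z0 + 1)) < 1"
    using K(2) \<open>z0 \<in> K\<close> by (auto simp: loop_interior_def)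
  ultimately show ?thesis using that[of "4 * cmod (z0 * (z0 + 1))"] by auto
qed

lemma one_plus_disc_slit:
  assumes "cmod u \<le> 1" "u \<noteq> - 1"
  shows "1 + u \<notin> \<real>\<^sub>\<le>\<^sub>0"
proof
  assume "1 + u \<in> \<real>\<^sub>\<le>\<^sub>0"
  then obtain r where r: "1 + u = of_real r" "r \<le> 0" by (rule nonpos_Reals_cases)
  have u: "u = of_real (r - 1)" using r(1) by (simp add: algebra_simps)
  then have "cmod u = \<bar>r - 1\<bar>" by (metis norm_of_real)
  then have "r = 0" using r(2) assms by auto
  with u assms show False by simp
qed

lemma open_loop_interior: "open loop_interior"
  unfolding loop_interior_def by (intro open_Collect_conj open_Collect_less continuous_intros)

lemma closed_loop_region: "closed loop_region"
  unfolding loop_region_def by (intro closed_Collect_conj closed_Collect_le continuous_intros)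

lemma compact_loop_region: "compact loop_region"
proof -
  have "loop_region \<subseteq> cball 0 (1/2)" using loop_region_norm by auto
  then show ?thesis
    using closed_loop_region bounded_subset[OF bounded_cball] compact_eq_bounded_closed by blast
qed

lemma zero_in_loop_interior: "0 \<in> loop_interior"
  by (simp add: loop_interior_def)

lemma loop_interior_subset: "loop_interior \<subseteq> loop_region"
  by (auto simp: loop_interior_def loop_region_def)

lemma connected_loop_interior: "connected loop_interior"
proof (rule starlike_imp_connected)
  show "starlike loop_interior"
    unfolding starlike_def
  proof (intro bexI[OF _ zero_in_loop_interior] ballI subsetI)
    fix z w assume "z \<in> loop_interior" "w \<in> closed_segment 0 z"
    then show "w \<in> loop_interior"
      using loop_interior_radial by (auto simp: in_segment scaleR_conv_of_real)
  qed
qed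

lemma loop_region_minus_boundary: "loop_region - lemniscate_plus = loop_interior"
proof -
  have "cmod (z * (z + 1)) = 1/4" if "z \<in> loop_region" "Re z = - 1/2" for z
    using cmod_on_symmetry_axis[OF that(2)] that(1) by (auto simp: loop_region_def)
  then show ?thesis
    unfolding loop_region_def loop_interior_def lemniscate_plus_def lemniscate_def
    by (auto simp: order.order_iff_strict)
qed

lemma lemniscate_plus_subset: "lemniscate_plus \<subseteq> loop_region"
  by (auto simp: loop_region_def lemniscate_plus_def lemniscate_def)

text \<open>
  The maximum modulus principle for \<open>z (z + 1)\<close> alone would allow the left loop as well. Applied to
  \<open>z\<close> itself it gives \<open>|z| \<le> 1/2\<close>, which leaves only the right half-plane.
\<close>

lemma bounded_by_lemniscate_plus:
  assumes "open G" "bounded G" "frontier G = lemniscate_plus"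
  shows "G \<subseteq> loop_interior"
proof
  fix z assume z: "z \<in> G"
  have fr: "w \<in> lemniscate_plus" if "w \<in> frontier G" for w using that assms by simp
  have b1: "cmod (w * (w + 1)) \<le> 1/4" if "w \<in> frontier G" for w
    using fr[OF that] by (simp add: lemniscate_plus_def lemniscate_def)
  have 1: "cmod (z * (z + 1)) \<le> 1/4"
    by (rule maximum_modulus_frontier[where f="\<lambda>z. z * (z+1)", OF _ _ assms(2) b1 z])
       (auto intro!: holomorphic_intros continuous_intros)
  have b2: "cmod w \<le> 1/2" if "w \<in> frontier G" for w
    using fr[OF that] lemniscate_plus_subset loop_region_norm by blast
  have "cmod z \<le> 1/2"
    by (rule maximum_modulus_frontier[where f="\<lambda>z. z", OF _ _ assms(2) b2 z])
       (auto intro!: holomorphic_intros continuous_intros)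
  then have "- 1/2 \<le> Re z" using abs_Re_le_cmod[of z] by linarith
  with 1 have "z \<in> loop_region" by (simp add: loop_region_def)
  moreover have "z \<notin> lemniscate_plus"
    using z assms by (metis disjoint_iff frontier_disjoint_eq)
  ultimately show "z \<in> loop_interior" using loop_region_minus_boundary by blast
qed

text \<open>
  The frontier of \<open>G\<close> misses the connected set \<open>loop_interior\<close>, so \<open>G\<close> cannot be a proper nonempty
  part of it.
\<close>

lemma domain_of_lemniscate_plus:
  assumes "open G" "bounded G" "frontier G = lemniscate_plus"
  shows "G = loop_interior" "closure G = loop_region"
proof -
  have sub: "G \<subseteq> loop_interior" using bounded_by_lemniscate_plus assms by blast
  have "- 1/2 \<in> lemniscate_plus"
    using lemniscate_loops_meet by blast
  then have ne: "G \<noteq> {}" using assms by auto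
  have dis: "loop_interior \<inter> frontier G = {}"
    using loop_region_minus_boundary assms by blast
  show "G = loop_interior"
  proof (rule ccontr)
    assume "G \<noteq> loop_interior"
    then have "loop_interior - G \<noteq> {}" using sub by blast
    moreover have "loop_interior \<inter> G \<noteq> {}" using sub ne by blast
    ultimately show False
      using connected_Int_frontier[OF connected_loop_interior] dis by blast
  qed
  then have "closure G = loop_interior \<union> lemniscate_plus"
    using assms closure_Un_frontier[of G] by simp
  then show "closure G = loop_region"
    using loop_region_minus_boundary lemniscate_plus_subset by blast
qed

section \<open>Taylor polynomials of powers and their remainder\<close>

definition neg_binom :: "nat \<Rightarrow> nat \<Rightarrow> complex" where
  "neg_binom n k = (- of_nat n) gchoose k"

text \<open>
  The Taylor polynomial of order \<open>m\<close> of \<open>(1 + z)^(-n)\<close> about \<open>0\<close>. The order is kept independent of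
  the exponent because the approximation theorem needs orders \<open>n - d\<close>.
\<close>

definition binom_taylor :: "nat \<Rightarrow> nat \<Rightarrow> complex poly" where
  "binom_taylor n m = (\<Sum>k\<le>m. monom (neg_binom n k) k)"

lemma neg_binom_0 [simp]: "neg_binom n 0 = 1"
  by (simp add: neg_binom_def)

lemma neg_binom_Suc: "of_nat (Suc k) * neg_binom n (Suc k) = - (of_nat (n + k) * neg_binom n k)"
  using gbinomial_mult_1[of "- of_nat n :: complex" k]
  by (simp add: neg_binom_def algebra_simps)

lemma neg_binom_binomial:
  assumes "n > 0"
  shows "neg_binom n k = (- 1) ^ k * of_nat ((n + k - 1) choose k)"
proof -
  have "of_nat (n + k - 1) = (of_nat n + of_nat k - 1 :: complex)"
    using assms by (simp add: of_nat_diff)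
  then show ?thesis
    using gbinomial_minus[of "of_nat n :: complex" k] by (simp add: neg_binom_def binomial_gbinomial)
qed

lemma norm_neg_binom: "n > 0 \<Longrightarrow> cmod (neg_binom n k) = real ((n + k - 1) choose k)"
  by (simp add: neg_binom_binomial norm_mult norm_power)

lemma neg_binom_central:
  assumes "n > 0"
  shows "2 * neg_binom n n = (- 1) ^ n * of_nat ((2 * n) choose n)"
proof -
  obtain k where k: "n = Suc k" using assms by (cases n) auto
  have "(2 * n) choose n = (2 * k + 1 choose k) + (2 * k + 1 choose Suc k)"
    by (simp add: k)
  moreover have "(2 * k + 1) choose k = (2 * k + 1) choose (Suc k)"
    using binomial_symmetric[of k "2 * k + 1"] by simp
  ultimately have "(2 * n) choose n = 2 * (2 * k + 1 choose Suc k)" by simp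
  moreover have "2 * k + 1 = n + n - 1" "Suc k = n" using k by auto
  ultimately have "(2 * n) choose n = 2 * ((n + n - 1) choose n)" by metis
  then show ?thesis unfolding neg_binom_binomial[OF assms, of n] by simp
qed

lemma norm_neg_binom_central: "n > 0 \<Longrightarrow> 2 * cmod (neg_binom n n) = real ((2 * n) choose n)"
proof -
  assume n: "n > 0"
  have "cmod (2 * neg_binom n n) = real ((2 * n) choose n)"
    unfolding neg_binom_central[OF n] by (simp add: norm_mult norm_power)
  then show ?thesis by (simp add: norm_mult)
qed

lemma neg_binom_nonzero: "n > 0 \<Longrightarrow> neg_binom n k \<noteq> 0"
  using norm_neg_binom[of n k] by auto

lemma norm_neg_binom_le:
  assumes "n > 0" "k \<le> n"
  shows "cmod (neg_binom n k) \<le> 4 ^ n"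
proof -
  have "(n + k - 1) choose k \<le> 2 ^ (n + k - 1)" by (rule binomial_le_pow2)
  also have "\<dots> \<le> 2 ^ (2 * n)" using assms by (intro power_increasing) auto
  also have "(2::nat) ^ (2 * n) = 4 ^ n" by (simp add: power_mult)
  finally have "real ((n + k - 1) choose k) \<le> real (4 ^ n)" by (simp only: of_nat_le_iff)
  then show ?thesis using norm_neg_binom[OF assms(1)] by simp
qed

lemma coeff_binom_taylor: "coeff (binom_taylor n m) k = (if k \<le> m then neg_binom n k else 0)"
proof -
  have "coeff (binom_taylor n m) k = (\<Sum>j\<le>m. if j = k then neg_binom n k else 0)"
    unfolding binom_taylor_def coeff_sum by (intro sum.cong) (auto)
  then show ?thesis by simp
qed

lemma degree_binom_taylor_le: "degree (binom_taylor n m) \<le> m"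
  by (rule degree_le) (simp add: coeff_binom_taylor)

lemma degree_binom_taylor:
  assumes "n > 0 \<or> m = 0"
  shows "degree (binom_taylor n m) = m" "lead_coeff (binom_taylor n m) = neg_binom n m"
proof -
  have "neg_binom n m \<noteq> 0" using assms neg_binom_nonzero by auto
  then have "coeff (binom_taylor n m) m \<noteq> 0" by (simp add: coeff_binom_taylor)
  then show "degree (binom_taylor n m) = m"
    using le_degree degree_binom_taylor_le le_antisym by blast
  then show "lead_coeff (binom_taylor n m) = neg_binom n m"
    by (simp add: coeff_binom_taylor)
qed

lemma higher_deriv_one_plus_powi:
  assumes "z \<noteq> - 1"
  shows "(deriv ^^ k) (\<lambda>z::complex. (1 + z) powi (- int n)) z =
           fact k * neg_binom n k * (1 + z) powi (- int n - int k)"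
  using assms
proof (induction k arbitrary: z)
  case (Suc k)
  have nz: "1 + z \<noteq> 0" using Suc.prems by (simp add: add_eq_0_iff)
  have "\<forall>\<^sub>F x in nhds z. x \<in> - {- 1 :: complex}"
    using Suc.prems by (intro eventually_nhds_in_open) auto
  then have ev: "\<forall>\<^sub>F x in nhds z. (deriv ^^ k) (\<lambda>z. (1 + z) powi (- int n)) x =
                     fact k * neg_binom n k * (1 + x) powi (- int n - int k)"
    by (rule eventually_mono) (use Suc.IH in auto)
  have "(deriv ^^ Suc k) (\<lambda>z. (1 + z) powi (- int n)) z =
          deriv (\<lambda>x. fact k * neg_binom n k * (1 + x) powi (- int n - int k)) z"
    using deriv_cong_ev[OF ev refl] by simp
  also have "\<dots> = fact k * neg_binom n k * (of_int (- int n - int k) * (1 + z) powi (- int n - int k - 1))"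
    using nz by (intro DERIV_imp_deriv) (auto intro!: derivative_eq_intros)
  also have "\<dots> = fact k * (- (of_nat (n + k) * neg_binom n k)) * (1 + z) powi (- int n - int k - 1)"
    by (simp add: algebra_simps)
  also have "\<dots> = fact (Suc k) * neg_binom n (Suc k) * (1 + z) powi (- int n - int (Suc k))"
    unfolding neg_binom_Suc[symmetric] by (simp add: algebra_simps)
  finally show ?case .
qed simp

lemma taylor_poly_one_plus_powi:
  "taylor_poly m (\<lambda>z. (1 + z) powi (- int n)) = binom_taylor n m"
  unfolding taylor_poly_def binom_taylor_def
  by (intro sum.cong refl) (simp add: higher_deriv_one_plus_powi)

text \<open>
  The recursion \<open>neg_binom_Suc\<close> of the coefficients is the differential equation
  \<open>n y + (1 + z) y' = 0\<close>, read off coefficient by coefficient; truncation leaves one term.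
\<close>

lemma binom_taylor_ode:
  "of_nat n * poly (binom_taylor n m) z + (1 + z) * poly (pderiv (binom_taylor n m)) z
     = of_nat (n + m) * neg_binom n m * z ^ m"
proof (induction m)
  case 0
  then show ?case by (simp add: binom_taylor_def monom_0)
next
  case (Suc m)
  have S: "binom_taylor n (Suc m) = binom_taylor n m + monom (neg_binom n (Suc m)) (Suc m)"
    by (simp add: binom_taylor_def)
  have "of_nat n * poly (binom_taylor n (Suc m)) z
        + (1 + z) * poly (pderiv (binom_taylor n (Suc m))) z
      = (of_nat n * poly (binom_taylor n m) z + (1 + z) * poly (pderiv (binom_taylor n m)) z)
        + of_nat n * neg_binom n (Suc m) * z ^ Suc m
        + (1 + z) * (of_nat (Suc m) * neg_binom n (Suc m)) * z ^ m"
    unfolding S by (simp add: pderiv_add pderiv_monom poly_monom algebra_simps)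
  also have "\<dots> = of_nat n * neg_binom n (Suc m) * z ^ Suc m
        + z * (of_nat (Suc m) * neg_binom n (Suc m)) * z ^ m"
    unfolding Suc by (simp only: neg_binom_Suc) (simp add: algebra_simps)
  also have "\<dots> = of_nat (n + Suc m) * neg_binom n (Suc m) * z ^ Suc m"
    by (simp add: algebra_simps)
  finally show ?case .
qed

definition taylor_defect :: "nat \<Rightarrow> nat \<Rightarrow> complex \<Rightarrow> complex" where
  "taylor_defect n m z = 1 - (1 + z) ^ n * poly (binom_taylor n m) z"

lemma taylor_defect_0: "taylor_defect n m 0 = 0"
  by (simp add: taylor_defect_def poly_0_coeff_0 coeff_binom_taylor)

lemma taylor_defect_deriv:
  assumes "n > 0"
  shows "(taylor_defect n m has_field_derivative
            - (of_nat (n + m) * neg_binom n m * z ^ m * (1 + z) ^ (n - 1))) (at z within S)"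
proof -
  have pw: "(1 + z) ^ n = (1 + z) * (1 + z) ^ (n - 1)"
    using assms by (cases n) auto
  have "((\<lambda>z. 1 - (1 + z) ^ n * poly (binom_taylor n m) z) has_field_derivative
          - (of_nat n * (1 + z) ^ (n - 1) * poly (binom_taylor n m) z
             + (1 + z) ^ n * poly (pderiv (binom_taylor n m)) z)) (at z within S)"
    by (auto intro!: derivative_eq_intros poly_DERIV[THEN has_field_derivative_at_within] simp: algebra_simps)
  also have "of_nat n * (1 + z) ^ (n - 1) * poly (binom_taylor n m) z
             + (1 + z) ^ n * poly (pderiv (binom_taylor n m)) z
           = (1 + z) ^ (n - 1) * (of_nat n * poly (binom_taylor n m) z
               + (1 + z) * poly (pderiv (binom_taylor n m)) z)"
    unfolding pw by (simp add: algebra_simps)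
  also have "\<dots> = of_nat (n + m) * neg_binom n m * z ^ m * (1 + z) ^ (n - 1)"
    unfolding binom_taylor_ode by (simp add: algebra_simps)
  finally show ?thesis unfolding taylor_defect_def .
qed

text \<open>
  Integrate the derivative over the segment from \<open>0\<close> to \<open>z\<close>, on which \<open>|t (t + 1)|\<close> is at most
  \<open>|z (z + 1)|\<close>. The factors of \<open>1 + t\<close> that are not paired with a factor \<open>t\<close> lie between \<open>1/2\<close> and
  \<open>3/2\<close> in modulus and are estimated crudely.
\<close>

lemma taylor_defect_bound:
  assumes n: "n > 0" "m \<le> n" and z: "z \<in> loop_region"
  shows "cmod (taylor_defect n m z) \<le> 2 * n * 8 ^ (n - m) * (4 * cmod (z * (z + 1))) ^ m"
proof -
  define \<rho> where "\<rho> = cmod (z * (z + 1))"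
  define B where "B = 2 * n * 4 ^ n * (2 * 2 ^ (n - m) * \<rho> ^ m)"
  have "norm (taylor_defect n m z - taylor_defect n m 0) \<le> B * norm (z - 0)"
  proof (rule field_differentiable_bound[where S="closed_segment 0 z"])
    fix t assume "t \<in> closed_segment 0 z"
    then obtain r where r: "0 \<le> r" "r \<le> 1" and t: "t = of_real r * z"
      by (auto simp: in_segment scaleR_conv_of_real)
    have tr: "t \<in> loop_region" unfolding t using loop_region_radial[OF z r] .
    have "cmod (t * (t + 1)) \<le> \<rho>"
      unfolding t \<rho>_def using cmod_product_radial[of z r] z r by (simp add: loop_region_def)
    then have p: "cmod t ^ m * cmod (1 + t) ^ m \<le> \<rho> ^ m"
      by (simp flip: power_mult_distrib norm_mult add: add.commute power_mono)
    have q: "cmod (1 + t) ^ (n - m) \<le> 2 ^ (n - m)"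
      using loop_region_norm(3)[OF tr] by (intro power_mono) auto
    have "cmod (1 + t) ^ (n - 1) = cmod (1 + t) ^ n / cmod (1 + t)"
      using n loop_region_norm(2)[OF tr] by (cases n) auto
    also have "\<dots> \<le> cmod (1 + t) ^ n / (1/2)"
      using loop_region_norm(2)[OF tr] by (intro divide_left_mono) auto
    also have "cmod (1 + t) ^ n = cmod (1 + t) ^ m * cmod (1 + t) ^ (n - m)"
      using n by (simp flip: power_add)
    finally have "cmod t ^ m * cmod (1 + t) ^ (n - 1)
        \<le> cmod t ^ m * (cmod (1 + t) ^ m * cmod (1 + t) ^ (n - m) * 2)"
      by (intro mult_left_mono) auto
    also have "\<dots> = (cmod t ^ m * cmod (1 + t) ^ m) * (2 * cmod (1 + t) ^ (n - m))" by simp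
    also have "\<dots> \<le> \<rho> ^ m * (2 * 2 ^ (n - m))"
      using p q by (intro mult_mono) (auto simp: \<rho>_def)
    finally have k: "cmod t ^ m * cmod (1 + t) ^ (n - 1) \<le> 2 * 2 ^ (n - m) * \<rho> ^ m"
      by (simp add: mult_ac)
    have "norm (- (of_nat (n + m) * neg_binom n m * t ^ m * (1 + t) ^ (n - 1)))
        = real (n + m) * cmod (neg_binom n m) * (cmod t ^ m * cmod (1 + t) ^ (n - 1))"
      by (simp add: norm_mult norm_power del: of_nat_add)
    also have "\<dots> \<le> real (2 * n) * 4 ^ n * (2 * 2 ^ (n - m) * \<rho> ^ m)"
      using n norm_neg_binom_le by (intro mult_mono[OF mult_mono k]) auto
    also have "\<dots> = B" by (simp add: B_def)
    finally show "norm (- (of_nat (n + m) * neg_binom n m * t ^ m * (1 + t) ^ (n - 1))) \<le> B" .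
  qed (use n taylor_defect_deriv in auto)
  also have "\<dots> \<le> B * (1/2)"
    using loop_region_norm(1)[OF z] by (intro mult_left_mono) (auto simp: B_def \<rho>_def)
  also have "B * (1/2) = 2 * n * 8 ^ (n - m) * (4 * \<rho>) ^ m"
  proof -
    have "(4::real) ^ n = 4 ^ (n - m) * 4 ^ m" using n by (simp flip: power_add)
    moreover have "(8::real) ^ (n - m) = 4 ^ (n - m) * 2 ^ (n - m)" by (simp flip: power_mult_distrib)
    ultimately show ?thesis by (simp add: B_def power_mult_distrib)
  qed
  finally show ?thesis by (simp add: taylor_defect_0 \<rho>_def)
qed

section \<open>Asymptotics of the remainder\<close>

lemma central_binomial_Suc:
  "real ((2 * Suc n) choose Suc n) * (real n + 1) = 2 * (2 * real n + 1) * real ((2 * n) choose n)"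
proof -
  have "Suc n * (2 * Suc n choose Suc n) = 2 * Suc n * (2 * n + 1 choose n)"
    using binomial_absorption[of n "2 * Suc n"] by simp
  then have "Suc n * (2 * Suc n choose Suc n) = Suc n * (2 * (2 * n + 1 choose n))"
    by (simp only: mult_ac)
  then have "2 * Suc n choose Suc n = 2 * (2 * n + 1 choose n)" by (simp only: mult_cancel1) simp
  moreover have "(n + 1) * (2 * n + 1 choose n) = (2 * n + 1) * (2 * n choose n)"
    using binomial_absorb_comp[of "2 * n + 1" n] by simp
  ultimately have "(2 * Suc n choose Suc n) * (n + 1) = 2 * (2 * n + 1) * (2 * n choose n)"
    by (metis mult.assoc mult.commute)
  then have "real ((2 * Suc n choose Suc n) * (n + 1)) = real (2 * (2 * n + 1) * (2 * n choose n))"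
    by (simp only:)
  then show ?thesis by (simp only: of_nat_mult of_nat_add of_nat_1 of_nat_numeral)
qed

lemma central_binomial_ratio:
  "real ((2 * Suc n) choose Suc n) / 4 ^ Suc n
     = real ((2 * n) choose n) / 4 ^ n * ((2 * real n + 1) / (2 * real n + 2))"
proof -
  have *: "x / 4 ^ Suc n = y / 4 ^ n * ((2 * real n + 1) / (2 * real n + 2))"
    if "x * (real n + 1) = 2 * (2 * real n + 1) * y" for x y :: real
    using that by (simp add: divide_simps) (simp add: algebra_simps)
  show ?thesis by (rule *) (rule central_binomial_Suc)
qed

text \<open>
  The partial products of Wallis's product are the reciprocals of \<open>2 n + 1\<close> times the square of
  the central binomial coefficient divided by \<open>4^n\<close>.
\<close>

lemma central_binomial_wallis:
  "(\<Prod>k=1..n. (4 * real k^2) / (4 * real k^2 - 1)) * (2 * n + 1)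
      * (real ((2 * n) choose n) / 4 ^ n)\<^sup>2 = 1"
proof (induction n)
  case (Suc n)
  define b where "b = real ((2 * n) choose n) / 4 ^ n"
  define P where "P = (\<Prod>k=1..n. (4 * real k^2) / (4 * real k^2 - 1))"
  have b': "real ((2 * Suc n) choose Suc n) / 4 ^ Suc n = b * ((2 * real n + 1) / (2 * real n + 2))"
    unfolding b_def by (rule central_binomial_ratio)
  have f: "(4 * real (Suc n)^2) / (4 * real (Suc n)^2 - 1) = (2 * real n + 2)\<^sup>2 / ((2 * real n + 1) * (2 * real n + 3))"
    by (simp add: power2_eq_square algebra_simps)
  have "(\<Prod>k=1..Suc n. (4 * real k^2) / (4 * real k^2 - 1)) * (2 * Suc n + 1)
      * (real ((2 * Suc n) choose Suc n) / 4 ^ Suc n)\<^sup>2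
      = P * ((2 * real n + 2)\<^sup>2 / ((2 * real n + 1) * (2 * real n + 3))) * (2 * real n + 3) * (b * ((2 * real n + 1) / (2 * real n + 2)))\<^sup>2"
    unfolding b' P_def f[symmetric] by (simp add: algebra_simps)
  also have "\<dots> = P * b\<^sup>2 * (((2 * real n + 2)\<^sup>2 / ((2 * real n + 1) * (2 * real n + 3))) * (2 * real n + 3) * ((2 * real n + 1) / (2 * real n + 2))\<^sup>2)"
    by (simp add: power_mult_distrib power_divide)
  also have "((2 * real n + 2)\<^sup>2 / ((2 * real n + 1) * (2 * real n + 3))) * (2 * real n + 3) * ((2 * real n + 1) / (2 * real n + 2))\<^sup>2 = 2 * real n + 1"
  proof -
    have "c\<^sup>2 / (a * b) * b * (a / c)\<^sup>2 = a" if "a \<noteq> 0" "b \<noteq> 0" "c \<noteq> 0" for a b c :: real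
      using that by (simp add: power_divide power2_eq_square)
    from this[of "2 * real n + 1" "2 * real n + 3" "2 * real n + 2"] show ?thesis by linarith
  qed
  also have "P * b\<^sup>2 * (2 * real n + 1) = 1"
    using Suc by (simp add: P_def b_def mult_ac add.commute)
  finally show ?case .
qed simp

text \<open>
  The sequence \<open>n x\<close> increases to \<open>1/\<pi>\<close> and \<open>(2 n + 1) x\<close> decreases to \<open>2/\<pi>\<close>, both limits coming
  from Wallis's product. These one-sided bounds already contain the error term \<open>O(1/n)\<close>.
\<close>

lemma central_binomial_bounds:
  assumes n: "n > 0"
  defines "x \<equiv> (real ((2 * n) choose n) / 4 ^ n)\<^sup>2"
  shows "pi * n * x \<le> 1" "1 \<le> pi * (n + 1/2) * x"
proof -
  define X where "X = (\<lambda>n. (real ((2 * n) choose n) / 4 ^ n)\<^sup>2)"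
  have rec: "X (Suc n) = X n * ((2 * real n + 1) / (2 * real n + 2))\<^sup>2" for n
    by (simp only: X_def power_mult_distrib central_binomial_ratio)
  have X0: "X n \<ge> 0" for n by (simp add: X_def)
  have "(\<lambda>n. inverse (\<Prod>k=1..n. (4 * real k^2) / (4 * real k^2 - 1))) \<longlonglongrightarrow> inverse (pi / 2)"
    by (intro tendsto_inverse wallis) auto
  also have "(\<lambda>n. inverse (\<Prod>k=1..n. (4 * real k^2) / (4 * real k^2 - 1))) = (\<lambda>n. (2 * n + 1) * X n)"
    using central_binomial_wallis by (intro ext inverse_unique) (simp add: X_def mult.assoc add.commute)
  finally have B: "(\<lambda>n. (2 * n + 1) * X n) \<longlonglongrightarrow> 2 / pi" by (simp add: add.commute)
  have "decseq (\<lambda>n. (2 * n + 1) * X n)"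
  proof (rule decseq_SucI)
    fix n
    have "(2 * Suc n + 1) * X (Suc n) = X n * ((2 * real n + 3) * ((2 * real n + 1) / (2 * real n + 2))\<^sup>2)"
      by (simp add: rec mult_ac)
    also have "\<dots> \<le> X n * (2 * n + 1)"
    proof (intro mult_left_mono X0)
      have "(2 * real n + 3) * (2 * n + 1) \<le> (2 * real n + 2)\<^sup>2"
        by (simp add: power2_eq_square algebra_simps)
      then have "(2 * real n + 3) * (2 * n + 1) * (2 * n + 1) / (2 * real n + 2)\<^sup>2 \<le> 2 * n + 1"
        by (simp add: divide_simps)
      then show "(2 * real n + 3) * ((2 * real n + 1) / (2 * real n + 2))\<^sup>2 \<le> 2 * n + 1"
        by (simp add: power2_eq_square mult_ac add.commute)
    qed
    finally show "(2 * Suc n + 1) * X (Suc n) \<le> (2 * n + 1) * X n" by (simp add: mult_ac)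
  qed
  then have "2 / pi \<le> (2 * n + 1) * X n"
    using decseq_ge[OF _ B] by blast
  then show "1 \<le> pi * (n + 1/2) * x"
    by (simp add: x_def X_def field_simps)
  have "(\<lambda>n. real n / (2 * real n + 1)) \<longlonglongrightarrow> 1 / 2"
    by real_asymp
  from tendsto_mult[OF B this] have "(\<lambda>n. real n * X n) \<longlonglongrightarrow> 2 / pi * (1 / 2)"
  proof (rule Lim_transform_eventually, intro always_eventually allI)
    fix n
    have "2 * real n + 1 \<noteq> 0" by linarith
    then show "(2 * n + 1) * X n * (real n / (2 * real n + 1)) = real n * X n"
      by (simp add: add.commute)
  qed
  then have A: "(\<lambda>n. real n * X n) \<longlonglongrightarrow> 1 / pi" by simp
  have "incseq (\<lambda>n. real n * X n)"
  proof (rule incseq_SucI)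
    fix n
    have "real n * X n = X n * n" by simp
    also have "\<dots> \<le> X n * (Suc n * ((2 * real n + 1) / (2 * real n + 2))\<^sup>2)"
    proof (intro mult_left_mono X0)
      have "4 * real n * (n + 1) \<le> (2 * n + 1)\<^sup>2"
        by (simp add: power2_eq_square algebra_simps)
      then have "real n \<le> (2 * n + 1)\<^sup>2 / (4 * (n + 1))"
        by (simp add: field_simps)
      also have "\<dots> = Suc n * ((2 * real n + 1) / (2 * real n + 2))\<^sup>2"
        by (simp add: power2_eq_square divide_simps) (simp add: algebra_simps)
      finally show "real n \<le> Suc n * ((2 * real n + 1) / (2 * real n + 2))\<^sup>2" .
    qed
    finally show "real n * X n \<le> Suc n * X (Suc n)" by (simp add: rec mult_ac)
  qed
  then have "real n * X n \<le> 1 / pi"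
    using incseq_le[OF _ A] by blast
  then show "pi * n * x \<le> 1"
    by (simp add: x_def X_def field_simps)
qed

lemma central_binomial_asymptotic:
  assumes n: "n > 0"
  defines "\<beta> \<equiv> real ((2 * n) choose n) * sqrt (n * pi) / 4 ^ n"
  shows "0 \<le> \<beta>" "\<beta> \<le> 1" "\<bar>\<beta> - 1\<bar> \<le> 1 / n"
proof -
  define x where "x = (real ((2 * n) choose n) / 4 ^ n)\<^sup>2"
  have sq: "\<beta>\<^sup>2 = pi * n * x"
    using n by (simp add: \<beta>_def x_def power_mult_distrib power_divide mult_ac)
  show 0: "0 \<le> \<beta>" using n by (simp add: \<beta>_def)
  have "\<beta>\<^sup>2 \<le> 1\<^sup>2" unfolding sq using central_binomial_bounds[OF n] by (simp add: x_def)
  then show 1: "\<beta> \<le> 1" by (rule power2_le_imp_le) simp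
  have "pi * (n + 1/2) * x = \<beta>\<^sup>2 * (1 + 1 / (2 * n))"
    unfolding sq using n by (simp add: field_simps)
  then have "1 \<le> \<beta>\<^sup>2 * (1 + 1 / (2 * n))"
    using central_binomial_bounds(2)[OF n] unfolding x_def[symmetric] by simp
  also have "\<dots> \<le> \<beta> * (1 + 1 / (2 * n))"
    using 0 1 by (intro mult_right_mono) (auto simp: power2_eq_square mult_left_le)
  also have "\<dots> = \<beta> + \<beta> / (2 * n)" by (simp add: algebra_simps)
  also have "\<beta> / (2 * n) \<le> 1 / n"
    using 0 1 n by (simp add: divide_simps)
  finally show "\<bar>\<beta> - 1\<bar> \<le> 1 / n" using 1 by simp
qed

text \<open>
  Let \<open>u = 4 z (z + 1)\<close> and \<open>q(s) = sqrt (1 + s u)\<close>. The path \<open>(q(s) - 1) / 2\<close> leads from \<open>0\<close> to \<open>z\<close>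
  and lies over the radius \<open>s u\<close> of the disc. Along it the defect has derivative
  \<open>n K (s u / 4)^(n - 1) (u / 4) A(s)\<close> with \<open>A = 1/2 - 1/(2 q)\<close>. Subtracting \<open>K (s u / 4)^n A(s)\<close>
  leaves a function whose derivative carries the factor \<open>s^n\<close> and no factor \<open>n\<close>; its integral is
  smaller than the main term by the order \<open>1/n\<close>. The assumption \<open>z \<noteq> -1/2\<close> keeps \<open>q\<close> away from \<open>0\<close>.
\<close>

lemma taylor_defect_expansion:
  assumes z: "z \<in> loop_region" "z \<noteq> - 1/2"
  obtains M where "\<And>n. n > 0 \<Longrightarrow>
    cmod (taylor_defect n n z - (- 1) ^ (n + 1) * of_nat ((2 * n) choose n) * (z * (z + 1)) ^ n * (z / (2 * z + 1)))
      \<le> real ((2 * n) choose n) * cmod (z * (z + 1)) ^ n * (M / n)"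
proof -
  define u where "u = 4 * (z * (z + 1))"
  define q where "q = (\<lambda>s::real. csqrt (1 + of_real s * u))"
  have u1: "cmod u \<le> 1" using z by (simp add: u_def loop_region_def norm_mult)
  have Re_pos: "0 < Re (2 * z + 1)" using loop_region_right_of_axis[OF z] by simp
  have "2 * z + 1 \<noteq> 0" using loop_region_right_of_axis[OF z] by (auto simp: complex_eq_iff)
  moreover have uz: "1 + u = (2 * z + 1)\<^sup>2" by (simp add: u_def square_of_affine)
  ultimately have u2: "u \<noteq> - 1" by auto
  have notneg: "1 + of_real s * u \<notin> \<real>\<^sub>\<le>\<^sub>0" if s: "0 \<le> s" "s \<le> 1" for s
  proof (rule one_plus_disc_slit)
    have su: "cmod (of_real s * u) = s * cmod u" using s by (simp add: norm_mult)
    have le: "s * cmod u \<le> s * 1" using s u1 by (intro mult_left_mono) auto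
    then show "cmod (of_real s * u) \<le> 1" using s su by linarith
    show "of_real s * u \<noteq> - 1"
    proof
      assume eq: "of_real s * u = - 1"
      then have "s * cmod u = 1" unfolding su[symmetric] by simp
      then have "s = 1" using le s by simp
      then show False using eq u2 by simp
    qed
  qed
  have q2: "(q s)\<^sup>2 = 1 + of_real s * u" for s by (simp add: q_def)
  have qnz: "q s \<noteq> 0" if "0 \<le> s" "s \<le> 1" for s
    using notneg[OF that] by (auto simp: q_def)
  have q1: "q 1 = 2 * z + 1"
    using uz Re_pos by (simp add: q_def csqrt_square)
  have contq: "continuous_on {0..1} q"
    unfolding q_def
    by (intro continuous_at_imp_continuous_on ballI continuous_intros continuous_within_csqrt
          continuous_at_compose[unfolded o_def, of _ "\<lambda>s. 1 + of_real s * u" csqrt])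
       (use notneg in auto)
  obtain c where c: "c > 0" "\<And>s. 0 \<le> s \<Longrightarrow> s \<le> 1 \<Longrightarrow> c \<le> cmod (q s)"
  proof -
    have "continuous_on {0..1} (\<lambda>s. cmod (q s))" by (intro continuous_intros contq)
    then obtain x where "x \<in> {0..1}" "\<forall>y\<in>{0..1}. cmod (q x) \<le> cmod (q y)"
      using continuous_attains_inf[of "{0..1::real}"] by (metis atLeastAtMost_iff compact_Icc empty_iff zero_le_one order_refl)
    then show ?thesis using that[of "cmod (q x)"] qnz[of x] by auto
  qed
  \<comment> \<open>A bound for \<open>A' = u / (4 q^3)\<close>.\<close>
  define M where "M = 1 / (4 * c ^ 3)"
  show ?thesis
  proof
    fix n :: nat assume n: "n > 0"
    define K :: complex where "K = (- 1) ^ (n + 1) * of_nat ((2 * n) choose n)"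
    define \<psi> where "\<psi> = (\<lambda>s::real. taylor_defect n n ((q s - 1) / 2)
                   - K * (of_real s * u / 4) ^ n * (1 / 2 - 1 / (2 * q s)))"
    define \<psi>' where "\<psi>' = (\<lambda>s::real. - (K * (of_real s * u / 4) ^ n * (u / (4 * q s ^ 3))))"
    define \<phi> where "\<phi> = (\<lambda>s. cmod K * (cmod u / 4) ^ n * M * (s ^ (n + 1) / (n + 1)))"
    have dq: "(q has_vector_derivative u / (2 * q s)) (at s)" if "0 < s" "s < 1" for s
    proof -
      have "((\<lambda>w. csqrt (1 + w * u)) has_field_derivative (1 / (2 * q s)) * u) (at (of_real s))"
        unfolding q_def using notneg[of s] that
        by (auto intro!: derivative_eq_intros simp: field_simps)
      from has_vector_derivative_real_field[OF this] show ?thesis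
        by (simp add: q_def field_simps)
    qed
    have "norm (\<psi> 1 - \<psi> 0) \<le> \<phi> 1 - \<phi> 0"
    proof (rule differentiable_bound_general[where f'="\<psi>'" and \<phi>'="\<lambda>s. cmod K * (cmod u / 4) ^ n * M * s ^ n"])
      have "continuous_on {0..1} (\<lambda>s. taylor_defect n n ((q s - 1) / 2))"
        unfolding taylor_defect_def by (intro continuous_intros contq) auto
      then show "continuous_on {0..1} \<psi>"
        unfolding \<psi>_def by (intro continuous_intros contq) (use qnz in auto)
      show "continuous_on {0..1} \<phi>" unfolding \<phi>_def by (intro continuous_intros) auto
    next
      fix s :: real assume s: "0 < s" "s < 1"
      define t where "t = (q s - 1) / 2"
      have Q: "q s \<noteq> 0" using qnz[of s] s by simp
      have tt: "t * (1 + t) = of_real s * u / 4"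
      proof -
        have "t * (1 + t) = ((q s)\<^sup>2 - 1) / 4" by (simp add: t_def power2_eq_square field_simps)
        then show ?thesis by (simp add: q2)
      qed
      have pw: "t ^ n * (1 + t) ^ (n - 1) = (of_real s * u / 4) ^ (n - 1) * t"
        unfolding tt[symmetric] using n by (cases n) (auto simp: power_mult_distrib)
      have cf: "- (of_nat (n + n) * neg_binom n n) = of_nat n * K"
      proof -
        have "of_nat (n + n) * neg_binom n n = of_nat n * (2 * neg_binom n n)" by simp
        then show ?thesis unfolding neg_binom_central[OF n] K_def by simp
      qed
      have d1: "((\<lambda>s. (q s - 1) / 2) has_vector_derivative u / (4 * q s)) (at s)"
        using dq[OF s] by (auto intro!: derivative_eq_intros)
      have "((taylor_defect n n \<circ> (\<lambda>s. (q s - 1) / 2)) has_vector_derivative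
           u / (4 * q s) * (- (of_nat (n + n) * neg_binom n n * t ^ n * (1 + t) ^ (n - 1)))) (at s)"
        by (rule field_vector_diff_chain_at[OF d1])
           (use taylor_defect_deriv[OF n, of n t UNIV] in \<open>simp only: t_def\<close>)
      also have "u / (4 * q s) * (- (of_nat (n + n) * neg_binom n n * t ^ n * (1 + t) ^ (n - 1)))
          = u / (4 * q s) * ((- (of_nat (n + n) * neg_binom n n)) * (t ^ n * (1 + t) ^ (n - 1)))"
        by simp
      also have "\<dots> = of_nat n * K * (of_real s * u / 4) ^ (n - 1) * (u / 4) * (1 / 2 - 1 / (2 * q s))"
        unfolding cf pw using Q by (simp add: t_def field_simps)
      finally have D1: "((\<lambda>s. taylor_defect n n ((q s - 1) / 2)) has_vector_derivative
          of_nat n * K * (of_real s * u / 4) ^ (n - 1) * (u / 4) * (1 / 2 - 1 / (2 * q s))) (at s)"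
        by (simp add: o_def)
      have P: "((\<lambda>s. (of_real s * u / 4) ^ n) has_vector_derivative
            of_nat n * (of_real s * u / 4) ^ (n - 1) * (u / 4)) (at s)"
      proof -
        have "((\<lambda>w. (w * u / 4) ^ n) has_field_derivative
            of_nat n * (of_real s * u / 4) ^ (n - 1) * (u / 4)) (at (of_real s))"
          by (auto intro!: derivative_eq_intros)
        from has_vector_derivative_real_field[OF this] show ?thesis by simp
      qed
      have A: "((\<lambda>s. 1 / 2 - 1 / (2 * q s)) has_vector_derivative u / (4 * q s ^ 3)) (at s)"
      proof -
        have "((\<lambda>w. 1 / 2 - 1 / (2 * w)) has_field_derivative 1 / (2 * (q s)\<^sup>2)) (at (q s))"
          using Q by (auto intro!: derivative_eq_intros simp: field_simps power2_eq_square)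
        from field_vector_diff_chain_at[OF dq[OF s] this] show ?thesis
          using Q by (simp add: o_def field_simps power2_eq_square power3_eq_cube)
      qed
      have D2: "((\<lambda>s. K * (of_real s * u / 4) ^ n * (1 / 2 - 1 / (2 * q s))) has_vector_derivative
          K * (of_real s * u / 4) ^ n * (u / (4 * q s ^ 3))
          + K * (of_nat n * (of_real s * u / 4) ^ (n - 1) * (u / 4)) * (1 / 2 - 1 / (2 * q s))) (at s)"
        by (intro has_vector_derivative_mult has_vector_derivative_mult_right P A)
      show "(\<psi> has_vector_derivative \<psi>' s) (at s)"
        unfolding \<psi>_def \<psi>'_def using has_vector_derivative_diff[OF D1 D2] by (simp add: mult_ac)
      show "(\<phi> has_vector_derivative cmod K * (cmod u / 4) ^ n * M * s ^ n) (at s)"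
        unfolding \<phi>_def has_real_derivative_iff_has_vector_derivative[symmetric]
        by (rule derivative_eq_intros refl | simp)+
      have "cmod u / (4 * cmod (q s) ^ 3) \<le> 1 / (4 * c ^ 3)"
        using u1 c(1) c(2)[of s] s by (intro frac_le mult_left_mono power_mono) auto
      then have "cmod K * (s ^ n * (cmod u / 4) ^ n) * (cmod u / (4 * cmod (q s) ^ 3))
          \<le> cmod K * (s ^ n * (cmod u / 4) ^ n) * M"
        unfolding M_def using s by (intro mult_left_mono) auto
      then show "norm (\<psi>' s) \<le> cmod K * (cmod u / 4) ^ n * M * s ^ n"
        using s by (simp add: \<psi>'_def norm_mult norm_divide norm_power power_mult_distrib power_divide mult_ac)
    qed simp
    moreover have "\<psi> 0 = 0" using n by (simp add: \<psi>_def q_def taylor_defect_0)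
    moreover have "\<psi> 1 = taylor_defect n n z - K * (z * (z + 1)) ^ n * (z / (2 * z + 1))"
    proof -
      have "1 / 2 - 1 / (2 * w) = ((w - 1) / 2) / w" if "w \<noteq> 0" for w :: complex
        using that by (simp add: field_simps)
      from this[OF \<open>2 * z + 1 \<noteq> 0\<close>]
      have "1 / 2 - 1 / (2 * (2 * z + 1)) = z / (2 * z + 1)" by simp
      then show ?thesis by (simp add: \<psi>_def q1 u_def)
    qed
    moreover have "\<phi> 1 - \<phi> 0 \<le> real ((2 * n) choose n) * cmod (z * (z + 1)) ^ n * (M / n)"
    proof -
      have "cmod K = real ((2 * n) choose n)" by (simp add: K_def norm_mult norm_power)
      moreover have "cmod u / 4 = cmod (z * (z + 1))" by (simp add: u_def norm_mult)
      ultimately have "\<phi> 1 - \<phi> 0 = real ((2 * n) choose n) * cmod (z * (z + 1)) ^ n * (M / (n + 1))"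
        by (simp add: \<phi>_def)
      also have "\<dots> \<le> real ((2 * n) choose n) * cmod (z * (z + 1)) ^ n * (M / n)"
        using n c(1) by (intro mult_left_mono divide_left_mono) (auto simp: M_def)
      finally show ?thesis .
    qed
    ultimately show "cmod (taylor_defect n n z - (- 1) ^ (n + 1) * of_nat ((2 * n) choose n) * (z * (z + 1)) ^ n * (z / (2 * z + 1)))
      \<le> real ((2 * n) choose n) * cmod (z * (z + 1)) ^ n * (M / n)"
      unfolding K_def by simp
  qed
qed

theorem taylor_defect_asymptotics:
  assumes z: "z \<in> loop_region" "z \<noteq> - 1/2"
  shows "\<exists>\<epsilon> :: nat \<Rightarrow> complex. \<epsilon> \<in> O(\<lambda>n. 1 / of_nat n) \<and>
     (\<forall>\<^sub>F n in sequentially. taylor_defect n n z =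
        (- 1) ^ (n + 1) * z / (of_real (sqrt (real n * pi)) * (2 * z + 1)) * (4 * z * (1 + z)) ^ n * (1 + \<epsilon> n))"
proof (cases "z = 0")
  case True
  have "(\<lambda>n. 0 :: complex) \<in> O(\<lambda>n. 1 / of_nat n)" by simp
  with True show ?thesis by (intro exI[of _ "\<lambda>n. 0"]) (simp add: taylor_defect_0)
next
  case False
  obtain M where M: "\<And>n. n > 0 \<Longrightarrow>
    cmod (taylor_defect n n z - (- 1) ^ (n + 1) * of_nat ((2 * n) choose n) * (z * (z + 1)) ^ n * (z / (2 * z + 1)))
      \<le> real ((2 * n) choose n) * cmod (z * (z + 1)) ^ n * (M / n)"
    using taylor_defect_expansion[OF z] by blast
  have nz: "2 * z + 1 \<noteq> 0" using loop_region_right_of_axis[OF z] by (auto simp: complex_eq_iff)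
  have z1: "z + 1 \<noteq> 0" using loop_region_norm(2)[OF z(1)] by (auto simp: add.commute)
  define A where "A = z / (2 * z + 1)"
  have A: "A \<noteq> 0" using False nz by (simp add: A_def)
  define T where "T = (\<lambda>n. (- 1) ^ (n + 1) * z / (of_real (sqrt (real n * pi)) * (2 * z + 1)) * (4 * z * (1 + z)) ^ n)"
  define \<epsilon> where "\<epsilon> = (\<lambda>n. taylor_defect n n z / T n - 1)"
  have Tnz: "T n \<noteq> 0" if "n > 0" for n
    using that False nz z1 by (auto simp: T_def add.commute)
  have eq: "taylor_defect n n z = T n * (1 + \<epsilon> n)" if "n > 0" for n
    using Tnz[OF that] by (simp add: \<epsilon>_def)
  have bound: "cmod (\<epsilon> n) \<le> (1 + M / cmod A) * (1 / n)" if n: "n > 0" for n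
  proof -
    define C where "C = real ((2 * n) choose n)"
    define \<beta> where "\<beta> = C * sqrt (n * pi) / 4 ^ n"
    note b = central_binomial_asymptotic[OF n, folded C_def, folded \<beta>_def]
    define \<delta> where "\<delta> = taylor_defect n n z - (- 1) ^ (n + 1) * of_real C * (z * (z + 1)) ^ n * A"
    have C: "C > 0" by (simp add: C_def)
    have \<delta>: "cmod \<delta> \<le> C * cmod (z * (z + 1)) ^ n * (M / n)"
      using M[OF n] by (simp add: \<delta>_def C_def A_def)
    have T: "T n * of_real \<beta> = (- 1) ^ (n + 1) * of_real C * (z * (z + 1)) ^ n * A"
    proof -
      have "(4 * z * (1 + z)) ^ n = 4 ^ n * (z * (z + 1)) ^ n"
        by (simp flip: power_mult_distrib add: algebra_simps)
      moreover have "complex_of_real (sqrt (real n * pi)) \<noteq> 0" using n by simp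
      moreover have "sg * z / (r * d) * (4 ^ n * p) * (c * r / 4 ^ n) = sg * c * p * (z / d)"
        if "r \<noteq> 0" for sg r d p c :: complex
        using that by simp
      ultimately show ?thesis
        by (simp add: T_def \<beta>_def A_def of_real_mult of_real_divide)
    qed
    have "\<epsilon> n = (of_real \<beta> - 1) + \<delta> / T n"
    proof -
      have "taylor_defect n n z = T n * of_real \<beta> + \<delta>" unfolding T by (simp add: \<delta>_def)
      then show ?thesis using Tnz[OF n] by (simp add: \<epsilon>_def add_divide_distrib)
    qed
    then have "cmod (\<epsilon> n) \<le> cmod (of_real \<beta> - 1) + cmod (\<delta> / T n)"
      using norm_triangle_ineq by metis
    also have "cmod (of_real \<beta> - 1) = \<bar>\<beta> - 1\<bar>" by (metis norm_of_real of_real_1 of_real_diff)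
    also have "\<bar>\<beta> - 1\<bar> \<le> 1 / n" using b by simp
    also have "cmod (\<delta> / T n) \<le> M / cmod A * (1 / n)"
    proof -
      have "cmod (T n) * \<beta> = cmod (T n * of_real \<beta>)" using b by (simp add: norm_mult)
      also have "\<dots> = C * cmod (z * (z + 1)) ^ n * cmod A"
        unfolding T using C by (simp add: norm_mult norm_power)
      finally have TT: "cmod (T n) * \<beta> = C * cmod (z * (z + 1)) ^ n * cmod A" .
      have M0: "0 \<le> M / n"
      proof -
        have "0 \<le> C * cmod (z * (z + 1)) ^ n * (M / n)" using \<delta> norm_ge_zero order_trans by blast
        moreover have "0 < C * cmod (z * (z + 1)) ^ n" using C False z1 by simp
        ultimately show ?thesis using mult_less_0_iff[of _ "M / n"] by (meson not_le)
      qed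
      have "cmod \<delta> * cmod A \<le> C * cmod (z * (z + 1)) ^ n * cmod A * (M / n)"
        using \<delta> mult_right_mono[OF \<delta>, of "cmod A"] by (simp add: mult_ac)
      also have "\<dots> = cmod (T n) * (\<beta> * (M / n))" by (simp flip: TT)
      also have "\<dots> \<le> cmod (T n) * (1 * (M / n))"
        using b M0 by (intro mult_left_mono mult_right_mono) auto
      finally have "cmod \<delta> * cmod A \<le> cmod (T n) * (M / n)" by simp
      moreover have "d / t \<le> m / a * (1 / k)"
        if "d * a \<le> t * (m / k)" "a > 0" "t > 0" "k > 0" for d a t m k :: real
        using that by (simp add: field_simps)
      ultimately show ?thesis using A Tnz[OF n] n by (simp add: norm_divide)
    qed
    finally show ?thesis by (simp add: algebra_simps)
  qed
  have "\<epsilon> \<in> O(\<lambda>n. 1 / of_nat n)"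
    by (rule bigoI[of _ "1 + M / cmod A"])
       (use bound in \<open>auto intro!: eventually_sequentiallyI[of 1] simp: norm_divide\<close>)
  moreover have "\<forall>\<^sub>F n in sequentially. taylor_defect n n z = T n * (1 + \<epsilon> n)"
    using eq by (intro eventually_sequentiallyI[of 1]) auto
  ultimately show ?thesis unfolding T_def by blast
qed

section \<open>Mean values over the unit circle\<close>

definition unit_circle :: "real \<Rightarrow> complex" where
  "unit_circle t = exp (2 * of_real pi * \<i> * of_real t)"

definition unif01 :: "real measure" where
  "unif01 = uniform_measure lborel {0..1}"

lemma norm_unit_circle [simp]: "cmod (unit_circle t) = 1"
  by (simp add: unit_circle_def)

lemma continuous_unit_circle [continuous_intros]: "continuous_on S unit_circle"
  unfolding unit_circle_def by (intro continuous_intros)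

lemma measurable_unit_circle [measurable]: "unit_circle \<in> borel_measurable borel"
  by (intro borel_measurable_continuous_onI continuous_intros)

lemma sets_unif01 [measurable_cong]: "sets unif01 = sets borel"
  by (simp add: unif01_def)

lemma space_unif01 [simp]: "space unif01 = UNIV"
  by (simp add: unif01_def)

lemma prob_space_unif01: "prob_space unif01"
  unfolding unif01_def by (rule prob_space_uniform_measure) auto

interpretation unif01: prob_space unif01
  by (rule prob_space_unif01)

lemma unif01_density: "unif01 = density lborel (indicator {0..1})"
  by (simp add: unif01_def uniform_measure_def divide_ennreal_def)

lemma integral_unif01:
  fixes f :: "real \<Rightarrow> complex"
  assumes "continuous_on {0..1} f" "f \<in> borel_measurable borel" "(f has_integral I) {0..1}"
  shows "integrable unif01 f" "(LINT t|unif01. f t) = I"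
proof -
  have int: "set_integrable lborel {0..1} f"
    using borel_integrable_compact[of "{0..1::real}" f] assms(1) by (simp add: set_integrable_def)
  have D: "unif01 = density lborel (\<lambda>x. ennreal (indicator {0..1} x))"
    unfolding unif01_density by (intro arg_cong2[where f=density] refl ext) (simp split: split_indicator)
  then show "integrable unif01 f"
    unfolding D using int assms(2) by (subst integrable_density) (auto simp: set_integrable_def)
  have "(LINT t|unif01. f t) = (LINT t:{0..1}|lborel. f t)"
    unfolding D using assms(2) by (subst integral_density) (auto simp: set_lebesgue_integral_def)
  also have "\<dots> = I"
    using set_borel_integral_eq_integral(2)[OF int] assms(3) by (simp add: integral_unique)
  finally show "(LINT t|unif01. f t) = I" .
qed

lemma mean_value_unit_circle:
  assumes cont: "continuous_on (cball 0 1) f" and hol: "f holomorphic_on ball 0 1"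
    and meas: "(\<lambda>t. f (unit_circle t)) \<in> borel_measurable borel"
  shows "integrable unif01 (\<lambda>t. f (unit_circle t))" "(LINT t|unif01. f (unit_circle t)) = f 0"
proof -
  have "((\<lambda>u. f u / (u - 0)) has_contour_integral (2 * of_real pi * \<i> * f 0)) (circlepath 0 1)"
    using Cauchy_integral_circlepath[OF cont hol, of 0] by simp
  then have "((\<lambda>t. f (unit_circle t) / unit_circle t * (2 * of_real pi * \<i> * unit_circle t))
               has_integral (2 * of_real pi * \<i> * f 0)) {0..1}"
    unfolding has_contour_integral_def
  proof (rule has_integral_eq[rotated])
    fix t :: real assume "t \<in> {0..1}"
    then have "vector_derivative (circlepath 0 1) (at t within {0..1})
        = 2 * of_real pi * \<i> * unit_circle t"
      by (subst vector_derivative_circlepath01) (auto simp: unit_circle_def)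
    moreover have "circlepath 0 1 t = unit_circle t"
      by (simp add: circlepath unit_circle_def)
    ultimately show "f (circlepath 0 1 t) / (circlepath 0 1 t - 0)
          * vector_derivative (circlepath 0 1) (at t within {0..1})
        = f (unit_circle t) / unit_circle t * (2 * of_real pi * \<i> * unit_circle t)"
      by simp
  qed
  then have "((\<lambda>t. 2 * of_real pi * \<i> * f (unit_circle t))
               has_integral (2 * of_real pi * \<i> * f 0)) {0..1}"
    by (rule has_integral_eq[rotated]) (simp add: unit_circle_def)
  from has_integral_mult_right[OF this, of "1 / (2 * of_real pi * \<i>)"]
  have hi: "((\<lambda>t. f (unit_circle t)) has_integral f 0) {0..1}" by simp
  have c: "continuous_on {0..1} (\<lambda>t. f (unit_circle t))"
    by (intro continuous_on_compose2[OF cont] continuous_intros) auto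
  show "integrable unif01 (\<lambda>t. f (unit_circle t))" "(LINT t|unif01. f (unit_circle t)) = f 0"
    using integral_unif01[OF c meas hi] by auto
qed

text \<open>
  The mean value property of the harmonic function \<open>ln |f|\<close>, obtained from the holomorphic
  branch \<open>Ln f\<close>, which is defined since \<open>f\<close> takes values in the right half-plane.
\<close>

lemma mean_value_log:
  assumes cont: "continuous_on (cball 0 1) f" and hol: "f holomorphic_on ball 0 1"
    and pos: "\<And>u. u \<in> cball 0 1 \<Longrightarrow> 0 < Re (f u)"
    and meas: "(\<lambda>t. f (unit_circle t)) \<in> borel_measurable borel"
  shows "integrable unif01 (\<lambda>t. ln (cmod (f (unit_circle t))))"
    and "(LINT t|unif01. ln (cmod (f (unit_circle t)))) = ln (cmod (f 0))"
proof -
  have nn: "f u \<notin> \<real>\<^sub>\<le>\<^sub>0" if "u \<in> cball 0 1" for u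
    using pos[OF that] by (auto simp: complex_nonpos_Reals_iff)
  have nz: "f u \<noteq> 0" if "u \<in> cball 0 1" for u
    using pos[OF that] by auto
  have *: "integrable unif01 (\<lambda>t. Ln (f (unit_circle t)))"
       "(LINT t|unif01. Ln (f (unit_circle t))) = Ln (f 0)"
  proof (rule_tac [!] mean_value_unit_circle[where f="\<lambda>u. Ln (f u)"])
    show "continuous_on (cball 0 1) (\<lambda>u. Ln (f u))"
      using nn by (intro continuous_intros cont) auto
    then show "continuous_on (cball 0 1) (\<lambda>u. Ln (f u))" .
    show "(\<lambda>u. Ln (f u)) holomorphic_on ball 0 1"
      using nn by (intro holomorphic_intros hol) auto
    then show "(\<lambda>u. Ln (f u)) holomorphic_on ball 0 1" .
    show "(\<lambda>t. Ln (f (unit_circle t))) \<in> borel_measurable borel"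
      using meas by measurable
    then show "(\<lambda>t. Ln (f (unit_circle t))) \<in> borel_measurable borel" .
  qed
  have eq: "ln (cmod (f (unit_circle t))) = Re (Ln (f (unit_circle t)))" for t
    using nz by (simp add: Re_Ln)
  show "integrable unif01 (\<lambda>t. ln (cmod (f (unit_circle t))))"
    unfolding eq using * by auto
  have "(LINT t|unif01. ln (cmod (f (unit_circle t)))) = Re (Ln (f 0))"
    unfolding eq using * by simp
  then show "(LINT t|unif01. ln (cmod (f (unit_circle t)))) = ln (cmod (f 0))"
    using nz[of 0] by (simp add: Re_Ln)
qed

text \<open>
  By periodicity, the parameters of one point of the circle form a countable set.
\<close>

lemma AE_unit_circle_neq: "AE t in unif01. unit_circle t \<noteq> a"
proof (cases "\<exists>t0. unit_circle t0 = a")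
  case True
  then obtain t0 where t0: "unit_circle t0 = a" by blast
  have "{t. unit_circle t = a} \<subseteq> range (\<lambda>n::int. t0 + of_int n)"
  proof
    fix t assume "t \<in> {t. unit_circle t = a}"
    then have "exp (2 * of_real pi * \<i> * of_real t) = exp (2 * of_real pi * \<i> * of_real t0)"
      using t0 by (simp add: unit_circle_def)
    then obtain n :: int where "2 * of_real pi * \<i> * of_real t
        = 2 * of_real pi * \<i> * of_real t0 + (of_int (2 * n) * pi) * \<i>"
      unfolding exp_eq by blast
    then have "2 * of_real pi * \<i> * of_real t = 2 * of_real pi * \<i> * of_real (t0 + of_int n)"
      by (simp add: algebra_simps)
    then have "complex_of_real t = of_real (t0 + of_int n)" by simp
    then show "t \<in> range (\<lambda>n::int. t0 + of_int n)" by (simp only: of_real_eq_iff) auto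
  qed
  then have "countable {t. unit_circle t = a}"
    by (rule countable_subset) simp
  then have "{t. unit_circle t = a} \<in> null_sets lborel"
    by (rule countable_imp_null_set_lborel)
  then have "AE t in lborel. unit_circle t \<noteq> a"
    by (rule AE_I') auto
  then show ?thesis
    unfolding unif01_density by (subst AE_density) auto
qed auto

text \<open>
  For \<open>|a| < 1\<close> one has \<open>|u - a| = |1 - cnj a * u|\<close> on the circle, and the right-hand side has a
  harmonic logarithm on the closed disc. For \<open>|a| = 1\<close> approach \<open>a\<close> by \<open>r a\<close> with \<open>r < 1\<close>: Fatou's
  lemma shows that the limit function is integrable, and \<open>|u - a| \<le> 2 |u - r a|\<close> then makes
  it, up to an additive constant, a majorant for dominated convergence.
\<close>

lemma log_mean_unit_circle:
  assumes a: "cmod a \<le> 1"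
  shows "integrable unif01 (\<lambda>t. ln (cmod (unit_circle t - a)))"
    and "(LINT t|unif01. ln (cmod (unit_circle t - a))) = 0"
proof -
  have inside: "integrable unif01 (\<lambda>t. ln (cmod (unit_circle t - a)))
      \<and> (LINT t|unif01. ln (cmod (unit_circle t - a))) = 0" if a: "cmod a < 1" for a
  proof -
    have eq: "cmod (unit_circle t - a) = cmod (1 - cnj a * unit_circle t)" for t
    proof -
      have "unit_circle t * cnj (unit_circle t) = 1"
        by (simp add: complex_norm_square[symmetric])
      then have "cnj (unit_circle t) * (unit_circle t - a) = cnj (1 - cnj a * unit_circle t)"
        by (simp add: algebra_simps)
      then have "cmod (cnj (unit_circle t) * (unit_circle t - a)) = cmod (1 - cnj a * unit_circle t)"
        by (simp only: complex_mod_cnj)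
      then show ?thesis by (simp add: norm_mult)
    qed
    have "0 < Re (1 - cnj a * u)" if "u \<in> cball 0 1" for u
    proof -
      have "cmod (cnj a * u) \<le> cmod a * 1"
        unfolding norm_mult using that by (intro mult_mono) auto
      then have "cmod (cnj a * u) < 1" using a by simp
      then show ?thesis using complex_Re_le_cmod[of "cnj a * u"] by (simp del: norm_mult)
    qed
    note * = mean_value_log[of "\<lambda>u. 1 - cnj a * u", OF _ _ this]
    have c: "continuous_on (cball 0 1) (\<lambda>u. 1 - cnj a * u)" by (intro continuous_intros)
    have h: "(\<lambda>u. 1 - cnj a * u) holomorphic_on ball 0 1" by (intro holomorphic_intros)
    show ?thesis unfolding eq using *[OF c h] by simp
  qed
  show "integrable unif01 (\<lambda>t. ln (cmod (unit_circle t - a)))"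
    and "(LINT t|unif01. ln (cmod (unit_circle t - a))) = 0"
  proof -
    have "integrable unif01 (\<lambda>t. ln (cmod (unit_circle t - a)))
      \<and> (LINT t|unif01. ln (cmod (unit_circle t - a))) = 0" if a1: "cmod a = 1"
    proof -
      define r where "r = (\<lambda>k::nat. 1 - 1 / real (k + 2))"
      have r: "0 \<le> r k" "r k < 1" for k by (auto simp: r_def)
      have rlim: "r \<longlonglongrightarrow> 1" unfolding r_def by real_asymp
      define F where "F = (\<lambda>k t. ln (cmod (unit_circle t - of_real (r k) * a)))"
      have ra: "cmod (of_real (r k) * a) < 1" for k
        using r[of k] a1 by (simp add: norm_mult)
      have F: "integrable unif01 (F k)" "(LINT t|unif01. F k t) = 0" for k
        using inside[OF ra] by (auto simp: F_def)
      have ub: "cmod (unit_circle t - of_real (r k) * a) \<le> 2" for t k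
        using norm_triangle_ineq4[of "unit_circle t" "of_real (r k) * a"] ra[of k] by simp
      have lb: "cmod (unit_circle t - a) \<le> 2 * cmod (unit_circle t - of_real (r k) * a)" for t k
      proof -
        have "cmod (of_real (r k) * a - a) = 1 - r k"
        proof -
          have "of_real (r k) * a - a = of_real (r k - 1) * a" by (simp add: algebra_simps)
          then show ?thesis using r[of k] a1 by (simp only: norm_mult norm_of_real) (simp add: abs_if)
        qed
        also have "\<dots> \<le> cmod (unit_circle t - of_real (r k) * a)"
          using norm_triangle_ineq2[of "unit_circle t" "of_real (r k) * a"] r[of k] a1
          by (simp add: norm_mult)
        finally show ?thesis
          using norm_triangle_ineq[of "unit_circle t - of_real (r k) * a" "of_real (r k) * a - a"]
          by simp
      qed
      have pos: "0 < cmod (unit_circle t - of_real (r k) * a)" for t k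
      proof -
        have "unit_circle t \<noteq> of_real (r k) * a"
        proof
          assume "unit_circle t = of_real (r k) * a"
          then have "cmod (of_real (r k) * a) = 1" by (metis norm_unit_circle)
          then show False using ra[of k] by simp
        qed
        then show ?thesis by simp
      qed
      have lim: "AE t in unif01. (\<lambda>k. F k t) \<longlonglongrightarrow> ln (cmod (unit_circle t - a))"
        using AE_unit_circle_neq[of a]
      proof eventually_elim
        case (elim t)
        have "(\<lambda>k. ln (cmod (unit_circle t - of_real (r k) * a)))
                \<longlonglongrightarrow> ln (cmod (unit_circle t - of_real 1 * a))"
          using elim by (intro tendsto_intros rlim) auto
        then show ?case by (simp add: F_def)
      qed
      have int: "integrable unif01 (\<lambda>t. ln (cmod (unit_circle t - a)))"
      proof -
        have "(\<integral>\<^sup>+ t. ennreal (ln 2 - ln (cmod (unit_circle t - a))) \<partial>unif01)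
            \<le> (\<integral>\<^sup>+ t. liminf (\<lambda>k. ennreal (ln 2 - F k t)) \<partial>unif01)"
        proof (intro nn_integral_mono_AE)
          show "AE t in unif01. ennreal (ln 2 - ln (cmod (unit_circle t - a)))
                  \<le> liminf (\<lambda>k. ennreal (ln 2 - F k t))"
            using lim
          proof eventually_elim
            case (elim t)
            then have "(\<lambda>k. ennreal (ln 2 - F k t)) \<longlonglongrightarrow> ennreal (ln 2 - ln (cmod (unit_circle t - a)))"
              by (intro tendsto_intros)
            from lim_imp_Liminf[OF trivial_limit_sequentially this] show ?case by simp
          qed
        qed
        also have "\<dots> \<le> liminf (\<lambda>k. \<integral>\<^sup>+ t. ennreal (ln 2 - F k t) \<partial>unif01)"
          by (intro nn_integral_liminf) (simp add: F_def)
        also have "(\<lambda>k. \<integral>\<^sup>+ t. ennreal (ln 2 - F k t) \<partial>unif01) = (\<lambda>k. ennreal (ln 2))"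
        proof
          fix k
          have "0 \<le> ln 2 - F k t" for t
            using ub[where k=k and t=t] pos[where k=k and t=t] by (simp add: F_def ln_mono)
          then show "(\<integral>\<^sup>+ t. ennreal (ln 2 - F k t) \<partial>unif01) = ennreal (ln 2)"
            using F[of k] unif01.prob_space by (subst nn_integral_eq_integral) auto
        qed
        also have "liminf (\<lambda>k. ennreal (ln 2)) < \<infinity>" by (simp add: Liminf_const)
        finally have fin: "(\<integral>\<^sup>+ t. ennreal (ln 2 - ln (cmod (unit_circle t - a))) \<partial>unif01) < \<infinity>" .
        have "0 \<le> ln 2 - ln (cmod (unit_circle t - a))" for t
        proof (cases "unit_circle t = a")
          case False
          then have "cmod (unit_circle t - a) \<le> 2" "0 < cmod (unit_circle t - a)"
            using norm_triangle_ineq4[of "unit_circle t" a] a1 by auto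
          then show ?thesis by (simp add: ln_mono)
        qed simp
        then have "integrable unif01 (\<lambda>t. ln 2 - ln (cmod (unit_circle t - a)))"
          using fin by (intro integrableI_nonneg) auto
        from Bochner_Integration.integrable_diff[OF _ this, of "\<lambda>_. ln 2"]
        have "integrable unif01 (\<lambda>t. ln 2 - (ln 2 - ln (cmod (unit_circle t - a))))" by simp
        moreover have "(\<lambda>t. ln 2 - (ln 2 - ln (cmod (unit_circle t - a)))) = (\<lambda>t. ln (cmod (unit_circle t - a)))"
          by (intro ext) simp
        ultimately show ?thesis by metis
      qed
      have "(\<lambda>k. LINT t|unif01. F k t) \<longlonglongrightarrow> (LINT t|unif01. ln (cmod (unit_circle t - a)))"
      proof (rule integral_dominated_convergence[where w="\<lambda>t. ln 2 + \<bar>ln (cmod (unit_circle t - a))\<bar>"])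
        show "integrable unif01 (\<lambda>t. ln 2 + \<bar>ln (cmod (unit_circle t - a))\<bar>)"
          using int by auto
        fix k
        show "AE t in unif01. norm (F k t) \<le> ln 2 + \<bar>ln (cmod (unit_circle t - a))\<bar>"
          using AE_unit_circle_neq[of a]
        proof eventually_elim
          case (elim t)
          have "ln (cmod (unit_circle t - a)) \<le> ln (2 * cmod (unit_circle t - of_real (r k) * a))"
            using elim lb[of t k] by (intro ln_mono) auto
          then have "ln (cmod (unit_circle t - a)) \<le> ln 2 + F k t"
            using pos[where k=k and t=t] by (simp add: F_def ln_mult)
          moreover have "F k t \<le> ln 2"
            unfolding F_def using ub[where k=k and t=t] pos[where k=k and t=t] by (intro ln_mono) auto
          ultimately show ?case by auto
        qed
      qed (use lim in \<open>auto simp: F_def\<close>)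
      then have "(LINT t|unif01. ln (cmod (unit_circle t - a))) = 0"
        using F(2) LIMSEQ_unique[of "\<lambda>k. 0::real"] by fastforce
      with int show ?thesis by blast
    qed
    then show "integrable unif01 (\<lambda>t. ln (cmod (unit_circle t - a)))"
      and "(LINT t|unif01. ln (cmod (unit_circle t - a))) = 0"
      using inside[of a] a by (cases "cmod a = 1"; auto)+
  qed
qed

section \<open>The potential of the harmonic measure of the region\<close>

definition loop_param :: "complex \<Rightarrow> complex" where
  "loop_param u = (csqrt (1 + u) - 1) / 2"

text \<open>
  The harmonic measure of \<open>loop_interior\<close> at \<open>0\<close>, as image of normalized arc length under the
  boundary values of the conformal map \<open>loop_param\<close> of the unit disc, which fixes \<open>0\<close>.
\<close>

definition loop_measure :: "complex measure" where
  "loop_measure = distr unif01 borel (\<lambda>t. loop_param (unit_circle t))"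

text \<open>
  The kernel \<open>log_kernel\<close> cut off to nonnegative values; they agree for points of distance at
  most \<open>1\<close>.
\<close>

definition log_ker :: "complex \<Rightarrow> complex \<Rightarrow> ennreal" where
  "log_ker z t = (if z = t then \<infinity> else ennreal (ln (1 / cmod (z - t))))"

lemma loop_param_quadratic: "4 * (loop_param u * (loop_param u + 1)) = u"
proof -
  have "4 * (loop_param u * (loop_param u + 1)) = (csqrt (1 + u))\<^sup>2 - 1"
    by (simp add: loop_param_def power2_eq_square field_simps)
  then show ?thesis by simp
qed

lemma Re_loop_param: "- 1/2 \<le> Re (loop_param u)"
  using Re_csqrt[of "1 + u"] by (simp add: loop_param_def)

lemma loop_param_in_region:
  assumes "cmod u \<le> 1"
  shows "loop_param u \<in> loop_region"
proof -
  have "4 * cmod (loop_param u * (loop_param u + 1)) \<le> 1"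
    using assms loop_param_quadratic[of u] by (metis norm_mult norm_numeral)
  then show ?thesis using Re_loop_param by (simp add: loop_region_def)
qed

lemma loop_param_0 [simp]: "loop_param 0 = 0"
  by (simp add: loop_param_def)

lemma loop_param_inverse:
  assumes "z \<in> loop_region"
  shows "loop_param (4 * (z * (z + 1))) = z"
proof -
  have "0 < Re (2 * z + 1) \<or> Re (2 * z + 1) = 0 \<and> 0 \<le> Im (2 * z + 1)"
  proof (cases "Re z = - 1/2")
    case True
    then show ?thesis
      using cmod_on_symmetry_axis[OF True] assms by (auto simp: loop_region_def)
  qed (use assms in \<open>auto simp: loop_region_def\<close>)
  then have "csqrt ((2 * z + 1)\<^sup>2) = 2 * z + 1" by (rule csqrt_square)
  then show ?thesis by (simp add: loop_param_def square_of_affine[symmetric])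
qed

lemma continuous_loop_param: "continuous_on (cball 0 1) loop_param"
proof -
  have "continuous (at u within cball 0 1) (\<lambda>u. csqrt (1 + u))" if "u \<in> cball 0 1" for u :: complex
  proof (cases "u = - 1")
    case True
    have "((\<lambda>x. sqrt (cmod (1 + x))) \<longlongrightarrow> sqrt (cmod (1 + - 1))) (at (- 1) within cball 0 1)"
      by (intro tendsto_intros)
    then have "((\<lambda>x. cmod (csqrt (1 + x))) \<longlongrightarrow> 0) (at (- 1) within cball 0 1)"
      by simp
    then show ?thesis
      using True by (simp add: continuous_within tendsto_norm_zero_cancel)
  next
    case False
    then have "isCont csqrt (1 + u)"
      using one_plus_disc_slit[of u] that by (intro continuous_at_csqrt) auto
    then have "isCont (csqrt \<circ> (\<lambda>u. 1 + u)) u"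
      by (intro continuous_at_compose) auto
    then show ?thesis
      by (simp add: o_def continuous_at_imp_continuous_at_within)
  qed
  then have "continuous_on (cball 0 1) (\<lambda>u::complex. csqrt (1 + u))"
    by (simp add: continuous_on_eq_continuous_within)
  then show ?thesis
    unfolding loop_param_def by (intro continuous_intros) auto
qed

lemma holomorphic_loop_param: "loop_param holomorphic_on ball 0 1"
  unfolding loop_param_def
proof (intro holomorphic_intros)
  fix u :: complex assume "u \<in> ball 0 1"
  then show "1 + u \<notin> \<real>\<^sub>\<le>\<^sub>0" by (intro one_plus_disc_slit) auto
qed auto

lemma measurable_loop_param_circle [measurable]:
  "(\<lambda>t. loop_param (unit_circle t)) \<in> borel_measurable borel"
  by (intro borel_measurable_continuous_onI continuous_on_compose2[OF continuous_loop_param]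
        continuous_intros) auto

lemma sets_loop_measure [measurable_cong]: "sets loop_measure = sets borel"
  by (simp add: loop_measure_def)

lemma loop_measure_prob: "loop_measure \<in> prob_measures_on loop_region"
proof -
  have [measurable]: "loop_region \<in> sets borel" using closed_loop_region by measurable
  have ps: "prob_space loop_measure"
    unfolding loop_measure_def by (rule unif01.prob_space_distr) measurable
  have "emeasure loop_measure loop_region = emeasure unif01 UNIV"
    unfolding loop_measure_def
    by (subst emeasure_distr) (auto simp: loop_param_in_region vimage_def)
  also have "\<dots> = 1" using unif01.emeasure_space_1 by simp
  finally show ?thesis using ps by (simp add: prob_measures_on_def sets_loop_measure)
qed

text \<open>
  The function \<open>z + 1 + loop_param u\<close> of \<open>u\<close> takes values in the right half-plane, unless \<open>z = -1/2\<close>.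
  In that case it is \<open>sqrt (1 + u) / 2\<close> with a zero at \<open>u = -1\<close>, and \<open>log_mean_unit_circle\<close>
  evaluates the mean.
\<close>

lemma log_mean_reflected:
  assumes z: "z \<in> loop_region"
  shows "integrable unif01 (\<lambda>t. ln (cmod (z + 1 + loop_param (unit_circle t))))"
    and "(LINT t|unif01. ln (cmod (z + 1 + loop_param (unit_circle t)))) = ln (cmod (1 + z))"
proof -
  have "integrable unif01 (\<lambda>t. ln (cmod (z + 1 + loop_param (unit_circle t))))
    \<and> (LINT t|unif01. ln (cmod (z + 1 + loop_param (unit_circle t)))) = ln (cmod (1 + z))"
  proof (cases "z = - 1/2")
    case False
    have "0 < Re (z + 1 + loop_param u)" for u
      using Re_loop_param[of u] loop_region_right_of_axis[OF z False] by simp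
    moreover have "continuous_on (cball 0 1) (\<lambda>u. z + 1 + loop_param u)"
      by (intro continuous_intros continuous_loop_param)
    moreover have "(\<lambda>u. z + 1 + loop_param u) holomorphic_on ball 0 1"
      by (intro holomorphic_intros holomorphic_loop_param)
    ultimately show ?thesis
      using mean_value_log[of "\<lambda>u. z + 1 + loop_param u"] by (simp add: add.commute)
  next
    case True
    have eq: "ln (cmod (z + 1 + loop_param (unit_circle t))) = ln (cmod (unit_circle t - (- 1))) / 2 - ln 2"
      if "unit_circle t \<noteq> - 1" for t
    proof -
      have "z + 1 + loop_param (unit_circle t) = csqrt (1 + unit_circle t) / 2"
        using True by (simp add: loop_param_def field_simps)
      then have "cmod (z + 1 + loop_param (unit_circle t)) = sqrt (cmod (1 + unit_circle t)) / 2"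
        by (simp only: norm_divide) simp
      moreover have "1 + unit_circle t \<noteq> 0" using that by (auto simp: add_eq_0_iff)
      moreover have "ln (sqrt b / 2) = ln b / 2 - ln 2" if "0 < b" for b :: real
        using that by (simp add: ln_div ln_sqrt)
      ultimately show ?thesis by (simp only: zero_less_norm_iff) (simp add: add.commute)
    qed
    have ae: "AE t in unif01. ln (cmod (unit_circle t - (- 1))) / 2 - ln 2
                 = ln (cmod (z + 1 + loop_param (unit_circle t)))"
      using AE_unit_circle_neq[of "- 1"] by eventually_elim (simp add: eq)
    have int: "integrable unif01 (\<lambda>t. ln (cmod (unit_circle t - (- 1))))"
      and v: "(LINT t|unif01. ln (cmod (unit_circle t - (- 1)))) = 0"
      using log_mean_unit_circle[of "- 1"] by simp_all
    have int': "integrable unif01 (\<lambda>t. ln (cmod (unit_circle t - (- 1))) / 2 - ln 2)"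
      using int by (intro Bochner_Integration.integrable_diff integrable_divide) auto
    have v': "(LINT t|unif01. ln (cmod (unit_circle t - (- 1))) / 2 - ln 2) = - ln 2"
      using int v unif01.prob_space by (simp del: diff_minus_eq_add)
    have "ln (cmod (1 + z)) = - ln 2"
    proof -
      have "1 + z = of_real (1/2)" using True by simp
      then have "cmod (1 + z) = \<bar>1 / 2\<bar>" by (simp only: norm_of_real)
      then have "ln (cmod (1 + z)) = ln (1 / 2)" by (simp only: abs_divide abs_one abs_numeral)
      then show ?thesis by (simp add: ln_div)
    qed
    moreover have "integrable unif01 (\<lambda>t. ln (cmod (z + 1 + loop_param (unit_circle t))))"
      using int' by (subst integrable_cong_AE[OF _ _ ae, symmetric]) auto
    moreover have "(LINT t|unif01. ln (cmod (z + 1 + loop_param (unit_circle t)))) = - ln 2"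
      using v' by (subst integral_cong_AE[OF _ _ ae, symmetric]) auto
    ultimately show ?thesis by simp
  qed
  then show "integrable unif01 (\<lambda>t. ln (cmod (z + 1 + loop_param (unit_circle t))))"
    and "(LINT t|unif01. ln (cmod (z + 1 + loop_param (unit_circle t)))) = ln (cmod (1 + z))"
    by auto
qed

text \<open>
  Since \<open>z\<close> and \<open>-1 - z\<close> are the two points over the same \<open>u = 4 z (z + 1)\<close>, one has
  \<open>4 (z - p) (z + 1 + p) = u - v\<close> for \<open>p = loop_param v\<close>. Thus \<open>- ln |z - p|\<close> is the sum of \<open>ln 4\<close>, of
  \<open>ln |z + 1 + p|\<close> with mean \<open>ln |1 + z|\<close>, and of \<open>- ln |u - v|\<close> with mean \<open>0\<close>.
\<close>

lemma loop_potential: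
  assumes z: "z \<in> loop_region"
  shows "(\<integral>\<^sup>+ t. log_ker z t \<partial>loop_measure) = ennreal (ln 4 + ln (cmod (1 + z)))"
proof -
  define u where "u = 4 * (z * (z + 1))"
  have u: "cmod u \<le> 1" using z by (simp add: u_def loop_region_def norm_mult)
  define h where "h = (\<lambda>t. ln 4 + ln (cmod (z + 1 + loop_param (unit_circle t))) - ln (cmod (unit_circle t - u)))"
  have [measurable]: "log_ker z \<in> borel_measurable borel"
    unfolding log_ker_def by measurable
  have "(\<integral>\<^sup>+ t. log_ker z t \<partial>loop_measure) = (\<integral>\<^sup>+ t. log_ker z (loop_param (unit_circle t)) \<partial>unif01)"
    unfolding loop_measure_def by (subst nn_integral_distr) auto
  have ae: "AE t in unif01. log_ker z (loop_param (unit_circle t)) = ennreal (h t) \<and> 0 \<le> h t"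
    using AE_unit_circle_neq[of u]
  proof eventually_elim
    case (elim t)
    define p where "p = loop_param (unit_circle t)"
    have fac: "4 * ((z - p) * (z + 1 + p)) = u - unit_circle t"
      using loop_param_quadratic[of "unit_circle t"] unfolding u_def p_def by (simp add: algebra_simps)
    then have nz: "z - p \<noteq> 0" "z + 1 + p \<noteq> 0" using elim by auto
    have "4 * (cmod (z - p) * cmod (z + 1 + p)) = cmod (unit_circle t - u)"
      using arg_cong[OF fac, of cmod] by (simp add: norm_mult norm_minus_commute)
    then have "ln 4 + (ln (cmod (z - p)) + ln (cmod (z + 1 + p))) = ln (cmod (unit_circle t - u))"
      using nz by (simp flip: ln_mult_pos)
    then have ht: "h t = ln (1 / cmod (z - p))"
      using nz by (simp add: h_def p_def ln_div)
    have "cmod (z - p) \<le> 1"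
      unfolding p_def by (intro loop_region_diam z loop_param_in_region) simp
    then have "0 \<le> h t" unfolding ht using nz by simp
    then show ?case using nz ht by (simp add: log_ker_def p_def)
  qed
  have int: "integrable unif01 h"
    unfolding h_def by (intro Bochner_Integration.integrable_diff Bochner_Integration.integrable_add
        log_mean_reflected z log_mean_unit_circle u) auto
  have "(LINT t|unif01. h t) = ln 4 + ln (cmod (1 + z)) - 0"
    unfolding h_def
    using log_mean_reflected[OF z] log_mean_unit_circle[OF u] unif01.prob_space
    by (subst Bochner_Integration.integral_diff, simp, simp, subst Bochner_Integration.integral_add) auto
  moreover have "(\<integral>\<^sup>+ t. log_ker z (loop_param (unit_circle t)) \<partial>unif01) = (\<integral>\<^sup>+ t. ennreal (h t) \<partial>unif01)"
    using ae by (intro nn_integral_cong_AE) auto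
  moreover have "(\<integral>\<^sup>+ t. ennreal (h t) \<partial>unif01) = ennreal (LINT t|unif01. h t)"
    using ae by (intro nn_integral_eq_integral int) auto
  ultimately show ?thesis
    using \<open>(\<integral>\<^sup>+ t. log_ker z t \<partial>loop_measure) = _\<close> by simp
qed

lemma loop_measure_log: 
  shows "integrable loop_measure (\<lambda>z. ln (cmod (1 + z)))" "(LINT z|loop_measure. ln (cmod (1 + z))) = 0"
proof -
  have "0 \<in> loop_region" using zero_in_loop_interior loop_interior_subset by blast
  note * = log_mean_reflected[OF this]
  show "integrable loop_measure (\<lambda>z. ln (cmod (1 + z)))"
    unfolding loop_measure_def using * by (subst integrable_distr_eq) auto
  show "(LINT z|loop_measure. ln (cmod (1 + z))) = 0"
    unfolding loop_measure_def using * by (subst integral_distr) auto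
qed

text \<open>
  The potential of a circle is constant on the disc that it bounds. So the circle has finite
  energy, which is used to see that discs have positive capacity.
\<close>

lemma circle_potential:
  assumes r: "0 < r" "r \<le> 1/2" and z: "cmod z \<le> r"
  shows "(\<integral>\<^sup>+ t. log_ker z t \<partial>distr unif01 borel (\<lambda>t. of_real r * unit_circle t)) = ennreal (ln (1 / r))"
proof -
  define a where "a = z / of_real r"
  have a: "cmod a \<le> 1" using r z by (simp add: a_def norm_divide)
  define h where "h = (\<lambda>t. ln (1 / r) - ln (cmod (unit_circle t - a)))"
  have [measurable]: "log_ker z \<in> borel_measurable borel"
    unfolding log_ker_def by measurable
  have "(\<integral>\<^sup>+ t. log_ker z t \<partial>distr unif01 borel (\<lambda>t. of_real r * unit_circle t))
      = (\<integral>\<^sup>+ t. log_ker z (of_real r * unit_circle t) \<partial>unif01)"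
    by (subst nn_integral_distr) auto
  moreover have ae: "AE t in unif01. log_ker z (of_real r * unit_circle t) = ennreal (h t) \<and> 0 \<le> h t"
    using AE_unit_circle_neq[of a]
  proof eventually_elim
    case (elim t)
    have "z - of_real r * unit_circle t = - of_real r * (unit_circle t - a)"
      using r by (simp add: a_def field_simps)
    then have c: "cmod (z - of_real r * unit_circle t) = r * cmod (unit_circle t - a)"
      using r by (simp add: norm_mult)
    have nz: "0 < cmod (unit_circle t - a)" using elim by simp
    have ht: "h t = ln (1 / cmod (z - of_real r * unit_circle t))"
      unfolding c h_def using r nz by (simp add: ln_div ln_mult)
    have "cmod (unit_circle t - a) \<le> 2" using norm_triangle_ineq4[of "unit_circle t" a] a by simp
    then have "r * cmod (unit_circle t - a) \<le> 1/2 * 2" using r by (intro mult_mono) auto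
    then have "0 \<le> h t" unfolding ht c using r nz by simp
    moreover have "z \<noteq> of_real r * unit_circle t" using c r nz by auto
    ultimately show ?case using ht by (simp add: log_ker_def)
  qed
  then have "(\<integral>\<^sup>+ t. log_ker z (of_real r * unit_circle t) \<partial>unif01) = (\<integral>\<^sup>+ t. ennreal (h t) \<partial>unif01)"
    by (intro nn_integral_cong_AE) auto
  moreover have int: "integrable unif01 h"
    unfolding h_def by (intro Bochner_Integration.integrable_diff log_mean_unit_circle a) auto
  moreover have "(\<integral>\<^sup>+ t. ennreal (h t) \<partial>unif01) = ennreal (LINT t|unif01. h t)"
    using ae by (intro nn_integral_eq_integral int) auto
  moreover have "(LINT t|unif01. h t) = ln (1 / r)"
    unfolding h_def using log_mean_unit_circle[OF a] unif01.prob_space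
    by (subst Bochner_Integration.integral_diff) auto
  ultimately show ?thesis by simp
qed

section \<open>The logarithmic kernel as a mixture of Gaussians\<close>

text \<open>
  A Frullani integral: write the integrand as the integral of \<open>exp (- s y) / 2\<close> over \<open>y\<close> from \<open>x^2\<close>
  to \<open>1\<close> and exchange the integrations, which leaves \<open>1 / (2 y)\<close>. For \<open>x \<le> 1\<close> everything is
  nonnegative, and \<open>x = 0\<close> is included with value infinity.
\<close>

lemma exp_frullani:
  fixes x :: real
  assumes x: "0 \<le> x" "x \<le> 1"
  shows "(\<integral>\<^sup>+ s. ennreal ((exp (- s * x\<^sup>2) - exp (- s)) / (2 * s)) * indicator {0<..} s \<partial>lborel)
           = (if x = 0 then \<infinity> else ennreal (ln (1 / x)))"
proof -
  define a where "a = x\<^sup>2"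
  have a: "0 \<le> a" "a \<le> 1" using x by (auto simp: a_def power_le_one)
  have inner: "(\<integral>\<^sup>+ y. ennreal (exp (- s * y) / 2) * indicator {a..1} y \<partial>lborel)
      = ennreal ((exp (- s * a) - exp (- s)) / (2 * s))" if s: "0 < s" for s :: real
  proof -
    have "(\<integral>\<^sup>+ y. ennreal (exp (- s * y) / 2) * indicator {a..1} y \<partial>lborel)
        = ennreal (- exp (- s * 1) / (2 * s) - (- exp (- s * a) / (2 * s)))"
      by (rule nn_integral_FTC_Icc) (use s a in \<open>auto intro!: derivative_eq_intros\<close>)
    also have "- exp (- s * 1) / (2 * s) - (- exp (- s * a) / (2 * s)) = (exp (- s * a) - exp (- s)) / (2 * s)"
      by (simp add: diff_divide_distrib)
    finally show ?thesis .
  qed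
  have outer: "(\<integral>\<^sup>+ s. ennreal (exp (- s * y) / 2) * indicator {0<..} s \<partial>lborel) = ennreal (1 / (2 * y))"
    if y: "0 < y" for y :: real
  proof -
    have "(\<integral>\<^sup>+ s. ennreal (exp (- s * y) / 2) * indicator {0<..} s \<partial>lborel)
        = (\<integral>\<^sup>+ s. ennreal (exp (- s * y) / 2) * indicator {0..} s \<partial>lborel)"
      using AE_lborel_singleton[of "0::real"]
      by (intro nn_integral_cong_AE) (auto split: split_indicator elim!: eventually_mono)
    also have "\<dots> = ennreal (0 - (- exp (- 0 * y) / (2 * y)))"
    proof (rule nn_integral_FTC_atLeast)
      have "filterlim (\<lambda>s. y * s) at_top at_top"
        by (rule filterlim_tendsto_pos_mult_at_top[OF tendsto_const y filterlim_ident])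
      then have "filterlim (\<lambda>s. - s * y) at_bot at_top"
        by (simp add: filterlim_uminus_at_bot mult.commute)
      then have "((\<lambda>s. exp (- s * y)) \<longlongrightarrow> 0) at_top"
        by (rule filterlim_compose[OF exp_at_bot])
      then have "((\<lambda>s. - exp (- s * y) / (2 * y)) \<longlongrightarrow> - 0 / (2 * y)) at_top"
        by (intro tendsto_intros) (use y in auto)
      then show "((\<lambda>s. - exp (- s * y) / (2 * y)) \<longlongrightarrow> 0) at_top" by simp
    qed (use y in \<open>auto intro!: derivative_eq_intros\<close>)
    finally show ?thesis by simp
  qed
  have "(\<integral>\<^sup>+ s. ennreal ((exp (- s * x\<^sup>2) - exp (- s)) / (2 * s)) * indicator {0<..} s \<partial>lborel)
      = (\<integral>\<^sup>+ s. (\<integral>\<^sup>+ y. ennreal (exp (- s * y) / 2) * indicator {a..1} y * indicator {0<..} s \<partial>lborel) \<partial>lborel)"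
  proof (intro nn_integral_cong)
    fix s :: real
    show "ennreal ((exp (- s * x\<^sup>2) - exp (- s)) / (2 * s)) * indicator {0<..} s
        = (\<integral>\<^sup>+ y. ennreal (exp (- s * y) / 2) * indicator {a..1} y * indicator {0<..} s \<partial>lborel)"
      using inner[of s] by (cases "0 < s") (auto simp: a_def)
  qed
  also have "\<dots> = (\<integral>\<^sup>+ y. (\<integral>\<^sup>+ s. ennreal (exp (- s * y) / 2) * indicator {a..1} y * indicator {0<..} s \<partial>lborel) \<partial>lborel)"
    by (rule lborel_pair.Fubini') measurable
  also have "\<dots> = (\<integral>\<^sup>+ y. ennreal (1 / (2 * y)) * indicator {a..1} y \<partial>lborel)"
  proof (intro nn_integral_cong_AE)
    show "AE y in lborel. (\<integral>\<^sup>+ s. ennreal (exp (- s * y) / 2) * indicator {a..1} y * indicator {0<..} s \<partial>lborel)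
        = ennreal (1 / (2 * y)) * indicator {a..1} y"
      using AE_lborel_singleton[of "0::real"]
    proof eventually_elim
      case (elim y)
      then show ?case
        using outer[of y] a by (auto split: split_indicator)
    qed
  qed
  finally have main: "(\<integral>\<^sup>+ s. ennreal ((exp (- s * x\<^sup>2) - exp (- s)) / (2 * s)) * indicator {0<..} s \<partial>lborel)
      = (\<integral>\<^sup>+ y. ennreal (1 / (2 * y)) * indicator {a..1} y \<partial>lborel)" .
  have logint: "(\<integral>\<^sup>+ y. ennreal (1 / (2 * y)) * indicator {b..1} y \<partial>lborel) = ennreal (- ln b / 2)"
    if b: "0 < b" "b \<le> 1" for b :: real
  proof -
    have "(\<integral>\<^sup>+ y. ennreal (1 / (2 * y)) * indicator {b..1} y \<partial>lborel) = ennreal (ln 1 / 2 - ln b / 2)"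
      by (rule nn_integral_FTC_Icc) (use b in \<open>auto intro!: derivative_eq_intros\<close>)
    then show ?thesis by simp
  qed
  show ?thesis
  proof (cases "x = 0")
    case False
    then have "0 < a" using x by (simp add: a_def)
    then show ?thesis
      unfolding main using logint[of a] a False x by (simp add: a_def ln_div ln_realpow)
  next
    case True
    \<comment> \<open>Integrating only from \<open>exp (- 2 n)\<close> on already gives \<open>n\<close>.\<close>
    have "ennreal (real n) \<le> (\<integral>\<^sup>+ y. ennreal (1 / (2 * y)) * indicator {a..1} y \<partial>lborel)" for n
    proof -
      have "ennreal (real n) = (\<integral>\<^sup>+ y. ennreal (1 / (2 * y)) * indicator {exp (- 2 * real n)..1} y \<partial>lborel)"
        by (subst logint) auto
      also have "\<dots> \<le> (\<integral>\<^sup>+ y. ennreal (1 / (2 * y)) * indicator {a..1} y \<partial>lborel)"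
        using True by (intro nn_integral_mono) (auto split: split_indicator simp: a_def intro: order_trans[OF exp_ge_zero])
      finally show ?thesis .
    qed
    then have "(\<integral>\<^sup>+ y. ennreal (1 / (2 * y)) * indicator {a..1} y \<partial>lborel) = \<infinity>"
      using ennreal_Ex_less_of_nat[of "\<integral>\<^sup>+ y. ennreal (1 / (2 * y)) * indicator {a..1} y \<partial>lborel"]
      by (fastforce simp: ennreal_of_nat_eq_real_of_nat not_less[symmetric] less_top[symmetric])
    then show ?thesis unfolding main using True by simp
  qed
qed

text \<open>
  The centre is a pair of reals, so that integrals over it can be split into two integrals over
  lines.
\<close>

definition gauss :: "real \<Rightarrow> complex \<Rightarrow> real \<times> real \<Rightarrow> real" where
  "gauss s z w = exp (- 2 * s * ((Re z - fst w)\<^sup>2 + (Im z - snd w)\<^sup>2))"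

text \<open>
  Completing the square turns the product into a normal density with mean \<open>(x + y) / 2\<close> and
  variance \<open>1 / (8 s)\<close>.
\<close>

lemma gauss_convolution_line:
  assumes s: "0 < s"
  shows "(\<integral>\<^sup>+ a. ennreal (exp (- 2 * s * (x - a)\<^sup>2) * exp (- 2 * s * (y - a)\<^sup>2)) \<partial>lborel)
           = ennreal (sqrt (pi / (4 * s)) * exp (- s * (x - y)\<^sup>2))"
proof -
  define m where "m = (x + y) / 2"
  define \<sigma> where "\<sigma> = sqrt (1 / (8 * s))"
  have \<sigma>2: "\<sigma>\<^sup>2 = 1 / (8 * s)" using s by (simp add: \<sigma>_def)
  have \<sigma>: "0 < \<sigma>" using s by (simp add: \<sigma>_def)
  interpret N: prob_space "density lborel (normal_density m \<sigma>)"
    using prob_space_normal_density[OF \<sigma>] .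
  have eq: "exp (- 2 * s * (x - a)\<^sup>2) * exp (- 2 * s * (y - a)\<^sup>2)
      = sqrt (pi / (4 * s)) * exp (- s * (x - y)\<^sup>2) * normal_density m \<sigma> a" for a
  proof -
    have "- 2 * s * (x - a)\<^sup>2 + (- 2 * s * (y - a)\<^sup>2) = - s * (x - y)\<^sup>2 + (- (4 * s * (a - m)\<^sup>2))"
      by (simp add: m_def power2_eq_square field_simps)
    then have "exp (- 2 * s * (x - a)\<^sup>2) * exp (- 2 * s * (y - a)\<^sup>2) = exp (- s * (x - y)\<^sup>2) * exp (- (4 * s * (a - m)\<^sup>2))"
      by (simp flip: exp_add)
    moreover have "normal_density m \<sigma> a = 1 / sqrt (pi / (4 * s)) * exp (- (4 * s * (a - m)\<^sup>2))"
      unfolding normal_density_def \<sigma>2 using s by (simp add: field_simps)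
    ultimately show ?thesis using s by simp
  qed
  have "(\<integral>\<^sup>+ a. ennreal (exp (- 2 * s * (x - a)\<^sup>2) * exp (- 2 * s * (y - a)\<^sup>2)) \<partial>lborel)
      = (\<integral>\<^sup>+ a. ennreal (sqrt (pi / (4 * s)) * exp (- s * (x - y)\<^sup>2)) * ennreal (normal_density m \<sigma> a) \<partial>lborel)"
    unfolding eq using s by (intro nn_integral_cong ennreal_mult) auto
  also have "\<dots> = ennreal (sqrt (pi / (4 * s)) * exp (- s * (x - y)\<^sup>2)) * (\<integral>\<^sup>+ a. ennreal (normal_density m \<sigma> a) \<partial>lborel)"
    by (intro nn_integral_cmult) auto
  also have "(\<integral>\<^sup>+ a. ennreal (normal_density m \<sigma> a) \<partial>lborel) = 1"
    using N.emeasure_space_1 by (simp add: emeasure_density)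
  finally show ?thesis by simp
qed

lemma gauss_convolution:
  assumes s: "0 < s"
  shows "(\<integral>\<^sup>+ w. ennreal (gauss s z w * gauss s t w) \<partial>(lborel \<Otimes>\<^sub>M lborel))
           = ennreal (pi / (4 * s) * exp (- s * (cmod (z - t))\<^sup>2))"
proof -
  define f where "f = (\<lambda>x y a. exp (- 2 * s * (x - a)\<^sup>2) * exp (- 2 * s * (y - a)\<^sup>2))"
  have f: "gauss s z w * gauss s t w = f (Re z) (Re t) (fst w) * f (Im z) (Im t) (snd w)" for w
    by (simp add: gauss_def f_def algebra_simps exp_add[symmetric])
  have f0: "0 \<le> f x y a" for x y a by (simp add: f_def)
  have [measurable]: "f x y \<in> borel_measurable borel" for x y unfolding f_def by measurable
  have fi: "(\<integral>\<^sup>+ a. ennreal (f x y a) \<partial>lborel) = ennreal (sqrt (pi / (4 * s)) * exp (- s * (x - y)\<^sup>2))" for x y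
    unfolding f_def by (rule gauss_convolution_line[OF s])
  have "(\<integral>\<^sup>+ w. ennreal (gauss s z w * gauss s t w) \<partial>(lborel \<Otimes>\<^sub>M lborel))
      = (\<integral>\<^sup>+ a. \<integral>\<^sup>+ b. ennreal (f (Re z) (Re t) a * f (Im z) (Im t) b) \<partial>lborel \<partial>lborel)"
    unfolding f by (subst lborel.nn_integral_fst[symmetric]) (auto simp: split_beta')
  also have "\<dots> = (\<integral>\<^sup>+ a. ennreal (f (Re z) (Re t) a) * (\<integral>\<^sup>+ b. ennreal (f (Im z) (Im t) b) \<partial>lborel) \<partial>lborel)"
    by (subst nn_integral_cmult[symmetric]) (auto simp: ennreal_mult f0)
  also have "\<dots> = (\<integral>\<^sup>+ a. ennreal (f (Re z) (Re t) a) \<partial>lborel) * (\<integral>\<^sup>+ b. ennreal (f (Im z) (Im t) b) \<partial>lborel)"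
    by (rule nn_integral_multc) auto
  also have "\<dots> = ennreal ((sqrt (pi / (4 * s)) * exp (- s * (Re z - Re t)\<^sup>2)) * (sqrt (pi / (4 * s)) * exp (- s * (Im z - Im t)\<^sup>2)))"
    unfolding fi using s by (intro ennreal_mult[symmetric]) auto
  also have "(sqrt (pi / (4 * s)) * exp (- s * (Re z - Re t)\<^sup>2)) * (sqrt (pi / (4 * s)) * exp (- s * (Im z - Im t)\<^sup>2))
      = pi / (4 * s) * exp (- s * (cmod (z - t))\<^sup>2)"
  proof -
    have "sqrt (pi / (4 * s)) * sqrt (pi / (4 * s)) = pi / (4 * s)" using s by simp
    moreover have "exp (- s * (Re z - Re t)\<^sup>2) * exp (- s * (Im z - Im t)\<^sup>2) = exp (- s * (cmod (z - t))\<^sup>2)"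
      by (simp add: cmod_power2 algebra_simps flip: exp_add)
    ultimately show ?thesis by (metis mult.assoc mult.left_commute)
  qed
  finally show ?thesis .
qed

lemma gauss_bounds: "0 < gauss s z w" "0 \<le> s \<Longrightarrow> gauss s z w \<le> 1"
  by (auto simp: gauss_def intro!: mult_nonneg_nonneg)

lemma measurable_gauss [measurable (raw)]:
  "s \<in> borel_measurable M \<Longrightarrow> f \<in> borel_measurable M \<Longrightarrow> g \<in> measurable M (borel \<Otimes>\<^sub>M borel) \<Longrightarrow>
     (\<lambda>x. gauss (s x) (f x) (g x)) \<in> borel_measurable M"
proof -
  assume [measurable]: "s \<in> borel_measurable M" "f \<in> borel_measurable M"
  assume g: "g \<in> measurable M (borel \<Otimes>\<^sub>M borel)"
  have [measurable]: "(\<lambda>x. fst (g x)) \<in> borel_measurable M" "(\<lambda>x. snd (g x)) \<in> borel_measurable M"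
    using measurable_compose[OF g measurable_fst] measurable_compose[OF g measurable_snd] by auto
  have [measurable]: "(\<lambda>x. Re (f x)) \<in> borel_measurable M" "(\<lambda>x. Im (f x)) \<in> borel_measurable M"
    by measurable
  show ?thesis unfolding gauss_def by measurable
qed

lemma measurable_gauss_point [measurable]: "(\<lambda>z. gauss s z w) \<in> borel_measurable borel"
  unfolding gauss_def by (intro borel_measurable_continuous_onI continuous_intros)

section \<open>Positive definiteness of the logarithmic energy\<close>

definition gauss_avg :: "real \<Rightarrow> complex measure \<Rightarrow> real \<times> real \<Rightarrow> real" where
  "gauss_avg s \<tau> w = (LINT z|\<tau>. gauss s z w)"

definition gauss_energy :: "real \<Rightarrow> complex measure \<Rightarrow> complex measure \<Rightarrow> real" where
  "gauss_energy s \<tau> \<sigma> = (LINT z|\<tau>. LINT t|\<sigma>. exp (- s * (cmod (z - t))\<^sup>2))"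

definition mutual_energy :: "complex measure \<Rightarrow> complex measure \<Rightarrow> ennreal" where
  "mutual_energy \<tau> \<sigma> = (\<integral>\<^sup>+ z. \<integral>\<^sup>+ t. log_ker z t \<partial>\<sigma> \<partial>\<tau>)"

text \<open>
  Energies of a difference of measures involve all pairs formed from two measures. The lemmas are
  proved for one pair and then used for the exchanged pair and for the pairs of equal measures.
\<close>

locale borel_prob_pair = T: prob_space \<tau> + S: prob_space \<sigma> for \<tau> \<sigma> :: "complex measure" +
  assumes sets_T [measurable_cong, simp]: "sets \<tau> = sets borel"
    and sets_S [measurable_cong, simp]: "sets \<sigma> = sets borel"
begin

sublocale TS: pair_sigma_finite \<tau> \<sigma> ..

lemma borel_prob_pair_swap: "borel_prob_pair \<sigma> \<tau>" by unfold_locales simp_all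
lemma borel_prob_pair_left: "borel_prob_pair \<tau> \<tau>" by unfold_locales simp_all
lemma borel_prob_pair_right: "borel_prob_pair \<sigma> \<sigma>" by unfold_locales simp_all

lemma measurable_gauss_avg [measurable]: "gauss_avg s \<tau> \<in> borel_measurable (lborel \<Otimes>\<^sub>M lborel)"
  unfolding gauss_avg_def by measurable

lemma integrable_gauss: "0 \<le> s \<Longrightarrow> integrable \<tau> (\<lambda>z. gauss s z w)"
  by (rule T.integrable_const_bound[of _ 1]) (use gauss_bounds in \<open>auto simp: abs_of_pos\<close>)

lemma gauss_avg_bounds:
  assumes "0 \<le> s"
  shows "0 \<le> gauss_avg s \<tau> w" "gauss_avg s \<tau> w \<le> 1"
proof -
  show "0 \<le> gauss_avg s \<tau> w"
    unfolding gauss_avg_def by (intro integral_nonneg_AE) (simp add: gauss_bounds less_imp_le)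
  have "gauss_avg s \<tau> w \<le> (LINT z|\<tau>. 1)"
    unfolding gauss_avg_def by (intro integral_mono integrable_gauss assms gauss_bounds) auto
  then show "gauss_avg s \<tau> w \<le> 1" by (simp add: T.prob_space)
qed

lemma ennreal_gauss_avg:
  assumes "0 \<le> s"
  shows "ennreal (gauss_avg s \<tau> w) = (\<integral>\<^sup>+ z. ennreal (gauss s z w) \<partial>\<tau>)"
  unfolding gauss_avg_def
  by (intro nn_integral_eq_integral[symmetric] integrable_gauss assms) (simp add: gauss_bounds less_imp_le)

lemma inner_gauss_energy:
  assumes "0 \<le> s"
  shows "integrable \<sigma> (\<lambda>t. exp (- s * (cmod (z - t))\<^sup>2))"
    "ennreal (LINT t|\<sigma>. exp (- s * (cmod (z - t))\<^sup>2)) = (\<integral>\<^sup>+ t. ennreal (exp (- s * (cmod (z - t))\<^sup>2)) \<partial>\<sigma>)"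
    "0 \<le> (LINT t|\<sigma>. exp (- s * (cmod (z - t))\<^sup>2))" "(LINT t|\<sigma>. exp (- s * (cmod (z - t))\<^sup>2)) \<le> 1"
proof -
  show int: "integrable \<sigma> (\<lambda>t. exp (- s * (cmod (z - t))\<^sup>2))"
    by (rule S.integrable_const_bound[of _ 1]) (use assms in auto)
  then show "ennreal (LINT t|\<sigma>. exp (- s * (cmod (z - t))\<^sup>2)) = (\<integral>\<^sup>+ t. ennreal (exp (- s * (cmod (z - t))\<^sup>2)) \<partial>\<sigma>)"
    by (intro nn_integral_eq_integral[symmetric]) auto
  show "0 \<le> (LINT t|\<sigma>. exp (- s * (cmod (z - t))\<^sup>2))" by simp
  have "(LINT t|\<sigma>. exp (- s * (cmod (z - t))\<^sup>2)) \<le> (LINT t|\<sigma>. 1)"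
    using assms by (intro integral_mono int) auto
  then show "(LINT t|\<sigma>. exp (- s * (cmod (z - t))\<^sup>2)) \<le> 1" by (simp add: S.prob_space)
qed

lemma ennreal_gauss_energy:
  assumes "0 \<le> s"
  shows "integrable \<tau> (\<lambda>z. LINT t|\<sigma>. exp (- s * (cmod (z - t))\<^sup>2))"
    "ennreal (gauss_energy s \<tau> \<sigma>) = (\<integral>\<^sup>+ z. \<integral>\<^sup>+ t. ennreal (exp (- s * (cmod (z - t))\<^sup>2)) \<partial>\<sigma> \<partial>\<tau>)"
proof -
  show int: "integrable \<tau> (\<lambda>z. LINT t|\<sigma>. exp (- s * (cmod (z - t))\<^sup>2))"
    by (rule T.integrable_const_bound[of _ 1]) (use inner_gauss_energy[OF assms] in auto)
  show "ennreal (gauss_energy s \<tau> \<sigma>) = (\<integral>\<^sup>+ z. \<integral>\<^sup>+ t. ennreal (exp (- s * (cmod (z - t))\<^sup>2)) \<partial>\<sigma> \<partial>\<tau>)"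
    unfolding gauss_energy_def inner_gauss_energy(2)[OF assms, symmetric]
    by (intro nn_integral_eq_integral[symmetric] int) auto
qed

text \<open>
  Tonelli's theorem applied to \<open>gauss_convolution\<close>: the mutual Gaussian energy is an inner product
  of Gaussian averages.
\<close>

lemma gauss_energy_convolution:
  assumes s: "0 < s"
  shows "(\<integral>\<^sup>+ w. ennreal (gauss_avg s \<tau> w * gauss_avg s \<sigma> w) \<partial>(lborel \<Otimes>\<^sub>M lborel))
           = ennreal (pi / (4 * s) * gauss_energy s \<tau> \<sigma>)"
proof -
  interpret L: sigma_finite_measure "lborel \<Otimes>\<^sub>M lborel :: (real \<times> real) measure"
    unfolding lborel_prod by (rule lborel.sigma_finite_measure_axioms)
  interpret LT: pair_sigma_finite "lborel \<Otimes>\<^sub>M lborel :: (real \<times> real) measure" \<tau> ..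
  interpret LS: pair_sigma_finite "lborel \<Otimes>\<^sub>M lborel :: (real \<times> real) measure" \<sigma> ..
  interpret swap: borel_prob_pair \<sigma> \<tau> by (rule borel_prob_pair_swap)
  have s0: "0 \<le> s" using s by simp
  have "(\<integral>\<^sup>+ w. ennreal (gauss_avg s \<tau> w * gauss_avg s \<sigma> w) \<partial>(lborel \<Otimes>\<^sub>M lborel))
      = (\<integral>\<^sup>+ w. \<integral>\<^sup>+ z. \<integral>\<^sup>+ t. ennreal (gauss s z w * gauss s t w) \<partial>\<sigma> \<partial>\<tau> \<partial>(lborel \<Otimes>\<^sub>M lborel))"
  proof (intro nn_integral_cong)
    fix w :: "real \<times> real"
    have "ennreal (gauss_avg s \<tau> w * gauss_avg s \<sigma> w)
        = (\<integral>\<^sup>+ z. ennreal (gauss s z w) \<partial>\<tau>) * (\<integral>\<^sup>+ t. ennreal (gauss s t w) \<partial>\<sigma>)"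
      using gauss_avg_bounds[OF s0, of w] swap.gauss_avg_bounds[OF s0, of w]
      by (simp add: ennreal_mult ennreal_gauss_avg[OF s0] swap.ennreal_gauss_avg[OF s0])
    also have "\<dots> = (\<integral>\<^sup>+ z. ennreal (gauss s z w) * (\<integral>\<^sup>+ t. ennreal (gauss s t w) \<partial>\<sigma>) \<partial>\<tau>)"
      by (rule nn_integral_multc[symmetric]) simp
    also have "\<dots> = (\<integral>\<^sup>+ z. \<integral>\<^sup>+ t. ennreal (gauss s z w) * ennreal (gauss s t w) \<partial>\<sigma> \<partial>\<tau>)"
      by (intro nn_integral_cong nn_integral_cmult[symmetric]) simp
    also have "\<dots> = (\<integral>\<^sup>+ z. \<integral>\<^sup>+ t. ennreal (gauss s z w * gauss s t w) \<partial>\<sigma> \<partial>\<tau>)"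
      by (intro nn_integral_cong ennreal_mult[symmetric]) (auto simp: gauss_bounds less_imp_le)
    finally show "ennreal (gauss_avg s \<tau> w * gauss_avg s \<sigma> w)
        = (\<integral>\<^sup>+ z. \<integral>\<^sup>+ t. ennreal (gauss s z w * gauss s t w) \<partial>\<sigma> \<partial>\<tau>)" .
  qed
  also have "\<dots> = (\<integral>\<^sup>+ z. \<integral>\<^sup>+ w. \<integral>\<^sup>+ t. ennreal (gauss s z w * gauss s t w) \<partial>\<sigma> \<partial>(lborel \<Otimes>\<^sub>M lborel) \<partial>\<tau>)"
    by (rule LT.Fubini'[symmetric]) measurable
  also have "\<dots> = (\<integral>\<^sup>+ z. \<integral>\<^sup>+ t. \<integral>\<^sup>+ w. ennreal (gauss s z w * gauss s t w) \<partial>(lborel \<Otimes>\<^sub>M lborel) \<partial>\<sigma> \<partial>\<tau>)"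
    by (intro nn_integral_cong LS.Fubini'[symmetric]) measurable
  also have "\<dots> = (\<integral>\<^sup>+ z. \<integral>\<^sup>+ t. ennreal (pi / (4 * s)) * ennreal (exp (- s * (cmod (z - t))\<^sup>2)) \<partial>\<sigma> \<partial>\<tau>)"
    unfolding gauss_convolution[OF s] using s by (intro nn_integral_cong ennreal_mult) auto
  also have "\<dots> = (\<integral>\<^sup>+ z. ennreal (pi / (4 * s)) * (\<integral>\<^sup>+ t. ennreal (exp (- s * (cmod (z - t))\<^sup>2)) \<partial>\<sigma>) \<partial>\<tau>)"
    by (intro nn_integral_cong nn_integral_cmult) measurable
  also have "\<dots> = ennreal (pi / (4 * s)) * (\<integral>\<^sup>+ z. \<integral>\<^sup>+ t. ennreal (exp (- s * (cmod (z - t))\<^sup>2)) \<partial>\<sigma> \<partial>\<tau>)"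
    by (intro nn_integral_cmult) measurable
  also have "\<dots> = ennreal (pi / (4 * s) * gauss_energy s \<tau> \<sigma>)"
    unfolding ennreal_gauss_energy(2)[OF s0, symmetric] using s by (intro ennreal_mult'[symmetric]) simp
  finally show ?thesis .
qed

lemma gauss_energy_nonneg: "0 \<le> gauss_energy s \<tau> \<sigma>"
  unfolding gauss_energy_def by (intro integral_nonneg_AE) simp

lemma integrable_gauss_avg_product:
  assumes s: "0 < s"
  shows "integrable (lborel \<Otimes>\<^sub>M lborel) (\<lambda>w. gauss_avg s \<tau> w * gauss_avg s \<sigma> w)"
    "(LINT w|(lborel \<Otimes>\<^sub>M lborel). gauss_avg s \<tau> w * gauss_avg s \<sigma> w) = pi / (4 * s) * gauss_energy s \<tau> \<sigma>"
proof -
  interpret swap: borel_prob_pair \<sigma> \<tau> by (rule borel_prob_pair_swap)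
  have nn: "0 \<le> gauss_avg s \<tau> w * gauss_avg s \<sigma> w" for w
    using s gauss_avg_bounds(1)[of s w] swap.gauss_avg_bounds(1)[of s w] by simp
  show int: "integrable (lborel \<Otimes>\<^sub>M lborel) (\<lambda>w. gauss_avg s \<tau> w * gauss_avg s \<sigma> w)"
    using gauss_energy_convolution[OF s] nn by (intro integrableI_nonneg) auto
  have "ennreal (LINT w|(lborel \<Otimes>\<^sub>M lborel). gauss_avg s \<tau> w * gauss_avg s \<sigma> w)
      = ennreal (pi / (4 * s) * gauss_energy s \<tau> \<sigma>)"
    unfolding gauss_energy_convolution[OF s, symmetric]
    using nn by (intro nn_integral_eq_integral[symmetric] int) auto
  then show "(LINT w|(lborel \<Otimes>\<^sub>M lborel). gauss_avg s \<tau> w * gauss_avg s \<sigma> w) = pi / (4 * s) * gauss_energy s \<tau> \<sigma>"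
    using s nn gauss_energy_nonneg by (subst (asm) ennreal_inj) (auto intro!: integral_nonneg_AE)
qed

text \<open>
  Up to the factor \<open>\<pi> / (4 s)\<close>, \<open>D\<close> is the integral of the square of the difference of the two
  Gaussian averages.
\<close>

lemma gauss_energy_difference:
  assumes s: "0 < s"
  defines "D \<equiv> gauss_energy s \<tau> \<tau> + gauss_energy s \<sigma> \<sigma> - 2 * gauss_energy s \<tau> \<sigma>"
  shows "0 \<le> D" "D = 0 \<Longrightarrow> AE w in lborel \<Otimes>\<^sub>M lborel. gauss_avg s \<tau> w = gauss_avg s \<sigma> w"
proof -
  interpret left: borel_prob_pair \<tau> \<tau> by (rule borel_prob_pair_left)
  interpret right: borel_prob_pair \<sigma> \<sigma> by (rule borel_prob_pair_right)
  let ?L = "lborel \<Otimes>\<^sub>M lborel :: (real \<times> real) measure"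
  have eq: "(gauss_avg s \<tau> w - gauss_avg s \<sigma> w)\<^sup>2 =
      gauss_avg s \<tau> w * gauss_avg s \<tau> w + gauss_avg s \<sigma> w * gauss_avg s \<sigma> w
      - 2 * (gauss_avg s \<tau> w * gauss_avg s \<sigma> w)" for w
    by (simp add: power2_eq_square algebra_simps)
  have int: "integrable ?L (\<lambda>w. (gauss_avg s \<tau> w - gauss_avg s \<sigma> w)\<^sup>2)"
    unfolding eq
    by (intro Bochner_Integration.integrable_diff Bochner_Integration.integrable_add integrable_mult_right
        left.integrable_gauss_avg_product right.integrable_gauss_avg_product integrable_gauss_avg_product s)
  have val: "(LINT w|?L. (gauss_avg s \<tau> w - gauss_avg s \<sigma> w)\<^sup>2) = pi / (4 * s) * D"
  proof -
    have "(LINT w|?L. (gauss_avg s \<tau> w - gauss_avg s \<sigma> w)\<^sup>2)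
        = pi / (4 * s) * gauss_energy s \<tau> \<tau> + pi / (4 * s) * gauss_energy s \<sigma> \<sigma>
          - 2 * (pi / (4 * s) * gauss_energy s \<tau> \<sigma>)"
      unfolding eq
      by (simp add: left.integrable_gauss_avg_product[OF s] right.integrable_gauss_avg_product[OF s]
          integrable_gauss_avg_product[OF s])
    then show ?thesis by (simp add: D_def algebra_simps)
  qed
  have "0 \<le> (LINT w|?L. (gauss_avg s \<tau> w - gauss_avg s \<sigma> w)\<^sup>2)" by simp
  then have "0 \<le> pi / (4 * s) * D" unfolding val .
  moreover have "0 < pi / (4 * s)" using s by simp
  ultimately show "0 \<le> D" by (metis mult_less_0_iff not_less order_less_irrefl)
  assume "D = 0"
  then have "(LINT w|?L. (gauss_avg s \<tau> w - gauss_avg s \<sigma> w)\<^sup>2) = 0" using val by simp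
  then have "AE w in ?L. (gauss_avg s \<tau> w - gauss_avg s \<sigma> w)\<^sup>2 = 0"
    using integral_nonneg_eq_0_iff_AE[OF int] by simp
  then show "AE w in ?L. gauss_avg s \<tau> w = gauss_avg s \<sigma> w" by simp
qed

end

text \<open>
  The indicator of an open set \<open>U\<close> is the limit of the continuous functions
  \<open>min 1 (k * infdist x (- U))\<close>, and open sets generate the Borel sets.
\<close>

lemma prob_measures_eqI_continuous:
  fixes \<tau> \<sigma> :: "complex measure"
  assumes prob: "prob_space \<tau>" "prob_space \<sigma>"
    and sets: "sets \<tau> = sets borel" "sets \<sigma> = sets borel"
    and eq: "\<And>f::complex \<Rightarrow> real. continuous_on UNIV f \<Longrightarrow> (LINT z|\<tau>. f z) = (LINT z|\<sigma>. f z)"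
  shows "\<tau> = \<sigma>"
proof -
  interpret T: prob_space \<tau> by fact
  interpret S: prob_space \<sigma> by fact
  have spaces: "space \<tau> = UNIV" "space \<sigma> = UNIV"
    using sets_eq_imp_space_eq[OF sets(1)] sets_eq_imp_space_eq[OF sets(2)] by simp_all
  show ?thesis
  proof (rule measure_eqI_generator_eq[where E="{U. open U}" and \<Omega>=UNIV and A="\<lambda>_. UNIV"])
    show "Int_stable {U::complex set. open U}" by (auto simp: Int_stable_def)
    show "sets \<tau> = sigma_sets UNIV {U. open U}" "sets \<sigma> = sigma_sets UNIV {U. open U}"
      using sets by (simp_all add: borel_def)
    fix U :: "complex set" assume "U \<in> {U. open U}"
    then have U: "open U" by simp
    show "emeasure \<tau> U = emeasure \<sigma> U"
    proof (cases "U = UNIV")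
      case True
      then show ?thesis
        using T.emeasure_space_1 S.emeasure_space_1 spaces by simp
    next
      case False
      define f where "f = (\<lambda>k x. min 1 (real k * infdist x (- U)))"
      have cont: "continuous_on UNIV (f k)" for k
        unfolding f_def by (intro continuous_intros)
      have f01: "0 \<le> f k x" "f k x \<le> 1" for k x by (auto simp: f_def infdist_nonneg)
      have lim: "(\<lambda>k. f k x) \<longlonglongrightarrow> indicator U x" for x
      proof (cases "x \<in> U")
        case True
        have "closed (- U)" using U by auto
        then have pos: "0 < infdist x (- U)"
          using False True in_closed_iff_infdist_zero[of "- U" x] infdist_nonneg[of x "- U"] by (auto simp: less_le)
        obtain k0 :: nat where k0: "1 < real k0 * infdist x (- U)" using reals_Archimedean3[OF pos] by blast
        have "f k x = 1" if "k \<ge> k0" for k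
        proof -
          have "real k0 * infdist x (- U) \<le> real k * infdist x (- U)"
            using that pos by (intro mult_right_mono) auto
          then show ?thesis using k0 by (simp add: f_def)
        qed
        then have "\<forall>\<^sub>F k in sequentially. f k x = 1" by (auto simp: eventually_sequentially)
        then show ?thesis using True by (simp add: tendsto_eventually)
      next
        case False
        then have "infdist x (- U) = 0" by simp
        then show ?thesis using False by (simp add: f_def)
      qed
      have conv: "(\<lambda>k. LINT x|M. f k x) \<longlonglongrightarrow> measure M U"
        if M: "prob_space M" "sets M = sets borel" for M
      proof -
        interpret M: prob_space M by fact
        have [measurable_cong]: "sets M = sets borel" by fact
        have [measurable]: "U \<in> sets borel" using U by simp
        have "(\<lambda>k. LINT x|M. f k x) \<longlonglongrightarrow> (LINT x|M. indicator U x)"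
        proof (rule integral_dominated_convergence[where w="\<lambda>_. 1"])
          show "f k \<in> borel_measurable M" for k
            using borel_measurable_continuous_onI[OF cont[of k]] M(2) measurable_cong_sets by blast
          show "(indicator U :: complex \<Rightarrow> real) \<in> borel_measurable M" by measurable
        qed (use f01 lim in auto)
        then show ?thesis using M.emeasure_space_1 sets_eq_imp_space_eq[OF M(2)] by simp
      qed
      have "measure \<tau> U = measure \<sigma> U"
        using LIMSEQ_unique[OF conv[OF prob(1) sets(1)]] conv[OF prob(2) sets(2)] eq[OF cont] by simp
      then show ?thesis by (simp add: T.emeasure_eq_measure S.emeasure_eq_measure)
    qed
  qed (auto simp: T.emeasure_eq_measure)
qed

text \<open>
  The real span of the exponentials of linear forms. Since products of exponentials are
  exponentials, it is an algebra, and the Stone-Weierstrass theorem applies to it.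
\<close>

inductive exp_span :: "(complex \<Rightarrow> real) \<Rightarrow> bool" where
  single: "exp_span (\<lambda>z. c * exp (inner z v))"
| add: "exp_span f \<Longrightarrow> exp_span g \<Longrightarrow> exp_span (\<lambda>z. f z + g z)"

lemma exp_span_continuous: "exp_span f \<Longrightarrow> continuous_on S f"
proof (induction rule: exp_span.induct)
  case (add f g)
  then show ?case by (intro continuous_on_add)
qed (intro continuous_intros)

lemma exp_span_mult_single: "exp_span f \<Longrightarrow> exp_span (\<lambda>z. c * exp (inner z v) * f z)"
proof (induction rule: exp_span.induct)
  case (single c' v')
  have "(\<lambda>z. c * exp (inner z v) * (c' * exp (inner z v'))) = (\<lambda>z. (c * c') * exp (inner z (v + v')))"
    by (simp add: inner_add_right exp_add mult_ac)
  then show ?case by (simp only: exp_span.single)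
next
  case (add f g)
  then show ?case using exp_span.add[OF add.IH] by (simp add: distrib_left)
qed

lemma exp_span_mult: "exp_span f \<Longrightarrow> exp_span g \<Longrightarrow> exp_span (\<lambda>z. f z * g z)"
proof (induction rule: exp_span.induct)
  case (single c v)
  then show ?case by (rule exp_span_mult_single)
next
  case (add f1 f2)
  then have "exp_span (\<lambda>z. f1 z * g z + f2 z * g z)" by (intro exp_span.add) auto
  then show ?case by (simp add: distrib_right)
qed

lemma exp_span_dense:
  assumes "compact E" "continuous_on E f" "0 < e"
  obtains h where "exp_span h" "\<And>z. z \<in> E \<Longrightarrow> \<bar>f z - h z\<bar> < e"
proof -
  interpret function_ring_on "Collect exp_span" E
  proof
    show "(\<lambda>_. c) \<in> Collect exp_span" for c :: real
      using exp_span.single[of c 0] by simp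
    fix x y :: complex assume "x \<noteq> y"
    then have "inner (x - y) (x - y) \<noteq> 0" by simp
    then have "inner x (x - y) \<noteq> inner y (x - y)" by (metis inner_diff_left eq_iff_diff_eq_0)
    then show "\<exists>f\<in>Collect exp_span. f x \<noteq> f y"
      using exp_span.single[of 1 "x - y"] by (intro bexI[of _ "\<lambda>z. 1 * exp (inner z (x - y))"]) auto
  qed (use assms in \<open>auto intro: exp_span_continuous exp_span.add exp_span_mult\<close>)
  show ?thesis using Stone_Weierstrass_basic[OF assms(2,3)] that by blast
qed

lemma integrable_continuous_compact_support:
  fixes f :: "complex \<Rightarrow> real"
  assumes "prob_space \<tau>" "sets \<tau> = sets borel" "AE z in \<tau>. z \<in> E" "compact E" "continuous_on UNIV f"
  shows "integrable \<tau> f"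
proof -
  interpret prob_space \<tau> by fact
  have "compact (f ` E)"
    using assms by (meson compact_continuous_image continuous_on_subset subset_UNIV)
  then obtain B where B: "\<And>z. z \<in> E \<Longrightarrow> norm (f z) \<le> B"
    using compact_imp_bounded bounded_iff by (metis image_eqI)
  show ?thesis
  proof (rule integrable_const_bound)
    show "AE z in \<tau>. norm (f z) \<le> B" using assms(3) by eventually_elim (rule B)
    show "f \<in> borel_measurable \<tau>"
      using borel_measurable_continuous_onI[OF assms(5)] assms(2) measurable_cong_sets by blast
  qed
qed

context borel_prob_pair
begin

lemma continuous_gauss_avg:
  assumes "0 \<le> s"
  shows "continuous_on UNIV (gauss_avg s \<tau>)"
proof (rule continuous_at_imp_continuous_on, rule ballI)
  fix w :: "real \<times> real"
  show "isCont (gauss_avg s \<tau>) w"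
    unfolding continuous_at_sequentially o_def
  proof (intro allI impI)
    fix x assume x: "x \<longlonglongrightarrow> w"
    show "(\<lambda>n. gauss_avg s \<tau> (x n)) \<longlonglongrightarrow> gauss_avg s \<tau> w"
      unfolding gauss_avg_def
    proof (rule integral_dominated_convergence[where w="\<lambda>_. 1"])
      show "AE z in \<tau>. (\<lambda>n. gauss s z (x n)) \<longlonglongrightarrow> gauss s z w"
        unfolding gauss_def by (intro AE_I2 tendsto_intros x)
      show "AE z in \<tau>. norm (gauss s z (x n)) \<le> 1" for n
        using gauss_bounds[of s] assms by (simp add: abs_of_pos)
    qed auto
  qed
qed

text \<open>
  Gaussian averages are continuous, and a nonempty open set is not a null set.
\<close>

lemma gauss_avg_eq_everywhere:
  assumes s: "0 \<le> s" and ae: "AE w in lborel \<Otimes>\<^sub>M lborel. gauss_avg s \<tau> w = gauss_avg s \<sigma> w"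
  shows "gauss_avg s \<tau> w = gauss_avg s \<sigma> w"
proof (rule ccontr)
  interpret swap: borel_prob_pair \<sigma> \<tau> by (rule borel_prob_pair_swap)
  assume neq: "gauss_avg s \<tau> w \<noteq> gauss_avg s \<sigma> w"
  define N where "N = {w. gauss_avg s \<tau> w \<noteq> gauss_avg s \<sigma> w}"
  have "open N"
    unfolding N_def by (intro open_Collect_neq continuous_gauss_avg swap.continuous_gauss_avg s)
  moreover have "N \<in> null_sets lborel"
    using ae \<open>open N\<close> unfolding lborel_prod by (subst AE_iff_null_sets) (auto simp: N_def)
  then have "negligible N"
    unfolding negligible_iff_null_sets by (rule null_sets_completionI)
  moreover have "w \<in> N" using neq by (simp add: N_def)
  ultimately show False using open_not_negligible[of N] by blast
qed

text \<open>
  Expanding the square in the exponent, \<open>gauss s z w\<close> is a constant times \<open>g(z) exp (z \<bullet> v)\<close> with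
  \<open>g(z) = exp (- 2 s |z|^2)\<close> and \<open>v = 4 s w\<close>. As \<open>w\<close> varies, the two measures therefore agree on \<open>g\<close>
  times the span of all exponentials, which is dense in the continuous functions on \<open>E\<close>.
\<close>

lemma eq_if_gauss_avg_eq:
  assumes s: "0 < s" and eq: "\<And>w. gauss_avg s \<tau> w = gauss_avg s \<sigma> w"
    and E: "compact E" "AE z in \<tau>. z \<in> E" "AE z in \<sigma>. z \<in> E"
  shows "\<tau> = \<sigma>"
proof (rule prob_measures_eqI_continuous)
  have intT: "integrable \<tau> f" and intS: "integrable \<sigma> f" if "continuous_on UNIV f" for f :: "complex \<Rightarrow> real"
    using integrable_continuous_compact_support[of \<tau> E f] integrable_continuous_compact_support[of \<sigma> E f]
      T.prob_space_axioms S.prob_space_axioms E that by auto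
  define g where "g = (\<lambda>z::complex. exp (- 2 * s * (norm z)\<^sup>2))"
  have contg: "continuous_on UNIV g" unfolding g_def by (intro continuous_intros)
  have span: "(LINT z|\<tau>. g z * h z) = (LINT z|\<sigma>. g z * h z)" if "exp_span h" for h
    using that
  proof (induction rule: exp_span.induct)
    case (single c v)
    \<comment> \<open>The centre for which the mixed term of the square is \<open>z \<bullet> v\<close>.\<close>
    define w where "w = (Re v / (4 * s), Im v / (4 * s))"
    define K where "K = 2 * s * ((fst w)\<^sup>2 + (snd w)\<^sup>2)"
    have K: "exp K * exp (- K) = 1" by (simp flip: exp_add)
    have gw: "gauss s z w = g z * exp (inner z v) * exp (- K)" for z
    proof -
      have "- 2 * s * ((Re z - fst w)\<^sup>2 + (Im z - snd w)\<^sup>2)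
          = - 2 * s * (norm z)\<^sup>2 + inner z v + - K"
        unfolding cmod_power2 using s by (simp add: inner_complex_def w_def K_def power2_eq_square field_simps)
      then show ?thesis unfolding gauss_def g_def by (simp only: exp_add)
    qed
    have k: "g z * (c * exp (inner z v)) = (c * exp K) * gauss s z w" for z
    proof -
      have "(c * exp K) * gauss s z w = g z * (c * exp (inner z v)) * (exp K * exp (- K))"
        unfolding gw by (simp only: mult_ac)
      then show ?thesis unfolding K by (simp only: mult_1_right)
    qed
    show ?case
      unfolding k using eq[of w] by (simp add: gauss_avg_def)
  next
    case (add f h)
    have c: "continuous_on UNIV (\<lambda>z. g z * f z)" "continuous_on UNIV (\<lambda>z. g z * h z)"
      using contg exp_span_continuous[OF add.hyps(1)] exp_span_continuous[OF add.hyps(2)]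
      by (auto intro: continuous_on_mult)
    have "(LINT z|M. g z * (f z + h z)) = (LINT z|M. g z * f z) + (LINT z|M. g z * h z)"
      if "M = \<tau> \<or> M = \<sigma>" for M
      using that intT[OF c(1)] intT[OF c(2)] intS[OF c(1)] intS[OF c(2)]
      unfolding distrib_left by (intro Bochner_Integration.integral_add) auto
    then show ?case using add.IH by simp
  qed
  fix f :: "complex \<Rightarrow> real" assume f: "continuous_on UNIV f"
  have bound: "\<bar>(LINT z|\<tau>. f z) - (LINT z|\<sigma>. f z)\<bar> \<le> 2 * e" if e: "0 < e" for e
  proof -
    have "continuous_on E (\<lambda>z. f z / g z)"
      by (intro continuous_intros continuous_on_subset[OF f] continuous_on_subset[OF contg]) (auto simp: g_def)
    then obtain h where h: "exp_span h" "\<And>z. z \<in> E \<Longrightarrow> \<bar>f z / g z - h z\<bar> < e"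
      using exp_span_dense[OF E(1) _ e] by blast
    have gh: "continuous_on UNIV (\<lambda>z. g z * h z)"
      using contg exp_span_continuous[OF h(1)] by (intro continuous_intros)
    have near: "\<bar>f z - g z * h z\<bar> \<le> e" if "z \<in> E" for z
    proof -
      have "0 < g z" "g z \<le> 1" using s by (auto simp: g_def)
      then have "f z - g z * h z = g z * (f z / g z - h z)"
        by (simp add: right_diff_distrib)
      then have "\<bar>f z - g z * h z\<bar> = g z * \<bar>f z / g z - h z\<bar>"
        using \<open>0 < g z\<close> by (simp add: abs_mult)
      also have "\<dots> \<le> 1 * e" using \<open>0 < g z\<close> \<open>g z \<le> 1\<close> h(2)[OF that] by (intro mult_mono) auto
      finally show ?thesis by simp
    qed
    have close: "\<bar>(LINT z|M. f z) - (LINT z|M. g z * h z)\<bar> \<le> e"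
      if M: "prob_space M" "integrable M f" "integrable M (\<lambda>z. g z * h z)" "AE z in M. z \<in> E" for M
    proof -
      interpret M: prob_space M by fact
      have "\<bar>(LINT z|M. f z) - (LINT z|M. g z * h z)\<bar> = \<bar>LINT z|M. f z - g z * h z\<bar>"
        using M by simp
      also have "\<dots> \<le> (LINT z|M. \<bar>f z - g z * h z\<bar>)" by simp
      also have "\<dots> \<le> (LINT z|M. e)"
        using M near by (intro integral_mono_AE) (auto elim!: eventually_mono)
      finally show ?thesis by (simp add: M.prob_space)
    qed
    show ?thesis
      using close[OF T.prob_space_axioms intT[OF f] intT[OF gh] E(2)]
        close[OF S.prob_space_axioms intS[OF f] intS[OF gh] E(3)] span[OF h(1)] by linarith
  qed
  have "\<bar>(LINT z|\<tau>. f z) - (LINT z|\<sigma>. f z)\<bar> \<le> 0"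
  proof (rule field_le_epsilon)
    fix e :: real assume "0 < e"
    then show "\<bar>(LINT z|\<tau>. f z) - (LINT z|\<sigma>. f z)\<bar> \<le> 0 + e"
      using bound[of "e / 2"] by simp
  qed
  then show "(LINT z|\<tau>. f z) = (LINT z|\<sigma>. f z)" by simp
qed (use T.prob_space_axioms S.prob_space_axioms in auto)

text \<open>
  Integrate \<open>exp_frullani\<close> against both measures. The bound on the diameter makes the integrand
  nonnegative, so that Tonelli's theorem applies to infinite energies as well.
\<close>

lemma mutual_energy_gauss:
  assumes E: "AE z in \<tau>. z \<in> E" "AE z in \<sigma>. z \<in> E"
    and diam: "\<And>z t. z \<in> E \<Longrightarrow> t \<in> E \<Longrightarrow> cmod (z - t) \<le> 1"
  shows "0 \<le> s \<Longrightarrow> exp (- s) \<le> gauss_energy s \<tau> \<sigma>"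
    and "mutual_energy \<tau> \<sigma>
      = (\<integral>\<^sup>+ s. ennreal ((gauss_energy s \<tau> \<sigma> - exp (- s)) / (2 * s)) * indicator {0<..} s \<partial>lborel)"
proof -
  interpret LS: pair_sigma_finite "lborel :: real measure" \<sigma> ..
  interpret LT: pair_sigma_finite "lborel :: real measure" \<tau> ..
  have ge: "exp (- s) \<le> exp (- s * (cmod (z - t))\<^sup>2)" if "z \<in> E" "t \<in> E" "0 \<le> s" for z t s
  proof -
    have "s * (cmod (z - t))\<^sup>2 \<le> s * 1"
      using diam[OF that(1,2)] that(3) by (intro mult_left_mono) (auto simp: power_le_one)
    then show ?thesis by simp
  qed
  have ge1: "exp (- s) \<le> (LINT t|\<sigma>. exp (- s * (cmod (z - t))\<^sup>2))" if "z \<in> E" "0 \<le> s" for z s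
  proof -
    have "(LINT t|\<sigma>. exp (- s)) \<le> (LINT t|\<sigma>. exp (- s * (cmod (z - t))\<^sup>2))"
      using E(2) ge that by (intro integral_mono_AE inner_gauss_energy) (auto elim!: eventually_mono)
    then show ?thesis by (simp add: S.prob_space)
  qed
  show ge2: "exp (- s) \<le> gauss_energy s \<tau> \<sigma>" if "0 \<le> s" for s
  proof -
    have "(LINT z|\<tau>. exp (- s)) \<le> gauss_energy s \<tau> \<sigma>"
      unfolding gauss_energy_def
      using E(1) ge1 that by (intro integral_mono_AE ennreal_gauss_energy) (auto elim!: eventually_mono)
    then show ?thesis by (simp add: T.prob_space)
  qed
  define k where "k = (\<lambda>s z t. ennreal ((exp (- s * (cmod (z - t))\<^sup>2) - exp (- s)) / (2 * s)) * indicator {0<..} s)"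
  have "mutual_energy \<tau> \<sigma> = (\<integral>\<^sup>+ z. \<integral>\<^sup>+ t. \<integral>\<^sup>+ s. k s z t \<partial>lborel \<partial>\<sigma> \<partial>\<tau>)"
    unfolding mutual_energy_def
  proof (intro nn_integral_cong_AE)
    show "AE z in \<tau>. (\<integral>\<^sup>+ t. log_ker z t \<partial>\<sigma>) = (\<integral>\<^sup>+ t. \<integral>\<^sup>+ s. k s z t \<partial>lborel \<partial>\<sigma>)"
      using E(1)
    proof eventually_elim
      case (elim z)
      show ?case
      proof (intro nn_integral_cong_AE)
        show "AE t in \<sigma>. log_ker z t = (\<integral>\<^sup>+ s. k s z t \<partial>lborel)"
          using E(2)
        proof eventually_elim
          case (elim t)
          then show ?case
            using exp_frullani[of "cmod (z - t)"] diam[OF \<open>z \<in> E\<close>, of t]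
            by (simp add: k_def log_ker_def)
        qed
      qed
    qed
  qed
  also have "\<dots> = (\<integral>\<^sup>+ z. \<integral>\<^sup>+ s. \<integral>\<^sup>+ t. k s z t \<partial>\<sigma> \<partial>lborel \<partial>\<tau>)"
    unfolding k_def by (intro nn_integral_cong LS.Fubini') measurable
  also have "\<dots> = (\<integral>\<^sup>+ s. \<integral>\<^sup>+ z. \<integral>\<^sup>+ t. k s z t \<partial>\<sigma> \<partial>\<tau> \<partial>lborel)"
    unfolding k_def by (intro LT.Fubini') measurable
  also have "\<dots> = (\<integral>\<^sup>+ s. ennreal ((gauss_energy s \<tau> \<sigma> - exp (- s)) / (2 * s)) * indicator {0<..} s \<partial>lborel)"
  proof (intro nn_integral_cong)
    fix s :: real
    show "(\<integral>\<^sup>+ z. \<integral>\<^sup>+ t. k s z t \<partial>\<sigma> \<partial>\<tau>)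
        = ennreal ((gauss_energy s \<tau> \<sigma> - exp (- s)) / (2 * s)) * indicator {0<..} s"
    proof (cases "0 < s")
      case True
      then have s0: "0 \<le> s" by simp
      have "(\<integral>\<^sup>+ z. \<integral>\<^sup>+ t. k s z t \<partial>\<sigma> \<partial>\<tau>)
          = (\<integral>\<^sup>+ z. ennreal (((LINT t|\<sigma>. exp (- s * (cmod (z - t))\<^sup>2)) - exp (- s)) / (2 * s)) \<partial>\<tau>)"
      proof (intro nn_integral_cong_AE)
        show "AE z in \<tau>. (\<integral>\<^sup>+ t. k s z t \<partial>\<sigma>)
            = ennreal (((LINT t|\<sigma>. exp (- s * (cmod (z - t))\<^sup>2)) - exp (- s)) / (2 * s))"
          using E(1)
        proof eventually_elim
          case (elim z)
          have "(\<integral>\<^sup>+ t. k s z t \<partial>\<sigma>) = (\<integral>\<^sup>+ t. ennreal ((exp (- s * (cmod (z - t))\<^sup>2) - exp (- s)) / (2 * s)) \<partial>\<sigma>)"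
            using True by (simp add: k_def)
          also have "\<dots> = ennreal (LINT t|\<sigma>. (exp (- s * (cmod (z - t))\<^sup>2) - exp (- s)) / (2 * s))"
          proof (rule nn_integral_eq_integral)
            show "integrable \<sigma> (\<lambda>t. (exp (- s * (cmod (z - t))\<^sup>2) - exp (- s)) / (2 * s))"
              by (intro integrable_divide Bochner_Integration.integrable_diff inner_gauss_energy s0) auto
            show "AE t in \<sigma>. 0 \<le> (exp (- s * (cmod (z - t))\<^sup>2) - exp (- s)) / (2 * s)"
              using E(2)
            proof eventually_elim
              case (elim t)
              show ?case using ge[OF \<open>z \<in> E\<close> elim s0] True by (intro divide_nonneg_nonneg) auto
            qed
          qed
          also have "(LINT t|\<sigma>. (exp (- s * (cmod (z - t))\<^sup>2) - exp (- s)) / (2 * s))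
              = ((LINT t|\<sigma>. exp (- s * (cmod (z - t))\<^sup>2)) - exp (- s)) / (2 * s)"
            using inner_gauss_energy(1)[OF s0, of z] S.prob_space by simp
          finally show ?case .
        qed
      qed
      also have "\<dots> = ennreal (LINT z|\<tau>. ((LINT t|\<sigma>. exp (- s * (cmod (z - t))\<^sup>2)) - exp (- s)) / (2 * s))"
      proof (rule nn_integral_eq_integral)
        show "integrable \<tau> (\<lambda>z. ((LINT t|\<sigma>. exp (- s * (cmod (z - t))\<^sup>2)) - exp (- s)) / (2 * s))"
          by (intro integrable_divide Bochner_Integration.integrable_diff ennreal_gauss_energy s0) auto
        show "AE z in \<tau>. 0 \<le> ((LINT t|\<sigma>. exp (- s * (cmod (z - t))\<^sup>2)) - exp (- s)) / (2 * s)"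
          using E(1)
        proof eventually_elim
          case (elim z)
          show ?case using ge1[OF elim s0] True by (intro divide_nonneg_nonneg) auto
        qed
      qed
      also have "(LINT z|\<tau>. ((LINT t|\<sigma>. exp (- s * (cmod (z - t))\<^sup>2)) - exp (- s)) / (2 * s))
          = (gauss_energy s \<tau> \<sigma> - exp (- s)) / (2 * s)"
        using ennreal_gauss_energy(1)[OF s0] T.prob_space by (simp add: gauss_energy_def)
      finally show ?thesis using True by simp
    qed (simp add: k_def)
  qed
  finally show "mutual_energy \<tau> \<sigma>
      = (\<integral>\<^sup>+ s. ennreal ((gauss_energy s \<tau> \<sigma> - exp (- s)) / (2 * s)) * indicator {0<..} s \<partial>lborel)" .
qed

lemma measurable_gauss_energy [measurable]: "(\<lambda>s. gauss_energy s \<tau> \<sigma>) \<in> borel_measurable borel"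
  unfolding gauss_energy_def
  by (intro T.borel_measurable_lebesgue_integral S.borel_measurable_lebesgue_integral, simp only: split_beta',
      intro S.borel_measurable_lebesgue_integral) measurable

text \<open>
  By \<open>mutual_energy_gauss\<close> the two sides of the inequality differ by the integral of
  \<open>D(s) / (2 s)\<close>, where \<open>D(s) \<ge> 0\<close> by \<open>gauss_energy_difference\<close>. This identity between nonnegative
  extended reals also makes sense for infinite energies. In case of finite equality \<open>D\<close> vanishes
  almost everywhere, and a single \<open>s > 0\<close> with \<open>D(s) = 0\<close> suffices.
\<close>

lemma energy_principle:
  assumes E: "compact E" "AE z in \<tau>. z \<in> E" "AE z in \<sigma>. z \<in> E"
    and diam: "\<And>z t. z \<in> E \<Longrightarrow> t \<in> E \<Longrightarrow> cmod (z - t) \<le> 1"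
  shows "2 * mutual_energy \<tau> \<sigma> \<le> mutual_energy \<tau> \<tau> + mutual_energy \<sigma> \<sigma>"
    and "2 * mutual_energy \<tau> \<sigma> = mutual_energy \<tau> \<tau> + mutual_energy \<sigma> \<sigma> \<Longrightarrow> mutual_energy \<tau> \<sigma> < \<infinity> \<Longrightarrow> \<tau> = \<sigma>"
proof -
  interpret left: borel_prob_pair \<tau> \<tau> by (rule borel_prob_pair_left)
  interpret right: borel_prob_pair \<sigma> \<sigma> by (rule borel_prob_pair_right)
  define D where "D = (\<lambda>s. gauss_energy s \<tau> \<tau> + gauss_energy s \<sigma> \<sigma> - 2 * gauss_energy s \<tau> \<sigma>)"
  have TS: "0 \<le> s \<Longrightarrow> exp (- s) \<le> gauss_energy s \<tau> \<sigma>" "mutual_energy \<tau> \<sigma>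
      = (\<integral>\<^sup>+ s. ennreal ((gauss_energy s \<tau> \<sigma> - exp (- s)) / (2 * s)) * indicator {0<..} s \<partial>lborel)" for s
    using mutual_energy_gauss[of E] E diam by auto
  have TT: "0 \<le> s \<Longrightarrow> exp (- s) \<le> gauss_energy s \<tau> \<tau>" "mutual_energy \<tau> \<tau>
      = (\<integral>\<^sup>+ s. ennreal ((gauss_energy s \<tau> \<tau> - exp (- s)) / (2 * s)) * indicator {0<..} s \<partial>lborel)" for s
    using left.mutual_energy_gauss[of E] E diam by auto
  have SS: "0 \<le> s \<Longrightarrow> exp (- s) \<le> gauss_energy s \<sigma> \<sigma>" "mutual_energy \<sigma> \<sigma>
      = (\<integral>\<^sup>+ s. ennreal ((gauss_energy s \<sigma> \<sigma> - exp (- s)) / (2 * s)) * indicator {0<..} s \<partial>lborel)" for s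
    using right.mutual_energy_gauss[of E] E diam by auto
  have [measurable]: "D \<in> borel_measurable borel" unfolding D_def by measurable
  have id: "mutual_energy \<tau> \<tau> + mutual_energy \<sigma> \<sigma>
      = 2 * mutual_energy \<tau> \<sigma> + (\<integral>\<^sup>+ s. ennreal (D s / (2 * s)) * indicator {0<..} s \<partial>lborel)"
  proof -
    have "mutual_energy \<tau> \<tau> + mutual_energy \<sigma> \<sigma>
      = (\<integral>\<^sup>+ s. ennreal ((gauss_energy s \<tau> \<tau> - exp (- s)) / (2 * s)) * indicator {0<..} s
            + ennreal ((gauss_energy s \<sigma> \<sigma> - exp (- s)) / (2 * s)) * indicator {0<..} s \<partial>lborel)"
      unfolding TT(2) SS(2) by (intro nn_integral_add[symmetric]) measurable
    also have "\<dots> = (\<integral>\<^sup>+ s. 2 * (ennreal ((gauss_energy s \<tau> \<sigma> - exp (- s)) / (2 * s)) * indicator {0<..} s)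
            + ennreal (D s / (2 * s)) * indicator {0<..} s \<partial>lborel)"
    proof (intro nn_integral_cong)
      fix s :: real
      show "ennreal ((gauss_energy s \<tau> \<tau> - exp (- s)) / (2 * s)) * indicator {0<..} s
            + ennreal ((gauss_energy s \<sigma> \<sigma> - exp (- s)) / (2 * s)) * indicator {0<..} s
          = 2 * (ennreal ((gauss_energy s \<tau> \<sigma> - exp (- s)) / (2 * s)) * indicator {0<..} s)
            + ennreal (D s / (2 * s)) * indicator {0<..} s"
      proof (cases "0 < s")
        case True
        define a b c d where "a = (gauss_energy s \<tau> \<tau> - exp (- s)) / (2 * s)"
          and "b = (gauss_energy s \<sigma> \<sigma> - exp (- s)) / (2 * s)"
          and "c = (gauss_energy s \<tau> \<sigma> - exp (- s)) / (2 * s)" and "d = D s / (2 * s)"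
        have "0 \<le> a" "0 \<le> b" "0 \<le> c" "0 \<le> d"
          using True TT(1)[of s] SS(1)[of s] TS(1)[of s] gauss_energy_difference(1)[OF True]
          by (auto simp: a_def b_def c_def d_def D_def intro!: divide_nonneg_nonneg)
        moreover have "a + b = 2 * c + d"
          using True by (simp add: a_def b_def c_def d_def D_def field_simps)
        ultimately have "ennreal a + ennreal b = ennreal (2 * c) + ennreal d"
          by (simp flip: ennreal_plus)
        also have "ennreal (2 * c) = 2 * ennreal c" by (simp add: ennreal_mult')
        finally have "ennreal a + ennreal b = 2 * ennreal c + ennreal d" .
        then show ?thesis using True by (simp add: a_def b_def c_def d_def)
      qed simp
    qed
    also have "\<dots> = 2 * mutual_energy \<tau> \<sigma> + (\<integral>\<^sup>+ s. ennreal (D s / (2 * s)) * indicator {0<..} s \<partial>lborel)"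
      unfolding TS(2) by (subst nn_integral_add) (auto simp: nn_integral_cmult)
    finally show ?thesis .
  qed
  show "2 * mutual_energy \<tau> \<sigma> \<le> mutual_energy \<tau> \<tau> + mutual_energy \<sigma> \<sigma>" unfolding id by simp
  assume "2 * mutual_energy \<tau> \<sigma> = mutual_energy \<tau> \<tau> + mutual_energy \<sigma> \<sigma>" and fin: "mutual_energy \<tau> \<sigma> < \<infinity>"
  then have "2 * mutual_energy \<tau> \<sigma> + (\<integral>\<^sup>+ s. ennreal (D s / (2 * s)) * indicator {0<..} s \<partial>lborel)
      = 2 * mutual_energy \<tau> \<sigma> + 0" unfolding id by simp
  moreover have "2 * mutual_energy \<tau> \<sigma> \<noteq> \<top>" using fin by (simp add: ennreal_mult_eq_top_iff)
  ultimately have "(\<integral>\<^sup>+ s. ennreal (D s / (2 * s)) * indicator {0<..} s \<partial>lborel) = 0"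
    by (metis ennreal_add_left_cancel infinity_ennreal_def)
  then have ae: "AE s in lborel. ennreal (D s / (2 * s)) * indicator {0<..} s = 0"
    by (subst (asm) nn_integral_0_iff_AE) auto
  have "\<exists>s>0. D s = 0"
  proof (rule ccontr)
    assume no: "\<not> (\<exists>s>0. D s = 0)"
    have "AE s in lborel. s \<notin> {0<..<1::real}"
      using ae
    proof eventually_elim
      case (elim s)
      show ?case
      proof
        assume s: "s \<in> {0<..<1}"
        then have "D s / (2 * s) \<le> 0" using elim by (simp add: ennreal_eq_0_iff)
        moreover have "0 \<le> D s" "D s \<noteq> 0" using no s gauss_energy_difference(1)[of s] by (auto simp: D_def)
        ultimately show False using s by (simp add: divide_le_0_iff)
      qed
    qed
    then have "{0<..<1::real} \<in> null_sets lborel" by (subst (asm) AE_iff_null_sets[symmetric]) auto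
    then show False by (simp add: null_sets_def)
  qed
  then obtain s where s: "0 < s" "D s = 0" by blast
  show "\<tau> = \<sigma>"
  proof (rule eq_if_gauss_avg_eq[OF s(1) _ E])
    have "AE w in lborel \<Otimes>\<^sub>M lborel. gauss_avg s \<tau> w = gauss_avg s \<sigma> w"
      by (rule gauss_energy_difference(2)[OF s(1)]) (use s(2) in \<open>simp only: D_def\<close>)
    then show "gauss_avg s \<tau> w = gauss_avg s \<sigma> w" for w
      by (rule gauss_avg_eq_everywhere[OF less_imp_le[OF s(1)]])
  qed
qed

end

section \<open>The equilibrium measure and the extremal norms\<close>

lemma e2ennreal_log_kernel: "e2ennreal (log_kernel z t) = log_ker z t"
  by (simp add: log_kernel_def log_ker_def)

lemma prob_measures_onD:
  assumes "\<tau> \<in> prob_measures_on K" "closed K"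
  shows "prob_space \<tau>" "sets \<tau> = sets borel" "AE z in \<tau>. z \<in> K"
proof -
  show \<tau>: "prob_space \<tau>" "sets \<tau> = sets borel" using assms by (auto simp: prob_measures_on_def)
  interpret prob_space \<tau> by fact
  have "K \<in> events" using assms \<tau> by simp
  moreover have "prob K = 1" using assms by (simp add: prob_measures_on_def measure_def)
  ultimately show "AE z in \<tau>. z \<in> K" by (simp add: AE_in_set_eq_1)
qed

text \<open>
  On a set of diameter at most \<open>1\<close> the negative parts in \<open>ext_integral\<close> vanish.
\<close>

lemma log_energy_mutual:
  assumes ae: "AE z in \<tau>. z \<in> K" and diam: "\<And>z t. z \<in> K \<Longrightarrow> t \<in> K \<Longrightarrow> cmod (z - t) \<le> 1"
  shows "log_energy \<tau> = enn2ereal (mutual_energy \<tau> \<tau>)"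
proof -
  have inner: "ext_integral \<tau> (log_kernel z) = enn2ereal (\<integral>\<^sup>+ t. log_ker z t \<partial>\<tau>)" if z: "z \<in> K" for z
  proof -
    have "(\<integral>\<^sup>+ t. e2ennreal (- log_kernel z t) \<partial>\<tau>) = (\<integral>\<^sup>+ t. 0 \<partial>\<tau>)"
    proof (rule nn_integral_cong_AE)
      show "AE t in \<tau>. e2ennreal (- log_kernel z t) = 0"
        using ae
      proof eventually_elim
        case (elim t)
        have "0 \<le> log_kernel z t"
          using diam[OF z elim] by (auto simp: log_kernel_def)
        then show ?case by (intro e2ennreal_neg) simp
      qed
    qed
    then show ?thesis by (simp add: ext_integral_def e2ennreal_log_kernel zero_ennreal.rep_eq)
  qed
  have "log_energy \<tau> = enn2ereal (\<integral>\<^sup>+ z. e2ennreal (ext_integral \<tau> (log_kernel z)) \<partial>\<tau>)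
      - enn2ereal (\<integral>\<^sup>+ z. e2ennreal (- ext_integral \<tau> (log_kernel z)) \<partial>\<tau>)"
    by (simp add: log_energy_def ext_integral_def)
  also have "(\<integral>\<^sup>+ z. e2ennreal (ext_integral \<tau> (log_kernel z)) \<partial>\<tau>) = mutual_energy \<tau> \<tau>"
    unfolding mutual_energy_def
    using ae by (intro nn_integral_cong_AE) (auto elim!: eventually_mono simp: inner)
  also have "(\<integral>\<^sup>+ z. e2ennreal (- ext_integral \<tau> (log_kernel z)) \<partial>\<tau>) = (\<integral>\<^sup>+ z. 0 \<partial>\<tau>)"
    using ae by (intro nn_integral_cong_AE) (auto elim!: eventually_mono simp: inner intro!: e2ennreal_neg)
  finally show ?thesis by (simp add: zero_ennreal.rep_eq)
qed

lemma ext_integral_integrable: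
  assumes "integrable M f"
  shows "ext_integral M (\<lambda>z. ereal (f z)) = ereal (LINT z|M. f z)"
proof -
  have fin: "(\<integral>\<^sup>+ x. ennreal (f x) \<partial>M) \<noteq> \<top>" "(\<integral>\<^sup>+ x. ennreal (- f x) \<partial>M) \<noteq> \<top>"
    using assms by (auto simp: real_integrable_def)
  have enn: "enn2ereal x = ereal (enn2real x)" if "x \<noteq> \<top>" for x
    using that by (cases x) (auto simp: enn2ereal_ennreal)
  show ?thesis
    unfolding ext_integral_def real_lebesgue_integral_def[OF assms]
    using fin by (simp add: enn)
qed

lemma loop_region_ln_bounds:
  assumes "z \<in> loop_region"
  shows "\<bar>ln (cmod (1 + z))\<bar> \<le> ln 2"
proof -
  have "ln (1/2) \<le> ln (cmod (1 + z))" "ln (cmod (1 + z)) \<le> ln 2"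
    using loop_region_norm[OF assms] by (auto intro!: ln_mono)
  then show ?thesis by (simp add: ln_div)
qed

context
  fixes \<tau> :: "complex measure"
  assumes \<tau>: "\<tau> \<in> prob_measures_on loop_region"
begin

interpretation prob_space \<tau>
  using prob_measures_onD[OF \<tau> closed_loop_region] by simp

lemma integrable_log_weight: "integrable \<tau> (\<lambda>z. ln (cmod (1 + z)))"
proof (rule integrable_const_bound)
  have [measurable_cong]: "sets \<tau> = sets borel" using prob_measures_onD[OF \<tau> closed_loop_region] by simp
  show "(\<lambda>z. ln (cmod (1 + z))) \<in> borel_measurable \<tau>" by measurable
  show "AE z in \<tau>. norm (ln (cmod (1 + z))) \<le> ln 2"
    using prob_measures_onD(3)[OF \<tau> closed_loop_region] by eventually_elim (simp add: loop_region_ln_bounds)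
qed

lemma mutual_energy_loop_measure:
  shows "mutual_energy \<tau> loop_measure = ennreal (ln 4 + (LINT z|\<tau>. ln (cmod (1 + z))))"
    "0 \<le> ln 4 + (LINT z|\<tau>. ln (cmod (1 + z)))"
proof -
  note ae = prob_measures_onD(3)[OF \<tau> closed_loop_region]
  have pos: "AE z in \<tau>. 0 \<le> ln 4 + ln (cmod (1 + z))"
    using ae
  proof eventually_elim
    case (elim z)
    have "ln 2 \<le> ln (4::real)" by simp
    then show ?case using loop_region_ln_bounds[OF elim] by linarith
  qed
  have int: "integrable \<tau> (\<lambda>z. ln 4 + ln (cmod (1 + z)))"
    using integrable_log_weight by simp
  have val: "(LINT z|\<tau>. ln 4 + ln (cmod (1 + z))) = ln 4 + (LINT z|\<tau>. ln (cmod (1 + z)))"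
    using integrable_log_weight prob_space by simp
  have "mutual_energy \<tau> loop_measure = (\<integral>\<^sup>+ z. ennreal (ln 4 + ln (cmod (1 + z))) \<partial>\<tau>)"
    unfolding mutual_energy_def
    using ae by (intro nn_integral_cong_AE) (auto elim!: eventually_mono simp: loop_potential)
  also have "\<dots> = ennreal (LINT z|\<tau>. ln 4 + ln (cmod (1 + z)))"
    by (rule nn_integral_eq_integral[OF int pos])
  finally show "mutual_energy \<tau> loop_measure = ennreal (ln 4 + (LINT z|\<tau>. ln (cmod (1 + z))))"
    unfolding val .
  show "0 \<le> ln 4 + (LINT z|\<tau>. ln (cmod (1 + z)))"
    unfolding val[symmetric] by (rule integral_nonneg_AE[OF pos])
qed

lemma weighted_energy_loop:
  "weighted_energy (\<lambda>z. - ln (cmod (1 + z))) \<tau>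
     = enn2ereal (mutual_energy \<tau> \<tau>) - ereal (2 * (LINT z|\<tau>. ln (cmod (1 + z))))"
proof -
  have "ext_integral \<tau> (\<lambda>z. ereal (- ln (cmod (1 + z)))) = ereal (- (LINT z|\<tau>. ln (cmod (1 + z))))"
    using integrable_log_weight by (subst ext_integral_integrable) auto
  then show ?thesis
    unfolding weighted_energy_def
    using log_energy_mutual[OF prob_measures_onD(3)[OF \<tau> closed_loop_region] loop_region_diam]
    by (simp add: minus_ereal_def)
qed

end

lemma mutual_energy_loop_measure_self: "mutual_energy loop_measure loop_measure = ennreal (ln 4)"
  using mutual_energy_loop_measure(1)[OF loop_measure_prob] loop_measure_log by simp

lemma weighted_energy_loop_measure: "weighted_energy (\<lambda>z. - ln (cmod (1 + z))) loop_measure = ereal (ln 4)"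
  unfolding weighted_energy_loop[OF loop_measure_prob] mutual_energy_loop_measure_self
  using loop_measure_log by (simp add: enn2ereal_ennreal)

text \<open>
  With \<open>q\<close> the integral of \<open>ln |1 + z|\<close>, the mutual energy with \<open>loop_measure\<close> is \<open>ln 4 + q\<close>, and that
  of \<open>loop_measure\<close> with itself is \<open>ln 4\<close>. So \<open>energy_principle\<close> says that the energy of \<open>\<tau>\<close> is at
  least \<open>2 (ln 4 + q) - ln 4 = ln 4 + 2 q\<close>, which is the claim.
\<close>

lemma weighted_energy_minimal:
  assumes \<tau>: "\<tau> \<in> prob_measures_on loop_region"
  shows "ereal (ln 4) \<le> weighted_energy (\<lambda>z. - ln (cmod (1 + z))) \<tau>"
    and "weighted_energy (\<lambda>z. - ln (cmod (1 + z))) \<tau> \<le> ereal (ln 4) \<Longrightarrow> \<tau> = loop_measure"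
proof -
  note T = prob_measures_onD[OF \<tau> closed_loop_region]
  note M = prob_measures_onD[OF loop_measure_prob closed_loop_region]
  interpret borel_prob_pair \<tau> loop_measure
    using T M by (auto simp: borel_prob_pair_def borel_prob_pair_axioms_def)
  define q where "q = (LINT z|\<tau>. ln (cmod (1 + z)))"
  note mu = mutual_energy_loop_measure[OF \<tau>, folded q_def]
  note ep = energy_principle[OF compact_loop_region T(3) M(3) loop_region_diam, unfolded mutual_energy_loop_measure_self mu(1)]
  have ln4: "0 \<le> ln (4::real)" by simp
  have 2: "2 * ennreal (ln 4 + q) = ennreal (2 * (ln 4 + q))" using mu(2) by (simp only: ennreal_mult'' ennreal_numeral)
  have "ereal (ln 4) \<le> weighted_energy (\<lambda>z. - ln (cmod (1 + z))) \<tau> \<and>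
     (weighted_energy (\<lambda>z. - ln (cmod (1 + z))) \<tau> \<le> ereal (ln 4) \<longrightarrow> \<tau> = loop_measure)"
  proof (cases "mutual_energy \<tau> \<tau>")
    case top
    then show ?thesis unfolding weighted_energy_loop[OF \<tau>] by (simp add: enn2ereal_top)
  next
    case (real a)
    have w: "weighted_energy (\<lambda>z. - ln (cmod (1 + z))) \<tau> = ereal (a - 2 * q)"
      unfolding weighted_energy_loop[OF \<tau>] q_def[symmetric] real(2) using real(1) by (simp add: enn2ereal_ennreal)
    have sum: "ennreal a + ennreal (ln 4) = ennreal (a + ln 4)" using real(1) ln4 by simp
    have "ennreal (2 * (ln 4 + q)) \<le> ennreal (a + ln 4)"
      using ep(1) unfolding real(2) 2 sum by simp
    then have le: "2 * (ln 4 + q) \<le> a + ln 4" using real(1) ln4 ennreal_le_iff[of "a + ln 4" "2 * (ln 4 + q)"] by (simp del: ennreal_plus)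
    have "\<tau> = loop_measure" if "a - 2 * q \<le> ln 4"
    proof (rule ep(2))
      have "2 * (ln 4 + q) = a + ln 4" using le that by simp
      then show "2 * ennreal (ln 4 + q) = mutual_energy \<tau> \<tau> + ennreal (ln 4)"
        unfolding real(2) 2 sum by (simp only:)
    qed auto
    with le show ?thesis unfolding w by auto
  qed
  then show "ereal (ln 4) \<le> weighted_energy (\<lambda>z. - ln (cmod (1 + z))) \<tau>"
    and "weighted_energy (\<lambda>z. - ln (cmod (1 + z))) \<tau> \<le> ereal (ln 4) \<Longrightarrow> \<tau> = loop_measure" by auto
qed

theorem equilibrium_measure_loop:
  "equilibrium_measure loop_region (\<lambda>z. - ln (cmod (1 + z))) = loop_measure"
  unfolding equilibrium_measure_def
proof (rule the_equality)
  show "loop_measure \<in> prob_measures_on loop_region \<and>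
    (\<forall>\<tau>\<in>prob_measures_on loop_region. weighted_energy (\<lambda>z. - ln (cmod (1 + z))) loop_measure
        \<le> weighted_energy (\<lambda>z. - ln (cmod (1 + z))) \<tau>)"
    using loop_measure_prob weighted_energy_minimal(1) weighted_energy_loop_measure by simp
  fix \<mu> assume "\<mu> \<in> prob_measures_on loop_region \<and>
    (\<forall>\<tau>\<in>prob_measures_on loop_region. weighted_energy (\<lambda>z. - ln (cmod (1 + z))) \<mu>
        \<le> weighted_energy (\<lambda>z. - ln (cmod (1 + z))) \<tau>)"
  then have "\<mu> \<in> prob_measures_on loop_region"
    "weighted_energy (\<lambda>z. - ln (cmod (1 + z))) \<mu> \<le> weighted_energy (\<lambda>z. - ln (cmod (1 + z))) loop_measure"
    using loop_measure_prob by auto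
  then show "\<mu> = loop_measure"
    unfolding weighted_energy_loop_measure by (intro weighted_energy_minimal(2))
qed

theorem robin_constant_loop: "robin_constant loop_region (\<lambda>z. - ln (cmod (1 + z))) = ereal (ln 4)"
proof -
  have "ext_integral loop_measure (\<lambda>z. ereal (- ln (cmod (1 + z)))) = ereal 0"
    using loop_measure_log by (subst ext_integral_integrable) auto
  then show ?thesis
    unfolding robin_constant_def equilibrium_measure_loop weighted_energy_loop_measure by simp
qed

text \<open>
  The uniform measure on a circle inside the set has finite energy by \<open>circle_potential\<close>.
\<close>

lemma log_capacity_disc_pos:
  assumes r: "0 < r" "r \<le> 1/2" and sub: "cball 0 r \<subseteq> E"
  shows "log_capacity E \<noteq> 0"
proof -
  define \<sigma> where "\<sigma> = distr unif01 borel (\<lambda>t. of_real r * unit_circle t)"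
  have ps: "prob_space \<sigma>"
    unfolding \<sigma>_def by (rule unif01.prob_space_distr) measurable
  have "emeasure \<sigma> (cball 0 r) = emeasure unif01 UNIV"
    unfolding \<sigma>_def using r by (subst emeasure_distr) (auto simp: vimage_def norm_mult)
  also have "\<dots> = 1" using unif01.emeasure_space_1 by simp
  finally have mem: "\<sigma> \<in> prob_measures_on (cball 0 r)"
    using ps by (simp add: prob_measures_on_def \<sigma>_def)
  note S = prob_measures_onD[OF mem closed_cball]
  have diam: "cmod (z - t) \<le> 1" if "z \<in> cball 0 r" "t \<in> cball 0 r" for z t :: complex
    using norm_triangle_ineq4[of z t] that r by simp
  have "mutual_energy \<sigma> \<sigma> = (\<integral>\<^sup>+ z. ennreal (ln (1 / r)) \<partial>\<sigma>)"
    unfolding mutual_energy_def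
  proof (rule nn_integral_cong_AE)
    show "AE z in \<sigma>. (\<integral>\<^sup>+ t. log_ker z t \<partial>\<sigma>) = ennreal (ln (1 / r))"
      using S(3) by eventually_elim (simp add: \<sigma>_def circle_potential[OF r])
  qed
  also have "\<dots> = ennreal (ln (1 / r))" using prob_space.emeasure_space_1[OF ps] by simp
  finally have "log_energy \<sigma> = enn2ereal (ennreal (ln (1 / r)))"
    using log_energy_mutual[OF S(3) diam] by simp
  then have fin: "log_energy \<sigma> \<noteq> \<infinity>" by (simp add: enn2ereal_eq_top_iff[simplified infinity_ereal_def[symmetric]])
  define v where "v = (INF K\<in>{K. compact K \<and> K \<subseteq> E}. INF \<tau>\<in>prob_measures_on K. log_energy \<tau>)"
  have "v \<le> log_energy \<sigma>"
    unfolding v_def using sub mem by (intro INF_lower2[of "cball 0 r"] INF_lower) auto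
  then have "v \<noteq> \<infinity>" using fin by auto
  then show ?thesis
    unfolding log_capacity_def v_def[symmetric] by (cases v) auto
qed

lemma log_capacity_empty: "log_capacity {} = 0"
proof -
  have "prob_measures_on {} = {}" by (auto simp: prob_measures_on_def)
  then have "(INF K\<in>{K::complex set. compact K \<and> K \<subseteq> {}}. INF \<tau>\<in>prob_measures_on K. log_energy \<tau>) = \<infinity>"
    by (auto simp: top_ereal_def[symmetric] cong: INF_cong)
  then show ?thesis unfolding log_capacity_def by (simp add: )
qed

text \<open>
  If \<open>L < |f 0|\<close>, then \<open>|f| > L\<close> on a whole disc, which is not an exceptional set. The lower bound
  also shows that the infimum defining the norm is taken over a set that is bounded below.
\<close>

lemma star_norm_bounds:
  assumes r: "0 < r" and sub: "ball 0 r \<subseteq> K" and cont: "continuous_on (ball 0 r) f"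
    and B: "\<And>z. z \<in> K \<Longrightarrow> cmod (f z) \<le> B"
  shows "cmod (f 0) \<le> star_norm K f" "star_norm K f \<le> B"
proof -
  define S where "S = {L. quasi_everywhere K (\<lambda>z. cmod (f z) \<le> L)}"
  have BS: "B \<in> S"
  proof -
    have "{z \<in> K. \<not> cmod (f z) \<le> B} = {}" using B by auto
    then show ?thesis unfolding S_def quasi_everywhere_def by (simp only: mem_Collect_eq log_capacity_empty)
  qed
  have low: "cmod (f 0) \<le> L" if "L \<in> S" for L
  proof (rule ccontr)
    assume "\<not> cmod (f 0) \<le> L"
    then have L: "L < cmod (f 0)" by simp
    have "continuous_on (ball 0 r) (\<lambda>z. cmod (f z))" by (intro continuous_intros cont)
    then have "open (ball 0 r \<inter> (\<lambda>z. cmod (f z)) -` {L<..})"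
      by (intro continuous_open_preimage) auto
    moreover have "0 \<in> ball 0 r \<inter> (\<lambda>z. cmod (f z)) -` {L<..}" using r L by simp
    ultimately obtain e where e: "0 < e" "cball 0 e \<subseteq> ball 0 r \<inter> (\<lambda>z. cmod (f z)) -` {L<..}"
      using open_contains_cball by blast
    have "cball 0 (min e (1/2)) \<subseteq> {z \<in> K. \<not> cmod (f z) \<le> L}"
      using e sub by (force simp: subset_iff)
    then have "log_capacity {z \<in> K. \<not> cmod (f z) \<le> L} \<noteq> 0"
      using e by (intro log_capacity_disc_pos[of "min e (1/2)"]) auto
    with that show False by (simp add: S_def quasi_everywhere_def)
  qed
  have "cmod (f 0) \<le> Inf S" using BS low by (intro cInf_greatest) auto
  then show "cmod (f 0) \<le> star_norm K f" by (simp add: star_norm_def S_def)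
  have "Inf S \<le> B" using BS low by (intro cInf_lower bdd_belowI) auto
  then show "star_norm K f \<le> B" by (simp add: star_norm_def S_def)
qed

theorem star_norm_limit:
  defines "p \<equiv> \<lambda>n. smult (inverse (lead_coeff (binom_taylor n n))) (binom_taylor n n)"
  shows "(\<lambda>n. root n (star_norm loop_region (\<lambda>z. (1 + z) ^ n * poly (p n) z))) \<longlonglongrightarrow> 1 / 4"
proof (rule tendsto_sandwich)
  define N where "N = (\<lambda>n. star_norm loop_region (\<lambda>z. (1 + z) ^ n * poly (p n) z))"
  obtain r where r: "0 < r" "ball 0 r \<subseteq> loop_region"
    using open_loop_interior zero_in_loop_interior loop_interior_subset
    by (meson open_contains_ball subset_trans)
  have bounds: "(1/4) ^ n \<le> N n \<and> N n \<le> (1/4) ^ n * (12 * n ^ 2)" if n: "n > 0" for n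
  proof -
    define c where "c = cmod (neg_binom n n)"
    have "4 ^ n / (2 * real n) \<le> 2 * c"
      using central_binomial_lower_bound[OF n] norm_neg_binom_central[OF n] by (simp add: c_def)
    then have c1: "4 ^ n / (4 * real n) \<le> c" by simp
    then have c0: "0 < c" using n by (intro less_le_trans[OF _ c1]) simp
    have c2: "c \<le> 4 ^ n" using norm_neg_binom_le[of n n] n by (simp add: c_def)
    have pz: "(1 + z) ^ n * poly (p n) z = (1 - taylor_defect n n z) / neg_binom n n" for z
      using degree_binom_taylor[of n n] n by (simp add: p_def taylor_defect_def divide_inverse)
    have B: "cmod ((1 + z) ^ n * poly (p n) z) \<le> (1 + 2 * n) / c" if z: "z \<in> loop_region" for z
    proof -
      have "cmod (taylor_defect n n z) \<le> 2 * n * (4 * cmod (z * (z + 1))) ^ n"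
        using taylor_defect_bound[OF n order_refl z] by simp
      also have "\<dots> \<le> real (2 * n) * 1"
        using z by (intro mult_left_mono power_le_one) (auto simp: loop_region_def)
      finally have "cmod (1 - taylor_defect n n z) \<le> 1 + 2 * n"
        using norm_triangle_ineq4[of 1 "taylor_defect n n z"] by simp
      then show ?thesis unfolding pz norm_divide c_def[symmetric] using c0 by (intro divide_right_mono) auto
    qed
    have "cmod ((1 + 0) ^ n * poly (p n) 0) \<le> N n" "N n \<le> (1 + 2 * n) / c"
      unfolding N_def by (intro star_norm_bounds[OF r _ B] continuous_intros; assumption)+
    moreover have "cmod ((1 + 0) ^ n * poly (p n) 0) = 1 / c"
      unfolding pz by (simp add: taylor_defect_0 norm_divide c_def)
    moreover have "(1/4) ^ n \<le> 1 / c" using c0 c2 by (simp add: power_one_over frac_le)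
    moreover have "(1 + 2 * real n) / c \<le> (3 * n) / (4 ^ n / (4 * n))"
      using n c0 c1 by (intro frac_le) auto
    moreover have "(3 * real n) / (4 ^ n / (4 * n)) = (1/4) ^ n * (12 * n ^ 2)"
      by (simp add: power2_eq_square power_one_over)
    ultimately show ?thesis by auto
  qed
  show "\<forall>\<^sub>F n in sequentially. 1/4 \<le> root n (N n)"
  proof (rule eventually_sequentiallyI[of 1])
    fix n :: nat assume n: "1 \<le> n"
    then have "root n ((1/4) ^ n) \<le> root n (N n)" using bounds[of n] by simp
    then show "1/4 \<le> root n (N n)" using n by (simp add: real_root_power_cancel)
  qed
  show "\<forall>\<^sub>F n in sequentially. root n (N n) \<le> 1/4 * (root n 12 * (root n (real n)) ^ 2)"
  proof (rule eventually_sequentiallyI[of 1])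
    fix n :: nat assume n: "1 \<le> n"
    then have "root n (N n) \<le> root n ((1/4) ^ n * (12 * n ^ 2))" using bounds[of n] by simp
    also have "\<dots> = 1/4 * (root n 12 * (root n (real n)) ^ 2)"
      using n by (simp add: real_root_mult real_root_power_cancel real_root_power)
    finally show "root n (N n) \<le> 1/4 * (root n 12 * (root n (real n)) ^ 2)" .
  qed
  have "(\<lambda>n. 1/4 * (root n 12 * (root n (real n)) ^ 2)) \<longlonglongrightarrow> 1/4 * (1 * 1 ^ 2)"
    by (intro tendsto_intros LIMSEQ_root LIMSEQ_root_const) auto
  then show "(\<lambda>n. 1/4 * (root n 12 * (root n (real n)) ^ 2)) \<longlonglongrightarrow> 1/4" by simp
qed auto

section \<open>Zeros of complex polynomials\<close>

text \<open>
  Indexing the zeros by \<open>{..<degree p}\<close> turns sums over distinct zeros weighted by their orders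
  into plain sums.
\<close>

lemma complex_poly_zeros:
  fixes p :: "complex poly"
  assumes "p \<noteq> 0"
  obtains \<zeta> where "p = smult (lead_coeff p) (\<Prod>i<degree p. [:- \<zeta> i, 1:])"
    and "\<And>f::complex \<Rightarrow> real. (\<Sum>z | poly p z = 0. real (order z p) * f z) = (\<Sum>i<degree p. f (\<zeta> i))"
    and "\<And>i. i < degree p \<Longrightarrow> poly p (\<zeta> i) = 0"
proof -
  obtain \<zeta> where \<zeta>: "smult (lead_coeff p) (\<Prod>i<degree p. [:- \<zeta> i, 1:]) = p"
    by (rule complex_poly_decompose')
  have "proots p = proots (smult (lead_coeff p) (\<Prod>i<degree p. [:- \<zeta> i, 1:]))" by (simp only: \<zeta>)
  also have "\<dots> = proots (\<Prod>i<degree p. [:- \<zeta> i, 1:])"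
    using assms by (intro proots_smult) simp
  also have "\<dots> = (\<Sum>i<degree p. proots [:- \<zeta> i, 1:])"
    by (rule proots_prod) simp
  also have "\<dots> = (\<Sum>i<degree p. {#\<zeta> i#})" by simp
  finally have pr: "proots p = (\<Sum>i<degree p. {#\<zeta> i#})" .
  show ?thesis
  proof (rule that)
    show "p = smult (lead_coeff p) (\<Prod>i<degree p. [:- \<zeta> i, 1:])" using \<zeta> by simp
    show "poly p (\<zeta> i) = 0" if "i < degree p" for i
    proof -
      have "poly p (\<zeta> i) = lead_coeff p * (\<Prod>j<degree p. \<zeta> i - \<zeta> j)"
        by (subst \<zeta>[symmetric]) (simp add: poly_prod)
      also have "\<dots> = 0" using that by (auto intro!: prod_zero)
      finally show ?thesis .
    qed
    then have sub: "\<zeta> ` {..<degree p} \<subseteq> {z. poly p z = 0}" by auto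
    have fin: "finite {z. poly p z = 0}" by (rule poly_roots_finite[OF assms])
    fix f :: "complex \<Rightarrow> real"
    have ord: "order z p = card {i \<in> {..<degree p}. \<zeta> i = z}" for z
    proof -
      have "order z p = count (proots p) z" using assms by simp
      also have "\<dots> = (\<Sum>i<degree p. if \<zeta> i = z then 1 else 0)"
        unfolding pr count_sum by (intro sum.cong refl) simp
      also have "\<dots> = card {i \<in> {..<degree p}. \<zeta> i = z}"
        by (simp add: sum.If_cases Int_def)
      finally show ?thesis .
    qed
    have "(\<Sum>i<degree p. f (\<zeta> i)) = (\<Sum>z | poly p z = 0. \<Sum>i | i \<in> {..<degree p} \<and> \<zeta> i = z. f (\<zeta> i))"
      using sub fin by (intro sum.group[symmetric]) auto
    also have "\<dots> = (\<Sum>z | poly p z = 0. real (order z p) * f z)"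
    proof (intro sum.cong refl)
      fix z
      have "(\<Sum>i | i \<in> {..<degree p} \<and> \<zeta> i = z. f (\<zeta> i)) = (\<Sum>i | i \<in> {..<degree p} \<and> \<zeta> i = z. f z)"
        by (intro sum.cong) auto
      then show "(\<Sum>i | i \<in> {..<degree p} \<and> \<zeta> i = z. f (\<zeta> i)) = real (order z p) * f z"
        unfolding ord by simp
    qed
    finally show "(\<Sum>z | poly p z = 0. real (order z p) * f z) = (\<Sum>i<degree p. f (\<zeta> i))" ..
  qed
qed

lemma integral_zero_counting_measure:
  fixes p :: "complex poly" and f :: "complex \<Rightarrow> real"
  assumes "p \<noteq> 0" and [measurable]: "f \<in> borel_measurable borel"
  shows "(LINT z|zero_counting_measure n p. f z) = (\<Sum>z | poly p z = 0. real (order z p) * f z) / n"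
proof -
  have fin: "finite {z. poly p z = 0}" by (rule poly_roots_finite[OF assms(1)])
  have meas: "(\<lambda>z. z) \<in> measurable (point_measure {z. poly p z = 0} (\<lambda>z. ennreal (real (order z p) / real n))) borel"
    by (simp add: measurable_def point_measure_def sets_density)
  have "(LINT z|zero_counting_measure n p. f z)
      = (LINT z|point_measure {z. poly p z = 0} (\<lambda>z. ennreal (real (order z p) / real n)). f z)"
    unfolding zero_counting_measure_def by (subst integral_distr[OF meas]) auto
  also have "\<dots> = (\<Sum>z | poly p z = 0. (real (order z p) / real n) *\<^sub>R f z)"
    by (rule lebesgue_integral_point_measure_finite[OF fin]) simp
  finally show ?thesis by (simp add: sum_divide_distrib)
qed

text \<open>
  Newton's identities in the form of a logarithmic derivative: the second factor is the generating
  function of the power sums.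
\<close>

lemma fps_deriv_prod_linear:
  fixes r :: "nat \<Rightarrow> 'a::field"
  shows "fps_deriv (\<Prod>i<n. 1 - fps_const (r i) * fps_X)
           = - ((\<Prod>i<n. 1 - fps_const (r i) * fps_X) * Abs_fps (\<lambda>k. \<Sum>i<n. r i ^ Suc k))"
proof (induction n)
  case 0
  have "Abs_fps (\<lambda>k. 0) = (0 :: 'a fps)" by (simp add: fps_eq_iff)
  then show ?case by simp
next
  case (Suc n)
  define P where "P = (\<Prod>i<n. 1 - fps_const (r i) * fps_X)"
  define A where "A = Abs_fps (\<lambda>k. \<Sum>i<n. r i ^ Suc k)"
  define B where "B = Abs_fps (\<lambda>k. r n ^ Suc k)"
  define L where "L = 1 - fps_const (r n) * fps_X"
  have AB: "Abs_fps (\<lambda>k. \<Sum>i<Suc n. r i ^ Suc k) = A + B"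
    by (simp add: A_def B_def fps_eq_iff)
  have LB: "L * B = fps_const (r n)"
  proof (rule fps_ext)
    fix k
    show "(L * B) $ k = fps_const (r n) $ k"
      by (cases k) (simp_all add: L_def B_def left_diff_distrib mult.assoc)
  qed
  have "fps_deriv (P * L) = P * fps_deriv L + fps_deriv P * L" by simp
  also have "fps_deriv L = - fps_const (r n)" by (simp add: L_def)
  also have "fps_deriv P = - (P * A)" using Suc by (simp add: P_def A_def)
  also have "P * - fps_const (r n) + - (P * A) * L = - (P * L * (A + B))"
    unfolding LB[symmetric] by (simp add: algebra_simps)
  finally show ?case unfolding AB by (simp add: P_def L_def)
qed

text \<open>
  Newton's identities express the \<open>k\<close>-th power sum through \<open>k\<close> times a coefficient and the earlier
  power sums, all with coefficients of modulus at most \<open>1\<close>. The values \<open>2^k - 1\<close> solve the recursion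
  \<open>b_k = k + b_1 + ... + b_(k - 1)\<close>. The number \<open>n\<close> of zeros does not enter.
\<close>

lemma power_sum_bound:
  fixes r :: "nat \<Rightarrow> complex"
  assumes R: "\<And>k. cmod ((\<Prod>i<n. 1 - fps_const (r i) * fps_X) $ k) \<le> 1" and k: "k > 0"
  shows "cmod (\<Sum>i<n. r i ^ k) \<le> 2 ^ k - 1"
  using k
proof (induction k rule: less_induct)
  case (less k)
  define P where "P = (\<Prod>i<n. 1 - fps_const (r i) * fps_X)"
  define p where "p = (\<lambda>j. \<Sum>i<n. r i ^ j)"
  obtain m where m: "k = Suc m" using less.prems by (cases k) auto
  have P0: "P $ 0 = 1"
    unfolding P_def by (induction n) simp_all
  have "fps_deriv P = - (P * Abs_fps (\<lambda>k. p (Suc k)))"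
    unfolding P_def p_def by (rule fps_deriv_prod_linear)
  then have "fps_deriv P $ m = - (P * Abs_fps (\<lambda>k. p (Suc k))) $ m" by simp
  then have "of_nat k * P $ k = - (\<Sum>i=0..m. P $ i * p (Suc (m - i)))"
    by (simp add: m fps_mult_nth)
  also have "(\<Sum>i=0..m. P $ i * p (Suc (m - i))) = p k + (\<Sum>i=Suc 0..m. P $ i * p (Suc (m - i)))"
    by (subst sum.atLeast_Suc_atMost) (simp_all add: P0 m)
  finally have "of_nat k * P $ k = - (p k + (\<Sum>i=Suc 0..m. P $ i * p (Suc (m - i))))" .
  then have pk: "p k = - (of_nat k * P $ k) - (\<Sum>i=Suc 0..m. P $ i * p (Suc (m - i)))"
    by (simp only: minus_minus add_diff_cancel_right')
  have "cmod (p k) \<le> cmod (of_nat k * P $ k) + cmod (\<Sum>i=Suc 0..m. P $ i * p (Suc (m - i)))"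
    unfolding pk using norm_triangle_ineq4[of "- (of_nat k * P $ k)"] by (simp del: of_nat_Suc)
  also have "cmod (of_nat k * P $ k) \<le> real k * 1"
    unfolding norm_mult using R[of k] by (intro mult_mono) (auto simp: P_def)
  also have "cmod (\<Sum>i=Suc 0..m. P $ i * p (Suc (m - i))) \<le> (\<Sum>i=Suc 0..m. 2 ^ Suc (m - i) - 1)"
  proof (rule sum_norm_le)
    fix i assume i: "i \<in> {Suc 0..m}"
    have "cmod (p (Suc (m - i))) \<le> 2 ^ Suc (m - i) - 1"
      unfolding p_def using i by (intro less.IH) (auto simp: m)
    moreover have "cmod (P $ i) \<le> 1" using R by (simp add: P_def)
    ultimately have "cmod (P $ i) * cmod (p (Suc (m - i))) \<le> 1 * (2 ^ Suc (m - i) - 1)"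
      by (intro mult_mono) auto
    then show "cmod (P $ i * p (Suc (m - i))) \<le> 2 ^ Suc (m - i) - 1" by (simp add: norm_mult)
  qed
  also have "(\<Sum>i=Suc 0..m. 2 ^ Suc (m - i) - 1) = (2 ^ k - 1 - real k :: real)"
  proof -
    have "(\<Sum>i=Suc 0..m. 2 ^ Suc (m - i) - 1) = (\<Sum>j<m. 2 ^ Suc j - (1::real))"
      by (rule sum.reindex_bij_witness[of _ "\<lambda>j. m - j" "\<lambda>i. m - i"]) auto
    also have "\<dots> = 2 ^ Suc m - 2 - real m" by (induction m) simp_all
    finally show ?thesis by (simp add: m)
  qed
  finally show ?case by (simp add: p_def)
qed

lemma enestroem_kakeya_identity:
  fixes x \<rho> :: "'a::comm_ring_1"
  shows "(x - \<rho>) * (\<Sum>k\<le>n. b k * x ^ k)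
           = b n * x ^ Suc n - \<rho> * b 0 - (\<Sum>k<n. (\<rho> * b (Suc k) - b k) * x ^ Suc k)"
  by (induction n) (simp_all add: algebra_simps)

text \<open>
  Multiplication by \<open>x - \<rho>\<close> makes all coefficients but the leading one nonpositive. At a zero \<open>x\<close>
  the leading term is thus balanced by terms of one sign, which gives the same identity for \<open>|x|\<close>
  as an inequality; for \<open>|x| > \<rho>\<close> it contradicts the positivity of the coefficients.
\<close>

lemma enestroem_kakeya:
  fixes b :: "nat \<Rightarrow> real" and x :: complex
  assumes pos: "\<And>k. k \<le> n \<Longrightarrow> 0 < b k" and ratio: "\<And>k. k < n \<Longrightarrow> b k \<le> \<rho> * b (Suc k)"
    and \<rho>: "0 \<le> \<rho>" and root: "(\<Sum>k\<le>n. of_real (b k) * x ^ k) = 0"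
  shows "cmod x \<le> \<rho>"
proof (rule ccontr)
  assume "\<not> cmod x \<le> \<rho>"
  then have gt: "\<rho> < cmod x" by simp
  have "of_real (b n) * x ^ Suc n = of_real \<rho> * of_real (b 0)
      + (\<Sum>k<n. (of_real \<rho> * of_real (b (Suc k)) - of_real (b k)) * x ^ Suc k)"
    using enestroem_kakeya_identity[of x "of_real \<rho>" "\<lambda>k. of_real (b k)" n] root by (simp add: algebra_simps)
  also have "\<dots> = of_real (\<rho> * b 0) + (\<Sum>k<n. of_real (\<rho> * b (Suc k) - b k) * x ^ Suc k)" by simp
  finally have "cmod (of_real (b n) * x ^ Suc n)
      = cmod (of_real (\<rho> * b 0) + (\<Sum>k<n. of_real (\<rho> * b (Suc k) - b k) * x ^ Suc k))" by simp
  also have "\<dots> \<le> cmod (of_real (\<rho> * b 0)) + (\<Sum>k<n. cmod (of_real (\<rho> * b (Suc k) - b k) * x ^ Suc k))"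
    by (intro order_trans[OF norm_triangle_ineq] add_mono norm_sum order_refl)
  also have "\<dots> = \<rho> * b 0 + (\<Sum>k<n. (\<rho> * b (Suc k) - b k) * cmod x ^ Suc k)"
  proof -
    have "cmod (of_real (\<rho> * b 0)) = \<rho> * b 0" using pos[of 0] \<rho> by (simp only: norm_of_real abs_of_nonneg less_imp_le mult_nonneg_nonneg)
    moreover have "cmod (of_real (\<rho> * b (Suc k) - b k) * x ^ Suc k) = (\<rho> * b (Suc k) - b k) * cmod x ^ Suc k"
      if "k < n" for k
      using ratio[OF that] by (simp only: norm_mult norm_power norm_of_real abs_of_nonneg diff_ge_0_iff_ge)
    ultimately show ?thesis by simp
  qed
  also have "cmod (of_real (b n) * x ^ Suc n) = b n * cmod x ^ Suc n"
    using pos[of n] by (simp add: norm_mult norm_power)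
  finally have "(cmod x - \<rho>) * (\<Sum>k\<le>n. b k * cmod x ^ k) \<le> 0"
    unfolding enestroem_kakeya_identity by simp
  moreover have "0 < (\<Sum>k\<le>n. b k * cmod x ^ k)"
  proof -
    have "0 < b 0 * cmod x ^ 0" using pos[of 0] by simp
    also have "\<dots> \<le> (\<Sum>k\<le>n. b k * cmod x ^ k)"
      using pos by (intro member_le_sum mult_nonneg_nonneg) (auto intro: less_imp_le)
    finally show ?thesis .
  qed
  ultimately show False using gt by (simp add: mult_le_0_iff)
qed

text \<open>
  The coefficients of \<open>s(- z)\<close> are positive and the ratios of consecutive ones are
  \<open>(k + 1) / (n + k)\<close>, increasing in \<open>k\<close> up to \<open>n / (2 n - 1)\<close>.
\<close>

lemma binom_taylor_zero_bound:
  assumes n: "n > 0" and z: "poly (binom_taylor n n) z = 0"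
  shows "cmod z \<le> n / (2 * real n - 1)"
proof -
  define b where "b = (\<lambda>k. real ((n + k - 1) choose k))"
  have rec: "real (Suc k) * b (Suc k) = real (n + k) * b k" for k
  proof -
    have "cmod (of_nat (Suc k) * neg_binom n (Suc k)) = cmod (of_nat (n + k) * neg_binom n k)"
      unfolding neg_binom_Suc by simp
    then show ?thesis
      using norm_neg_binom[OF n] by (simp add: norm_mult b_def del: of_nat_Suc of_nat_add)
  qed
  have "cmod (- z) \<le> n / (2 * real n - 1)"
  proof (rule enestroem_kakeya)
    fix k assume k: "k < n"
    have "b k = real (Suc k) / real (n + k) * b (Suc k)"
      using rec[of k] n by (simp add: field_simps del: of_nat_Suc of_nat_add)
    also have "\<dots> \<le> n / (2 * real n - 1) * b (Suc k)"
    proof (rule mult_right_mono)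
      have "real (Suc k) * (2 * real n - 1) \<le> real n * real (n + k)"
      proof -
        have "0 \<le> (real n - 1) * (real n - 1 - real k)" using k n by (intro mult_nonneg_nonneg) auto
        then show ?thesis by (simp add: algebra_simps)
      qed
      then show "real (Suc k) / real (n + k) \<le> n / (2 * real n - 1)"
        using n by (simp add: divide_simps mult.commute)
    qed (simp add: b_def)
    finally show "b k \<le> n / (2 * real n - 1) * b (Suc k)" .
  next
    have "poly (binom_taylor n n) z = (\<Sum>k\<le>n. neg_binom n k * z ^ k)"
      by (simp add: binom_taylor_def poly_sum poly_monom)
    also have "\<dots> = (\<Sum>k\<le>n. of_real (b k) * (- z) ^ k)"
      by (intro sum.cong refl) (simp add: neg_binom_binomial[OF n] b_def power_minus[of z])
    finally show "(\<Sum>k\<le>n. of_real (b k) * (- z) ^ k) = 0" using z by simp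
  next
    show "0 < b k" if "k \<le> n" for k
      using n by (simp add: b_def)
  qed (use n in simp)
  then show ?thesis by simp
qed

lemma norm_neg_binom_mono:
  assumes n: "n > 0" and k: "k \<le> m"
  shows "cmod (neg_binom n k) \<le> cmod (neg_binom n m)"
proof -
  have sym: "(n + j - 1) choose j = (n + j - 1) choose (n - 1)" for j
    using binomial_symmetric[of j "n + j - 1"] n by simp
  have "(n + k - 1) choose (n - 1) \<le> (n + m - 1) choose (n - 1)"
    using k by (intro binomial_right_mono) simp
  then show ?thesis unfolding norm_neg_binom[OF n] sym by simp
qed

section \<open>Distribution of the zeros\<close>

lemma binom_taylor_nonzero:
  assumes "n > 0"
  shows "binom_taylor n n \<noteq> 0"
proof
  assume "binom_taylor n n = 0"
  then have "neg_binom n n = 0" using degree_binom_taylor(2)[of n n] assms by simp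
  then show False using neg_binom_nonzero[OF assms] by simp
qed

text \<open>
  The power sums are bounded by \<open>power_sum_bound\<close>, since the moduli of the coefficients increase
  towards the leading one. The last bound comes from the values at two points: \<open>s(0) = 1\<close>, and
  \<open>|s(-1)|\<close> is twice the modulus of the leading coefficient by \<open>binom_taylor_ode\<close> at \<open>z = -1\<close>.
\<close>

lemma binom_taylor_zeros:
  assumes n: "n > 0"
  obtains \<zeta> where "\<And>i. i < n \<Longrightarrow> poly (binom_taylor n n) (\<zeta> i) = 0"
    and "\<And>f::complex \<Rightarrow> real. f \<in> borel_measurable borel \<Longrightarrow>
           (LINT z|zero_counting_measure n (binom_taylor n n). f z) = (\<Sum>i<n. f (\<zeta> i)) / n"
    and "\<And>k. k > 0 \<Longrightarrow> cmod (\<Sum>i<n. \<zeta> i ^ k) \<le> 2 ^ k"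
    and "\<And>i. i < n \<Longrightarrow> 0 < cmod (4 * (\<zeta> i * (\<zeta> i + 1)))"
    and "(\<Sum>i<n. ln (cmod (4 * (\<zeta> i * (\<zeta> i + 1))))) \<le> ln (8 * real n)"
proof -
  define S where "S = binom_taylor n n"
  define c where "c = neg_binom n n"
  have c: "c \<noteq> 0" using neg_binom_nonzero[OF n] by (simp add: c_def)
  have deg: "degree S = n" "lead_coeff S = c"
    using degree_binom_taylor[of n n] n by (auto simp: S_def c_def)
  have S0: "S \<noteq> 0" using binom_taylor_nonzero[OF n] by (simp add: S_def)
  have co_n: "coeff S n = c" using deg by simp
  obtain \<zeta> where "S = smult (lead_coeff S) (\<Prod>i<degree S. [:- \<zeta> i, 1:])"
    and "\<And>f::complex \<Rightarrow> real. (\<Sum>z | poly S z = 0. real (order z S) * f z) = (\<Sum>i<degree S. f (\<zeta> i))"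
    and "\<And>i. i < degree S \<Longrightarrow> poly S (\<zeta> i) = 0"
    using complex_poly_zeros[OF S0] by blast
  note \<zeta> = this(1)[unfolded deg(1) co_n] and cnt = this(2)[unfolded deg(1)] and zero = this(3)[unfolded deg(1)]
  have S_eval: "poly S z = c * (\<Prod>i<n. z - \<zeta> i)" for z
    using arg_cong[OF \<zeta>, of "\<lambda>p. poly p z"] by (simp add: poly_prod)
  have at0: "poly S 0 = 1" by (simp add: S_def poly_0_coeff_0 coeff_binom_taylor)
  have at1: "cmod (poly S (- 1)) = 2 * cmod c"
  proof -
    have "of_nat n * poly S (- 1) = of_nat n * (2 * c * (- 1) ^ n)"
      using binom_taylor_ode[of n n "- 1"] by (simp add: S_def c_def mult.assoc)
    then have "poly S (- 1) = 2 * c * (- 1) ^ n" using n by simp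
    then show ?thesis by (simp add: norm_mult norm_power)
  qed
  show ?thesis
  proof (rule that)
    show "poly (binom_taylor n n) (\<zeta> i) = 0" if "i < n" for i using zero[OF that] by (simp add: S_def)
    show "(LINT z|zero_counting_measure n (binom_taylor n n). f z) = (\<Sum>i<n. f (\<zeta> i)) / n"
      if "f \<in> borel_measurable borel" for f :: "complex \<Rightarrow> real"
      using integral_zero_counting_measure[OF S0 that, of n] unfolding cnt by (simp add: S_def)
  next
    fix k :: nat assume k: "k > 0"
    have lin: "fps_of_poly (reflect_poly [:- a, 1:]) = 1 - fps_const a * fps_X" for a :: complex
    proof (cases "a = 0")
      case True
      then show ?thesis by (simp add: reflect_poly_def)
    next
      case False
      then have "reflect_poly [:- a, 1:] = [:1, - a:]" by (simp add: reflect_poly_def)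
      then show ?thesis by (simp add: fps_of_poly_linear')
    qed
    have fp: "fps_of_poly (reflect_poly S) = fps_const c * (\<Prod>i<n. 1 - fps_const (\<zeta> i) * fps_X)"
      using arg_cong[OF \<zeta>, of "\<lambda>p. fps_of_poly (reflect_poly p)"]
      by (simp add: reflect_poly_smult reflect_poly_prod fps_of_poly_smult fps_of_poly_prod lin)
    have co: "coeff (reflect_poly S) j = c * (\<Prod>i<n. 1 - fps_const (\<zeta> i) * fps_X) $ j" for j
      using arg_cong[OF fp, of "\<lambda>F. F $ j"] by simp
    have "cmod ((\<Prod>i<n. 1 - fps_const (\<zeta> i) * fps_X) $ j) \<le> 1" for j
    proof -
      have "cmod (coeff (reflect_poly S) j) \<le> cmod c"
      proof -
        have "coeff (reflect_poly S) j = (if j \<le> n then neg_binom n (n - j) else 0)"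
          unfolding coeff_reflect_poly deg(1) by (simp add: S_def coeff_binom_taylor)
        then show ?thesis
          using norm_neg_binom_mono[OF n, of "n - j" n] by (simp add: c_def)
      qed
      then have "cmod c * cmod ((\<Prod>i<n. 1 - fps_const (\<zeta> i) * fps_X) $ j) \<le> cmod c * 1"
        unfolding co norm_mult by simp
      then show ?thesis using c by simp
    qed
    then have "cmod (\<Sum>i<n. \<zeta> i ^ k) \<le> 2 ^ k - 1" using k by (rule power_sum_bound)
    then show "cmod (\<Sum>i<n. \<zeta> i ^ k) \<le> 2 ^ k" by simp
  next
    have nz: "\<zeta> i \<noteq> 0" "\<zeta> i + 1 \<noteq> 0" if "i < n" for i
    proof -
      show "\<zeta> i \<noteq> 0" using zero[OF that] at0 by (metis zero_neq_one)
      show "\<zeta> i + 1 \<noteq> 0"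
      proof
        assume "\<zeta> i + 1 = 0"
        then have "\<zeta> i = - 1" by (simp add: eq_neg_iff_add_eq_0)
        then show False using zero[OF that] at1 c by simp
      qed
    qed
    then show pos: "0 < cmod (4 * (\<zeta> i * (\<zeta> i + 1)))" if "i < n" for i using that by simp
    have p0: "cmod c * (\<Prod>i<n. cmod (\<zeta> i)) = 1"
      using arg_cong[OF S_eval[of 0], of cmod]
      unfolding at0 norm_mult prod_norm[symmetric] by simp
    have p1: "cmod c * (\<Prod>i<n. cmod (\<zeta> i + 1)) = 2 * cmod c"
    proof -
      have "cmod (- 1 - \<zeta> i) = cmod (\<zeta> i + 1)" for i
        using norm_minus_cancel[of "\<zeta> i + 1"] by (simp only: minus_add_distrib) (simp add: add.commute)
      then show ?thesis
        using arg_cong[OF S_eval[of "- 1"], of cmod]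
        unfolding at1 norm_mult prod_norm[symmetric] by simp
    qed
    have "(\<Prod>i<n. cmod (4 * (\<zeta> i * (\<zeta> i + 1)))) = 4 ^ n * ((\<Prod>i<n. cmod (\<zeta> i)) * (\<Prod>i<n. cmod (\<zeta> i + 1)))"
      by (simp add: norm_mult prod.distrib)
    also have "(\<Prod>i<n. cmod (\<zeta> i + 1)) = 2" using p1 c by simp
    also have "(\<Prod>i<n. cmod (\<zeta> i)) = 1 / cmod c" using p0 c by (simp add: field_simps)
    finally have pr: "(\<Prod>i<n. cmod (4 * (\<zeta> i * (\<zeta> i + 1)))) = 2 * 4 ^ n / cmod c" by simp
    have "4 ^ n / (2 * real n) \<le> 2 * cmod c"
      using central_binomial_lower_bound[OF n] norm_neg_binom_central[OF n] by (simp add: c_def)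
    then have "2 * 4 ^ n / cmod c \<le> 8 * real n"
      using n c by (simp add: field_simps)
    then have "ln (\<Prod>i<n. cmod (4 * (\<zeta> i * (\<zeta> i + 1)))) \<le> ln (8 * real n)"
      unfolding pr using c n by (intro ln_mono) auto
    then show "(\<Sum>i<n. ln (cmod (4 * (\<zeta> i * (\<zeta> i + 1))))) \<le> ln (8 * real n)"
      using pos by (subst (asm) ln_prod) auto
  qed
qed

text \<open>
  To the right of the axis a zero has defect \<open>1\<close>, which contradicts \<open>taylor_defect_bound\<close> if
  \<open>|4 z (z + 1)|\<close> stays below \<open>1\<close>. To the left of it \<open>|z| > 1/2\<close>, and \<open>binom_taylor_zero_bound\<close>
  bounds \<open>|z + 1|\<close> from below by a quantity that tends to \<open>1/2\<close>.
\<close>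

lemma zeros_location:
  assumes \<delta>: "0 < \<delta>"
  shows "\<forall>\<^sub>F n in sequentially. \<forall>z. poly (binom_taylor n n) z = 0 \<longrightarrow>
           cmod z < 1/2 + \<delta> \<and> 1 - \<delta> < cmod (4 * (z * (z + 1)))"
proof -
  \<comment> \<open>The maximum covers the trivial case \<open>\<delta> > 1\<close>.\<close>
  define \<rho> where "\<rho> = max 0 (1 - \<delta>)"
  have \<rho>: "0 \<le> \<rho>" "\<rho> < 1" using \<delta> by (auto simp: \<rho>_def)
  have "(\<lambda>n. 2 * (real n * \<rho> ^ n)) \<longlonglongrightarrow> 2 * 0"
    using \<rho> by (intro tendsto_intros powser_times_n_limit_0) simp
  then have e1: "\<forall>\<^sub>F n in sequentially. 2 * (real n * \<rho> ^ n) < 1"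
    by (rule order_tendstoD) simp
  have "(\<lambda>n. real n / (2 * real n - 1)) \<longlonglongrightarrow> 1/2" by real_asymp
  then have e2: "\<forall>\<^sub>F n in sequentially. real n / (2 * real n - 1) < 1/2 + \<delta>"
    by (rule order_tendstoD) (use \<delta> in simp)
  have "(\<lambda>n. 2 * (1 - real n / (2 * real n - 1))) \<longlonglongrightarrow> 1" by real_asymp
  then have e3: "\<forall>\<^sub>F n in sequentially. 1 - \<delta> < 2 * (1 - real n / (2 * real n - 1))"
    by (rule order_tendstoD) (use \<delta> in simp)
  from e1 e2 e3 eventually_gt_at_top[of 0] show ?thesis
  proof eventually_elim
    case (elim n)
    show ?case
    proof (intro allI impI conjI)
      fix z assume z: "poly (binom_taylor n n) z = 0"
      have zb: "cmod z \<le> n / (2 * real n - 1)" using binom_taylor_zero_bound[OF elim(4) z] .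
      then show "cmod z < 1/2 + \<delta>" using elim by linarith
      show "1 - \<delta> < cmod (4 * (z * (z + 1)))"
      proof (cases "- 1/2 \<le> Re z")
        case True
        show ?thesis
        proof (rule ccontr)
          assume "\<not> ?thesis"
          then have le: "4 * cmod (z * (z + 1)) \<le> \<rho>" by (simp add: \<rho>_def norm_mult)
          then have "z \<in> loop_region" using True \<rho> by (simp add: loop_region_def)
          then have "cmod (taylor_defect n n z) \<le> 2 * n * (4 * cmod (z * (z + 1))) ^ n"
            using taylor_defect_bound[OF elim(4) order_refl, of z] by simp
          also have "\<dots> \<le> real (2 * n) * \<rho> ^ n"
            using power_mono[OF le, of n] by (intro mult_left_mono) auto
          also have "\<dots> < 1" using elim(1) by simp
          finally show False using z by (simp add: taylor_defect_def)
        qed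
      next
        case False
        then have "1/2 < cmod z" using abs_Re_le_cmod[of z] by linarith
        moreover have "1 - n / (2 * real n - 1) \<le> cmod (z + 1)"
          using norm_triangle_ineq2[of 1 "- z"] zb by (simp add: add.commute)
        moreover have "0 \<le> 1 - real n / (2 * real n - 1)"
          using elim(4) by (simp add: divide_simps)
        ultimately have "1/2 * (1 - n / (2 * real n - 1)) \<le> cmod z * cmod (z + 1)"
          by (intro mult_mono) auto
        then show ?thesis using elim by (simp add: norm_mult)
      qed
    qed
  qed
qed

text \<open>
  The logarithms of \<open>|4 z (z + 1)|\<close> at the zeros add up to at most \<open>ln (8 n)\<close>, while each of them is
  at least \<open>- \<epsilon>\<close> for large \<open>n\<close>. Hence only a vanishing fraction can exceed a fixed positive number.
\<close>

lemma zeros_outside_fraction: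
  fixes \<zeta> :: "nat \<Rightarrow> nat \<Rightarrow> complex"
  assumes zero: "\<And>n i. 0 < n \<Longrightarrow> i < n \<Longrightarrow> poly (binom_taylor n n) (\<zeta> n i) = 0"
    and pos: "\<And>n i. 0 < n \<Longrightarrow> i < n \<Longrightarrow> 0 < cmod (4 * (\<zeta> n i * (\<zeta> n i + 1)))"
    and sum: "\<And>n. 0 < n \<Longrightarrow> (\<Sum>i<n. ln (cmod (4 * (\<zeta> n i * (\<zeta> n i + 1))))) \<le> ln (8 * real n)"
    and \<eta>: "0 < \<eta>"
  shows "(\<lambda>n. real (card {i. i < n \<and> 1 + \<eta> \<le> cmod (4 * (\<zeta> n i * (\<zeta> n i + 1)))}) / n) \<longlonglongrightarrow> 0"
proof (rule LIMSEQ_I)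
  fix e :: real assume e: "0 < e"
  define l where "l = ln (1 + \<eta>)"
  have l: "0 < l" using \<eta> by (simp add: l_def)
  \<comment> \<open>With this \<open>\<delta>\<close> every zero contributes at least \<open>- e l / 2\<close> to the sum of logarithms.\<close>
  define \<delta> where "\<delta> = 1 - exp (- (e * l / 2))"
  have \<delta>: "0 < \<delta>" "1 - \<delta> = exp (- (e * l / 2))" using e l by (auto simp: \<delta>_def)
  have "(\<lambda>n. ln (8 * real n) / n) \<longlonglongrightarrow> 0" by real_asymp
  then have "\<forall>\<^sub>F n in sequentially. ln (8 * real n) / n < e * l / 2"
    by (rule order_tendstoD) (use e l in simp)
  with zeros_location[OF \<delta>(1)] eventually_gt_at_top[of 0]
  have "\<forall>\<^sub>F n in sequentially. norm (real (card {i. i < n \<and> 1 + \<eta> \<le> cmod (4 * (\<zeta> n i * (\<zeta> n i + 1)))}) / n - 0) < e"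
  proof eventually_elim
    case (elim n)
    define A where "A = {i. i < n \<and> 1 + \<eta> \<le> cmod (4 * (\<zeta> n i * (\<zeta> n i + 1)))}"
    have fin: "finite A" "A \<subseteq> {..<n}" by (auto simp: A_def)
    have low: "- (e * l / 2) \<le> ln (cmod (4 * (\<zeta> n i * (\<zeta> n i + 1))))" if "i < n" for i
    proof -
      have "1 - \<delta> \<le> cmod (4 * (\<zeta> n i * (\<zeta> n i + 1)))"
        using elim zero that by (auto intro: less_imp_le)
      then have "ln (1 - \<delta>) \<le> ln (cmod (4 * (\<zeta> n i * (\<zeta> n i + 1))))"
        using \<delta>(2) by (intro ln_mono) auto
      then show ?thesis by (simp add: \<delta>(2))
    qed
    have termwise: "(if i \<in> A then l else 0) - e * l / 2 \<le> ln (cmod (4 * (\<zeta> n i * (\<zeta> n i + 1))))" if "i < n" for i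
    proof (cases "i \<in> A")
      case True
      then have "l \<le> ln (cmod (4 * (\<zeta> n i * (\<zeta> n i + 1))))"
        unfolding l_def A_def using \<eta> by (intro ln_mono) auto
      moreover have "0 \<le> e * l / 2" using e l by simp
      ultimately show ?thesis using True by simp
    qed (use low[OF that] in simp)
    have "(\<Sum>i<n. (if i \<in> A then l else 0) - e * l / 2) \<le> (\<Sum>i<n. ln (cmod (4 * (\<zeta> n i * (\<zeta> n i + 1)))))"
      by (intro sum_mono termwise) simp
    also have "\<dots> \<le> ln (8 * real n)" using sum elim by simp
    also have "(\<Sum>i<n. (if i \<in> A then l else 0) - e * l / 2) = card A * l - n * (e * l / 2)"
      using fin by (simp add: sum_subtractf sum.If_cases Int_absorb1)
    finally have a1: "card A * l \<le> ln (8 * real n) + n * (e * l / 2)" by simp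
    have a2: "ln (8 * real n) < n * (e * l / 2)" using elim by (simp add: divide_simps mult.commute)
    have a3: "n * (e * l / 2) + n * (e * l / 2) = (n * e) * l" by (simp add: field_simps)
    have "card A * l < (n * e) * l" using a1 a2 a3 by simp
    then have "card A < n * e" using l by simp
    then show ?case unfolding A_def[symmetric] using elim(2) by (simp add: divide_simps mult.commute)
  qed
  then show "\<exists>N. \<forall>n\<ge>N. norm (real (card {i. i < n \<and> 1 + \<eta> \<le> cmod (4 * (\<zeta> n i * (\<zeta> n i + 1)))}) / n - 0) < e"
    by (simp add: eventually_sequentially)
qed

lemma zeros_polynomial_average:
  fixes \<zeta> :: "nat \<Rightarrow> nat \<Rightarrow> complex"
  assumes ps: "\<And>n k. 0 < n \<Longrightarrow> 0 < k \<Longrightarrow> cmod (\<Sum>i<n. \<zeta> n i ^ k) \<le> 2 ^ k"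
  shows "(\<lambda>n. (\<Sum>i<n. poly R (\<zeta> n i)) / of_nat n) \<longlonglongrightarrow> poly R 0"
proof -
  have lim: "(\<lambda>n. (\<Sum>i<n. \<zeta> n i ^ k) / of_nat n) \<longlonglongrightarrow> (if k = 0 then 1 else 0)" for k
  proof (cases "k = 0")
    case True
    have "\<forall>\<^sub>F n in sequentially. (1::complex) = of_nat n / of_nat n"
      using eventually_gt_at_top[of 0] by eventually_elim simp
    then show ?thesis using True by (auto intro: Lim_transform_eventually)
  next
    case False
    have "(\<lambda>n. 2 ^ k / real n) \<longlonglongrightarrow> 0" by real_asymp
    moreover have "\<forall>\<^sub>F n in sequentially. norm ((\<Sum>i<n. \<zeta> n i ^ k) / of_nat n) \<le> 2 ^ k / real n"
      using eventually_gt_at_top[of 0]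
      by eventually_elim (use ps False in \<open>auto simp: norm_divide intro!: divide_right_mono\<close>)
    ultimately show ?thesis using False by (auto intro: Lim_null_comparison)
  qed
  have eq: "(\<Sum>i<n. poly R (\<zeta> n i)) / of_nat n = (\<Sum>k\<le>degree R. coeff R k * ((\<Sum>i<n. \<zeta> n i ^ k) / of_nat n))" for n
    unfolding poly_altdef by (subst sum.swap) (simp add: sum_distrib_left sum_divide_distrib)
  have "(\<lambda>n. \<Sum>k\<le>degree R. coeff R k * ((\<Sum>i<n. \<zeta> n i ^ k) / of_nat n))
      \<longlonglongrightarrow> (\<Sum>k\<le>degree R. coeff R k * (if k = 0 then 1 else 0))"
    by (intro tendsto_intros lim)
  also have "(\<Sum>k\<le>degree R. coeff R k * (if k = 0 then 1 else 0)) = poly R 0"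
    by (simp add: poly_0_coeff_0 if_distrib[of "(*) _"] cong: if_cong)
  finally show ?thesis unfolding eq .
qed

text \<open>
  On the unit circle \<open>1 / u = cnj u\<close>, so a term with a negative exponent has the same real part as
  its conjugate, which has a positive exponent.
\<close>

lemma real_part_of_laurent:
  fixes P :: "complex poly"
  obtains P' :: "complex poly" where "\<And>u. cmod u = 1 \<Longrightarrow> Re (poly P u / u ^ N) = Re (poly P' u)"
proof
  define P' where "P' = (\<Sum>k\<le>degree P. if N \<le> k then monom (coeff P k) (k - N) else monom (cnj (coeff P k)) (N - k))"
  fix u :: complex assume u: "cmod u = 1"
  then have u0: "u \<noteq> 0" by auto
  have inv: "inverse u = cnj u" using u by (simp add: inverse_complex_def complex_eq_iff cmod_def) 
  have "Re (coeff P k * u ^ k / u ^ N) = Re (poly (if N \<le> k then monom (coeff P k) (k - N) else monom (cnj (coeff P k)) (N - k)) u)" for k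
  proof (cases "N \<le> k")
    case True
    then show ?thesis using u0 by (simp add: poly_monom power_diff)
  next
    case False
    then have "u ^ k / u ^ N = inverse u ^ (N - k)"
      using u0 by (simp add: power_diff field_simps power_inverse)
    then have "coeff P k * u ^ k / u ^ N = cnj (cnj (coeff P k) * u ^ (N - k))"
      by (simp add: inv times_divide_eq_right[symmetric] del: times_divide_eq_right)
    then have "Re (coeff P k * u ^ k / u ^ N) = Re (cnj (coeff P k) * u ^ (N - k))" by (simp only: cnj.sel)
    then show ?thesis using False by (simp add: poly_monom)
  qed
  then show "Re (poly P u / u ^ N) = Re (poly P' u)"
    by (simp add: P'_def poly_sum poly_altdef[of P] sum_divide_distrib)
qed

text \<open>
  The real functions on the circle that are Laurent polynomials in \<open>u\<close> form an algebra that
  contains \<open>Re\<close> and \<open>Im\<close>. The Stone-Weierstrass theorem makes it dense, and \<open>real_part_of_laurent\<close>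
  removes the negative exponents.
\<close>

lemma circle_real_part_dense:
  assumes cont: "continuous_on (sphere 0 1) F" and e: "0 < (e::real)"
  obtains P where "\<And>u. cmod u = 1 \<Longrightarrow> \<bar>F u - Re (poly P u)\<bar> < e"
proof -
  define R where "R = {h :: complex \<Rightarrow> real. \<exists>N P. \<forall>u. cmod u = 1 \<longrightarrow> complex_of_real (h u) = poly P u / u ^ N}"
  interpret function_ring_on R "sphere 0 1"
  proof
    show "compact (sphere (0::complex) 1)" by simp
    fix f g assume f: "f \<in> R"
    then obtain N P where NP: "\<And>u. cmod u = 1 \<Longrightarrow> complex_of_real (f u) = poly P u / u ^ N"
      unfolding R_def by blast
    have "continuous_on (sphere 0 1) (\<lambda>u. Re (poly P u / u ^ N))"
      by (intro continuous_intros) auto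
    moreover have "f u = Re (poly P u / u ^ N)" if "u \<in> sphere 0 1" for u
      using NP[of u] that by (metis Re_complex_of_real mem_sphere_0)
    ultimately show "continuous_on (sphere 0 1) f" by (metis (mono_tags, lifting) continuous_on_cong)
    assume "g \<in> R"
    then obtain M S where MS: "\<And>u. cmod u = 1 \<Longrightarrow> complex_of_real (g u) = poly S u / u ^ M"
      unfolding R_def by blast
    have "complex_of_real (f u + g u) = poly (P * monom 1 M + S * monom 1 N) u / u ^ (N + M)"
      and "complex_of_real (f u * g u) = poly (P * S) u / u ^ (N + M)" if u: "cmod u = 1" for u
    proof -
      have "u \<noteq> 0" using u by auto
      then show "complex_of_real (f u + g u) = poly (P * monom 1 M + S * monom 1 N) u / u ^ (N + M)"
        by (simp add: NP[OF u] MS[OF u] poly_monom power_add field_simps)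
      show "complex_of_real (f u * g u) = poly (P * S) u / u ^ (N + M)"
        by (simp add: NP[OF u] MS[OF u] power_add)
    qed
    then show "(\<lambda>x. f x + g x) \<in> R" "(\<lambda>x. f x * g x) \<in> R" unfolding R_def by blast+
  next
    fix c :: real
    have "complex_of_real c = poly [:of_real c:] u / u ^ 0" for u by simp
    then show "(\<lambda>_. c) \<in> R" unfolding R_def by blast
  next
    fix x y :: complex assume xy: "x \<noteq> y"
    have uu: "Re u * Re u + Im u * Im u = 1" if "cmod u = 1" for u
      using that cmod_power2[of u] by (simp add: power2_eq_square)
    have "complex_of_real (Re u) = poly [:1/2, 0, 1/2:] u / u ^ 1" if u: "cmod u = 1" for u
    proof -
      have "complex_of_real (Re u) * u = 1/2 + 1/2 * u\<^sup>2"
        by (rule complex_eqI) (use uu[OF u] in \<open>simp_all add: power2_eq_square field_simps\<close>)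
      moreover have "u \<noteq> 0" using u by auto
      ultimately show ?thesis by (simp add: field_simps power2_eq_square)
    qed
    then have Re: "Re \<in> R" unfolding R_def by blast
    have "complex_of_real (Im u) = poly [:\<i>/2, 0, - \<i>/2:] u / u ^ 1" if u: "cmod u = 1" for u
    proof -
      have "complex_of_real (Im u) * u = \<i>/2 + - \<i>/2 * u\<^sup>2"
        by (rule complex_eqI) (use uu[OF u] in \<open>simp_all add: power2_eq_square field_simps\<close>)
      moreover have "u \<noteq> 0" using u by auto
      ultimately show ?thesis by (simp add: field_simps power2_eq_square)
    qed
    then have Im: "Im \<in> R" unfolding R_def by blast
    show "\<exists>f\<in>R. f x \<noteq> f y" using xy Re Im complex_eq_iff by blast
  qed
  obtain h where h: "h \<in> R" "\<And>u. u \<in> sphere 0 1 \<Longrightarrow> \<bar>F u - h u\<bar> < e"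
    using Stone_Weierstrass_basic[OF cont e] by blast
  then obtain N P where NP: "\<And>u. cmod u = 1 \<Longrightarrow> complex_of_real (h u) = poly P u / u ^ N"
    unfolding R_def by blast
  obtain P' where P': "\<And>u. cmod u = 1 \<Longrightarrow> Re (poly P u / u ^ N) = Re (poly P' u)"
    using real_part_of_laurent by blast
  show ?thesis
  proof (rule that)
    fix u :: complex assume u: "cmod u = 1"
    then have "h u = Re (poly P' u)" using NP[OF u] P'[OF u] by (metis Re_complex_of_real)
    then show "\<bar>F u - Re (poly P' u)\<bar> < e" using h(2)[of u] u by simp
  qed
qed

text \<open>
  A point with \<open>|z| \<le> 1/2\<close> and \<open>|4 z (z + 1)| = 1\<close> lies on the right loop, that is, on the image of
  the circle under \<open>loop_param\<close>. So the continuous function \<open>m\<close> below is positive on the compact set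
  where \<open>|h| \<ge> e\<close>.
\<close>

lemma near_lemniscate_small:
  fixes h :: "complex \<Rightarrow> real"
  assumes cont: "continuous_on UNIV h"
    and small: "\<And>u. cmod u = 1 \<Longrightarrow> \<bar>h (loop_param u)\<bar> < e"
  obtains d where "0 < d" "d \<le> 1/2"
    "\<And>z. cmod z < 1/2 + d \<Longrightarrow> \<bar>cmod (4 * (z * (z + 1))) - 1\<bar> < d \<Longrightarrow> \<bar>h z\<bar> < e"
proof -
  define A where "A = cball 0 1 \<inter> {z. e \<le> \<bar>h z\<bar>}"
  define m where "m = (\<lambda>z. max (cmod z - 1/2) \<bar>cmod (4 * (z * (z + 1))) - 1\<bar>)"
  have "compact A"
    unfolding A_def
    by (intro compact_Int_closed compact_cball closed_Collect_le continuous_intros cont)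
  have mpos: "0 < m z" if z: "z \<in> A" for z
  proof (rule ccontr)
    assume "\<not> 0 < m z"
    then have "cmod z \<le> 1/2" and c: "cmod (4 * (z * (z + 1))) = 1" by (auto simp: m_def)
    then have "- 1/2 \<le> Re z" using abs_Re_le_cmod[of z] by linarith
    with c have "z \<in> loop_region" by (simp add: loop_region_def norm_mult)
    then have "\<bar>h z\<bar> < e" using small[OF c] loop_param_inverse by simp
    with z show False by (simp add: A_def)
  qed
  obtain d0 where d0: "0 < d0" "\<And>z. z \<in> A \<Longrightarrow> d0 \<le> m z"
  proof (cases "A = {}")
    case True
    then show ?thesis using that[of 1] by simp
  next
    case False
    have "continuous_on A m" unfolding m_def by (intro continuous_intros)
    then obtain z0 where "z0 \<in> A" "\<forall>z\<in>A. m z0 \<le> m z"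
      using continuous_attains_inf[OF \<open>compact A\<close> False] by blast
    then show ?thesis using that[of "m z0"] mpos by blast
  qed
  show ?thesis
  proof (rule that[of "min d0 (1/2)"])
    fix z assume z: "cmod z < 1/2 + min d0 (1/2)" "\<bar>cmod (4 * (z * (z + 1))) - 1\<bar> < min d0 (1/2)"
    then have "m z < d0" by (auto simp: m_def)
    then have "z \<notin> A" using d0(2) by fastforce
    moreover have "cmod z \<le> 1" using z(1) min.cobounded2[of d0 "1/2"] by linarith
    ultimately show "\<bar>h z\<bar> < e" by (simp add: A_def)
  qed (use d0 in auto)
qed

text \<open>
  Approximate \<open>f\<close> on the loop by the real part of a polynomial \<open>R\<close> in \<open>4 z (z + 1)\<close>. The averages of
  \<open>R\<close> over the zeros tend to \<open>R(0)\<close>, which is also its mean with respect to \<open>loop_measure\<close>. The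
  difference \<open>h\<close> is small at the zeros near the loop, and bounded at the few others.
\<close>

theorem zero_counting_measure_converges:
  "weak_star_conv (\<lambda>n. zero_counting_measure n (binom_taylor n n)) loop_measure"
  unfolding weak_star_conv_def
proof (intro allI impI)
  fix f :: "complex \<Rightarrow> real" assume cont: "continuous_on UNIV f" and "bounded (range f)"
  have fm: "f \<in> borel_measurable borel" using cont by (rule borel_measurable_continuous_onI)
  define good where "good = (\<lambda>n (\<zeta> :: nat \<Rightarrow> complex). (\<forall>i<n. poly (binom_taylor n n) (\<zeta> i) = 0) \<and>
       (LINT z|zero_counting_measure n (binom_taylor n n). f z) = (\<Sum>i<n. f (\<zeta> i)) / n \<and>
       (\<forall>k>0. cmod (\<Sum>i<n. \<zeta> i ^ k) \<le> 2 ^ k) \<and>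
       (\<forall>i<n. 0 < cmod (4 * (\<zeta> i * (\<zeta> i + 1)))) \<and>
       (\<Sum>i<n. ln (cmod (4 * (\<zeta> i * (\<zeta> i + 1))))) \<le> ln (8 * real n))"
  define \<zeta> where "\<zeta> = (\<lambda>n. SOME \<zeta>. good n \<zeta>)"
  have "good n (\<zeta> n)" if n: "0 < n" for n
  proof -
    have "\<exists>\<zeta>. good n \<zeta>"
      unfolding good_def
      by (rule binom_taylor_zeros[OF n], rule exI, intro conjI allI impI) (use fm in auto)
    then show ?thesis unfolding \<zeta>_def by (rule someI_ex)
  qed
  then have \<zeta>:
    "\<And>n i. 0 < n \<Longrightarrow> i < n \<Longrightarrow> poly (binom_taylor n n) (\<zeta> n i) = 0"
    "\<And>n. 0 < n \<Longrightarrow> (LINT z|zero_counting_measure n (binom_taylor n n). f z) = (\<Sum>i<n. f (\<zeta> n i)) / n"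
    "\<And>n k. 0 < n \<Longrightarrow> 0 < k \<Longrightarrow> cmod (\<Sum>i<n. \<zeta> n i ^ k) \<le> 2 ^ k"
    "\<And>n i. 0 < n \<Longrightarrow> i < n \<Longrightarrow> 0 < cmod (4 * (\<zeta> n i * (\<zeta> n i + 1)))"
    "\<And>n. 0 < n \<Longrightarrow> (\<Sum>i<n. ln (cmod (4 * (\<zeta> n i * (\<zeta> n i + 1))))) \<le> ln (8 * real n)"
    unfolding good_def by auto
  have circ: "continuous_on (sphere 0 1) (\<lambda>u. f (loop_param u))"
    by (intro continuous_on_compose2[OF cont] continuous_on_subset[OF continuous_loop_param]) auto
  show "(\<lambda>n. LINT z|zero_counting_measure n (binom_taylor n n). f z) \<longlonglongrightarrow> (LINT z|loop_measure. f z)"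
  proof (rule LIMSEQ_I)
    fix r :: real assume r: "0 < r"
    \<comment> \<open>The error consists of three terms: \<open>2 e\<close> from \<open>h\<close>, \<open>e\<close> from the averages of \<open>R\<close>, \<open>e\<close> from the limit.\<close>
    define e where "e = r / 5"
    have e: "0 < e" using r by (simp add: e_def)
    obtain P where P: "\<And>u. cmod u = 1 \<Longrightarrow> \<bar>f (loop_param u) - Re (poly P u)\<bar> < e"
      using circle_real_part_dense[OF circ e] by blast
    define R where "R = pcompose P [:0, 4, 4:]"
    have R: "poly R z = poly P (4 * (z * (z + 1)))" for z
      by (simp add: R_def poly_pcompose algebra_simps)
    define h where "h = (\<lambda>z. f z - Re (poly R z))"
    have hc: "continuous_on UNIV h" unfolding h_def by (intro continuous_intros cont)
    have hs: "\<bar>h (loop_param u)\<bar> < e" if "cmod u = 1" for u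
      using P[OF that] by (simp add: h_def R loop_param_quadratic)
    obtain d where d: "0 < d" "d \<le> 1/2"
      "\<And>z. cmod z < 1/2 + d \<Longrightarrow> \<bar>cmod (4 * (z * (z + 1))) - 1\<bar> < d \<Longrightarrow> \<bar>h z\<bar> < e"
      using near_lemniscate_small[OF hc hs] by blast
    have "compact (h ` cball 0 1)"
      using hc by (intro compact_continuous_image) (auto intro: continuous_on_subset)
    then obtain B where B: "0 < B" "\<And>z. z \<in> cball 0 1 \<Longrightarrow> \<bar>h z\<bar> \<le> B"
      using compact_imp_bounded bounded_pos by (metis image_eqI real_norm_def)
    define N where "N = (\<lambda>n. real (card {i. i < n \<and> 1 + d \<le> cmod (4 * (\<zeta> n i * (\<zeta> n i + 1)))}))"
    have "(\<lambda>n. B * (N n / n)) \<longlonglongrightarrow> B * 0"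
      unfolding N_def by (intro tendsto_intros zeros_outside_fraction \<zeta> d(1))
    then have ev1: "\<forall>\<^sub>F n in sequentially. B * (N n / n) < e"
      by (rule order_tendstoD) (use e in simp)
    have "(\<lambda>n. Re ((\<Sum>i<n. poly R (\<zeta> n i)) / of_nat n)) \<longlonglongrightarrow> Re (poly R 0)"
      by (intro tendsto_intros zeros_polynomial_average \<zeta>)
    from tendstoD[OF this e]
    have ev2: "\<forall>\<^sub>F n in sequentially. \<bar>Re ((\<Sum>i<n. poly R (\<zeta> n i)) / of_nat n) - Re (poly R 0)\<bar> < e"
      by (simp add: dist_real_def)
    have mu: "\<bar>(LINT z|loop_measure. f z) - Re (poly R 0)\<bar> \<le> e"
    proof -
      have fg: "integrable unif01 (\<lambda>t. f (loop_param (unit_circle t)))"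
      proof -
        have "compact ((\<lambda>u. f (loop_param u)) ` sphere 0 1)"
          by (intro compact_continuous_image circ) auto
        then obtain C where C: "\<And>u. u \<in> sphere 0 1 \<Longrightarrow> \<bar>f (loop_param u)\<bar> \<le> C"
          using compact_imp_bounded bounded_iff by (metis image_eqI real_norm_def)
        show ?thesis
        proof (rule unif01.integrable_const_bound)
          show "AE t in unif01. norm (f (loop_param (unit_circle t))) \<le> C" using C by simp
          show "(\<lambda>t. f (loop_param (unit_circle t))) \<in> borel_measurable unif01"
            using fm measurable_loop_param_circle by measurable
        qed
      qed
      have pm: "integrable unif01 (\<lambda>t. poly P (unit_circle t))" "(LINT t|unif01. poly P (unit_circle t)) = poly P 0"
        by (intro mean_value_unit_circle continuous_intros holomorphic_intros
            borel_measurable_continuous_onI)+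
      have "(LINT z|loop_measure. f z) = (LINT t|unif01. f (loop_param (unit_circle t)))"
        unfolding loop_measure_def using fm by (subst integral_distr) auto
      moreover have "Re (poly R 0) = (LINT t|unif01. Re (poly P (unit_circle t)))"
        using pm by (simp add: R)
      ultimately have "\<bar>(LINT z|loop_measure. f z) - Re (poly R 0)\<bar>
          = \<bar>LINT t|unif01. f (loop_param (unit_circle t)) - Re (poly P (unit_circle t))\<bar>"
        using fg pm by simp
      also have "\<dots> \<le> (LINT t|unif01. \<bar>f (loop_param (unit_circle t)) - Re (poly P (unit_circle t))\<bar>)"
        by simp
      also have "\<dots> \<le> (LINT t|unif01. e)"
        using fg pm P by (intro integral_mono) (auto intro: less_imp_le)
      finally show ?thesis using unif01.prob_space by simp
    qed
    have "\<forall>\<^sub>F n in sequentially. norm ((LINT z|zero_counting_measure n (binom_taylor n n). f z) - (LINT z|loop_measure. f z)) < r"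
      using ev1 ev2 zeros_location[OF d(1)] eventually_gt_at_top[of 0]
    proof eventually_elim
      case (elim n)
      define X where "X = {i. i < n \<and> 1 + d \<le> cmod (4 * (\<zeta> n i * (\<zeta> n i + 1)))}"
      have X: "finite X" "X \<subseteq> {..<n}" by (auto simp: X_def)
      have NX: "N n = card X" by (simp only: N_def X_def)
      have hb: "\<bar>h (\<zeta> n i)\<bar> \<le> e + (if i \<in> X then B else 0)" if i: "i < n" for i
      proof -
        have loc: "cmod (\<zeta> n i) < 1/2 + d" "1 - d < cmod (4 * (\<zeta> n i * (\<zeta> n i + 1)))"
          using elim \<zeta>(1)[OF _ i] by auto
        show ?thesis
        proof (cases "i \<in> X")
          case True
          have "\<bar>h (\<zeta> n i)\<bar> \<le> B" using loc d by (intro B) simp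
          then show ?thesis using True e by simp
        next
          case False
          then have "\<bar>cmod (4 * (\<zeta> n i * (\<zeta> n i + 1))) - 1\<bar> < d" using loc i by (auto simp: X_def)
          then have "\<bar>h (\<zeta> n i)\<bar> < e" using loc by (intro d(3))
          then show ?thesis using False by simp
        qed
      qed
      have "\<bar>\<Sum>i<n. h (\<zeta> n i)\<bar> \<le> (\<Sum>i<n. e + (if i \<in> X then B else 0))"
        by (intro order_trans[OF sum_abs] sum_mono hb) simp
      also have "\<dots> = n * e + B * N n"
        using X by (simp add: sum.distrib sum.If_cases Int_absorb1 NX)
      finally have "\<bar>(\<Sum>i<n. h (\<zeta> n i)) / n\<bar> \<le> e + B * (N n / n)"
        using elim(4) by (simp add: divide_simps mult.commute)
      then have H: "\<bar>(\<Sum>i<n. h (\<zeta> n i)) / n\<bar> \<le> 2 * e" using elim(1) by simp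
      have "(\<Sum>i<n. f (\<zeta> n i)) / n = (\<Sum>i<n. h (\<zeta> n i)) / n + Re ((\<Sum>i<n. poly R (\<zeta> n i)) / of_nat n)"
      proof -
        have "Re (s / of_nat n) = Re s / n" for s by (metis Re_divide_of_real of_real_of_nat_eq)
        then show ?thesis by (simp add: h_def sum_subtractf diff_divide_distrib)
      qed
      then have "\<bar>(\<Sum>i<n. f (\<zeta> n i)) / n - (LINT z|loop_measure. f z)\<bar> \<le> 4 * e"
        using H elim(2) mu by linarith
      then show ?case using \<zeta>(2)[OF elim(4)] r by (simp add: e_def)
    qed
    then show "\<exists>no. \<forall>n\<ge>no. norm ((LINT z|zero_counting_measure n (binom_taylor n n). f z) - (LINT z|loop_measure. f z)) < r"
      by (simp add: eventually_sequentially)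
  qed
qed

section \<open>Weighted polynomial approximation\<close>

lemma loop_param_in_interior:
  assumes "cmod u < 1"
  shows "loop_param u \<in> loop_interior"
proof -
  have "4 * cmod (loop_param u * (loop_param u + 1)) < 1"
    using assms loop_param_quadratic[of u] by (metis norm_mult norm_numeral)
  moreover have "- 1/2 < Re (loop_param u)"
  proof -
    have "0 < Re (1 + u)" using assms abs_Re_le_cmod[of u] by simp
    then have "0 < Re (csqrt (1 + u))" by (simp add: add_nonneg_pos)
    then show ?thesis by (simp add: loop_param_def)
  qed
  ultimately show ?thesis by (simp add: loop_interior_def)
qed

text \<open>
  The function \<open>f \<circ> loop_param\<close> is a power series on the unit disc. Its partial sums, taken at
  \<open>4 z (z + 1)\<close>, are polynomials in \<open>z\<close>.
\<close>

lemma polynomial_approximation: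
  assumes f: "f holomorphic_on loop_interior" and K: "compact K" "K \<subseteq> loop_interior" and e: "0 < (e::real)"
  obtains p where "\<And>z. z \<in> K \<Longrightarrow> cmod (f z - poly p z) < e"
proof -
  define F where "F = (\<lambda>u. f (loop_param u))"
  have holF: "F holomorphic_on ball 0 1"
    unfolding F_def
    by (rule holomorphic_on_compose_gen[OF holomorphic_loop_param f, unfolded o_def])
       (auto intro: loop_param_in_interior)
  define a where "a = (\<lambda>n. (deriv ^^ n) F 0 / fact n)"
  have sums: "(\<lambda>n. a n * u ^ n) sums F u" if "cmod u < 1" for u
    using holomorphic_power_series[OF holF, of u] that by (simp add: a_def)
  obtain r where r: "0 \<le> r" "r < 1" "\<And>z. z \<in> K \<Longrightarrow> 4 * cmod (z * (z + 1)) \<le> r"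
    using compact_in_loop_interior[OF K] by blast
  have "ereal r < conv_radius a"
  proof -
    obtain \<rho> where \<rho>: "r < \<rho>" "\<rho> < 1" using dense[OF r(2)] by blast
    have "summable (\<lambda>n. a n * of_real \<rho> ^ n)"
      using sums[of "of_real \<rho>"] \<rho> r by (auto simp: sums_iff)
    then have "ereal (norm (of_real \<rho> :: complex)) \<le> conv_radius a" by (rule conv_radius_geI)
    then have "ereal \<rho> \<le> conv_radius a" using \<rho> r by simp
    then show ?thesis using \<rho>(1) by (metis ereal_less(2) less_ereal.simps(1) less_le_trans)
  qed
  from uniform_limitD[OF powser_uniform_limit[OF this, of 0] e]
  obtain N where N: "\<And>u. u \<in> cball 0 r \<Longrightarrow> dist (\<Sum>i<N. a i * (u - 0) ^ i) (suminf (\<lambda>i. a i * (u - 0) ^ i)) < e"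
    unfolding eventually_sequentially by blast
  define p where "p = (\<Sum>i<N. smult (a i) ([:0, 4, 4:] ^ i))"
  show ?thesis
  proof (rule that[of p])
    fix z assume z: "z \<in> K"
    define u where "u = 4 * (z * (z + 1))"
    have u: "cmod u \<le> r" using r(3)[OF z] by (simp add: u_def norm_mult)
    have "z \<in> loop_region" using z K loop_interior_subset by blast
    then have "F u = f z" unfolding F_def u_def by (simp add: loop_param_inverse)
    moreover have "suminf (\<lambda>i. a i * u ^ i) = F u"
      using sums[of u] u r by (simp add: sums_iff)
    moreover have "poly p z = (\<Sum>i<N. a i * u ^ i)"
      by (simp add: p_def u_def poly_sum algebra_simps)
    ultimately show "cmod (f z - poly p z) < e"
      using N[of u] u by (simp add: dist_norm norm_minus_commute)
  qed
qed

text \<open>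
  Multiply \<open>p\<close> by the Taylor polynomial of order \<open>n - degree p\<close>. Compared with the order \<open>n\<close> the
  remainder loses only a constant factor \<open>8^d\<close> against geometric decay.
\<close>

lemma weighted_approximation_of_polynomial:
  assumes K: "compact K" "K \<subseteq> loop_interior" and e: "0 < (e::real)"
  shows "\<forall>\<^sub>F n in sequentially. \<exists>P. degree P \<le> n \<and> (\<forall>z\<in>K. cmod (poly p z - (1 + z) ^ n * poly P z) < e)"
proof -
  define d where "d = degree p"
  obtain r where r: "0 \<le> r" "r < 1" "\<And>z. z \<in> K \<Longrightarrow> 4 * cmod (z * (z + 1)) \<le> r"
    using compact_in_loop_interior[OF K] by blast
  have "compact (poly p ` K)" by (intro compact_continuous_image K continuous_intros)
  then obtain B where B: "0 < B" "\<And>z. z \<in> K \<Longrightarrow> cmod (poly p z) \<le> B"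
    using compact_imp_bounded bounded_pos by (metis image_eqI)
  have "(\<lambda>m. B * 2 * 8 ^ d * (real m * r ^ m) + B * 2 * 8 ^ d * d * r ^ m)
      \<longlonglongrightarrow> B * 2 * 8 ^ d * 0 + B * 2 * 8 ^ d * d * 0"
    using r by (intro tendsto_intros powser_times_n_limit_0 LIMSEQ_power_zero) auto
  then have "\<forall>\<^sub>F m in sequentially. B * 2 * 8 ^ d * (real m * r ^ m) + B * 2 * 8 ^ d * d * r ^ m < e"
    by (rule order_tendstoD) (use e in simp)
  then obtain M where M: "\<And>m. M \<le> m \<Longrightarrow> B * 2 * 8 ^ d * (real m * r ^ m) + B * 2 * 8 ^ d * d * r ^ m < e"
    by (auto simp: eventually_sequentially)
  show ?thesis
  proof (rule eventually_sequentiallyI[of "M + d + 1"])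
    fix n assume n: "M + d + 1 \<le> n"
    define m where "m = n - d"
    have nm: "n = m + d" "M \<le> m" "0 < n" "n - m = d" using n by (auto simp: m_def)
    define P where "P = p * binom_taylor n m"
    have "degree P \<le> n"
      using degree_mult_le[of p "binom_taylor n m"] degree_binom_taylor_le[of n m] nm
      by (simp add: P_def d_def)
    moreover have "cmod (poly p z - (1 + z) ^ n * poly P z) < e" if z: "z \<in> K" for z
    proof -
      have zr: "z \<in> loop_region" using z K loop_interior_subset by blast
      have "poly p z - (1 + z) ^ n * poly P z = poly p z * taylor_defect n m z"
        by (simp add: P_def taylor_defect_def algebra_simps)
      then have "cmod (poly p z - (1 + z) ^ n * poly P z) = cmod (poly p z) * cmod (taylor_defect n m z)"
        by (simp add: norm_mult)
      also have "\<dots> \<le> B * (2 * n * 8 ^ (n - m) * (4 * cmod (z * (z + 1))) ^ m)"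
        using B taylor_defect_bound[OF nm(3) _ zr, of m] z nm(1) by (intro mult_mono) auto
      also have "\<dots> \<le> B * (2 * n * 8 ^ (n - m) * r ^ m)"
        using B(1) r(3)[OF z] by (intro mult_left_mono power_mono) auto
      also have "\<dots> = B * 2 * 8 ^ d * (real m * r ^ m) + B * 2 * 8 ^ d * d * r ^ m"
        unfolding nm(4) by (simp add: nm(1) algebra_simps)
      also have "\<dots> < e" using M nm(2) by blast
      finally show ?thesis .
    qed
    ultimately show "\<exists>P. degree P \<le> n \<and> (\<forall>z\<in>K. cmod (poly p z - (1 + z) ^ n * poly P z) < e)" by blast
  qed
qed

text \<open>
  Choose for each \<open>n\<close> an element that is good for the smallest tolerance \<open>1 / (j + 1)\<close> with \<open>j \<le> n\<close>
  that can be met at \<open>n\<close>.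
\<close>

lemma diagonal_choice:
  fixes good :: "nat \<Rightarrow> real \<Rightarrow> 'a \<Rightarrow> bool"
  assumes ev: "\<And>e. 0 < e \<Longrightarrow> \<forall>\<^sub>F n in sequentially. \<exists>P. D n P \<and> good n e P"
    and dflt: "\<And>n. \<exists>P. D n P"
    and mono: "\<And>n e e' P. good n e P \<Longrightarrow> e \<le> e' \<Longrightarrow> good n e' P"
  shows "\<exists>P. (\<forall>n. D n (P n)) \<and> (\<forall>e>0. \<forall>\<^sub>F n in sequentially. good n e (P n))"
proof -
  define A where "A = (\<lambda>n. {j. j \<le> n \<and> (\<exists>P. D n P \<and> good n (1 / (real j + 1)) P)})"
  have fin: "finite (A n)" for n by (simp add: A_def)
  define P where "P = (\<lambda>n. if A n = {} then SOME P. D n P else SOME P. D n P \<and> good n (1 / (real (Max (A n)) + 1)) P)"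
  have best: "D n (P n) \<and> good n (1 / (real (Max (A n)) + 1)) (P n)" if "A n \<noteq> {}" for n
  proof -
    have "Max (A n) \<in> A n" using that fin by simp
    then have "\<exists>P. D n P \<and> good n (1 / (real (Max (A n)) + 1)) P" by (simp add: A_def)
    then show ?thesis using that someI_ex[of "\<lambda>P. D n P \<and> good n (1 / (real (Max (A n)) + 1)) P"] by (simp add: P_def)
  qed
  show ?thesis
  proof (intro exI[of _ P] conjI allI impI)
    show "D n (P n)" for n
      using best[of n] someI_ex[OF dflt[of n]] by (cases "A n = {}") (simp_all add: P_def)
    fix e :: real assume "0 < e"
    then obtain j :: nat where j: "1 / (real j + 1) < e"
      using nat_approx_posE[of e] by (metis of_nat_Suc add.commute)
    have "\<forall>\<^sub>F n in sequentially. \<exists>P. D n P \<and> good n (1 / (real j + 1)) P" by (intro ev) simp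
    with eventually_ge_at_top[of j] show "\<forall>\<^sub>F n in sequentially. good n e (P n)"
    proof eventually_elim
      case (elim n)
      then have jA: "j \<in> A n" by (simp add: A_def)
      then have "j \<le> Max (A n)" using fin by simp
      then have "1 / (real (Max (A n)) + 1) \<le> 1 / (real j + 1)" by (simp add: frac_le)
      then show ?case using best[of n] jA j mono[of n _ "P n" e] by force
    qed
  qed
qed

theorem approximation_pair_loop_interior: "approximation_pair loop_interior (\<lambda>z. 1 + z)"
  unfolding approximation_pair_def
proof (intro conjI allI impI ballI)
  show "open loop_interior" by (rule open_loop_interior)
  show "(\<lambda>z. 1 + z) holomorphic_on loop_interior" by (intro holomorphic_intros)
  show "1 + z \<noteq> 0" if "z \<in> loop_interior" for z
    using loop_region_norm(2)[of z] that loop_interior_subset by auto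
  fix f K assume f: "f holomorphic_on loop_interior" and K: "compact K" "K \<subseteq> loop_interior"
  define D where "D = (\<lambda>n (P :: complex poly). degree P \<le> n)"
  define good where "good = (\<lambda>n e P. \<forall>z\<in>K. cmod (f z - (1 + z) ^ n * poly P z) < e)"
  have "\<forall>\<^sub>F n in sequentially. \<exists>P. D n P \<and> good n e P" if e: "0 < e" for e
  proof -
    obtain p where p: "\<And>z. z \<in> K \<Longrightarrow> cmod (f z - poly p z) < e / 2"
      using polynomial_approximation[OF f K, of "e / 2"] e by auto
    have "\<forall>\<^sub>F n in sequentially. \<exists>P. degree P \<le> n \<and> (\<forall>z\<in>K. cmod (poly p z - (1 + z) ^ n * poly P z) < e / 2)"
      using weighted_approximation_of_polynomial[OF K, of "e / 2" p] e by simp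
    then show ?thesis
    proof eventually_elim
      case (elim n)
      then obtain P where P: "degree P \<le> n" "\<And>z. z \<in> K \<Longrightarrow> cmod (poly p z - (1 + z) ^ n * poly P z) < e / 2"
        by blast
      have "cmod (f z - (1 + z) ^ n * poly P z) < e" if "z \<in> K" for z
        using norm_triangle_ineq[of "f z - poly p z" "poly p z - (1 + z) ^ n * poly P z"] p[OF that] P(2)[OF that]
        by simp
      then show ?case using P(1) by (auto simp: D_def good_def)
    qed
  qed
  moreover have "\<exists>P. D n P" for n unfolding D_def by (rule exI[of _ 0]) simp
  moreover have "good n e' P" if "good n e P" "e \<le> e'" for n e e' P
    using that unfolding good_def by force
  ultimately obtain P where P: "\<And>n. D n (P n)" "\<And>e. 0 < e \<Longrightarrow> \<forall>\<^sub>F n in sequentially. good n e (P n)"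
    using diagonal_choice[of D good] by blast
  show "\<exists>P. (\<forall>n. degree (P n) \<le> n) \<and> uniform_limit K (\<lambda>n z. (1 + z) ^ n * poly (P n) z) f sequentially"
  proof (intro exI[of _ P] conjI)
    show "\<forall>n. degree (P n) \<le> n" using P(1) by (simp add: D_def)
    show "uniform_limit K (\<lambda>n z. (1 + z) ^ n * poly (P n) z) f sequentially"
      unfolding uniform_limit_iff using P(2) by (simp add: good_def dist_norm norm_minus_commute)
  qed
qed

text \<open>
  The maximum modulus principle for \<open>p(z) / z^n\<close> on the outside of the loop, including infinity.
  The substitution \<open>z = 1 / x\<close> turns the quotient into the polynomial \<open>r\<close> and the outside into a
  bounded set \<open>S\<close>, because \<open>0\<close> is an interior point of the region.
\<close>

lemma polynomial_bound_outside_loop: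
  fixes p :: "complex poly"
  assumes deg: "degree p \<le> n" and bd: "\<And>z. z \<in> lemniscate_plus \<Longrightarrow> cmod (poly p z) \<le> C * cmod z ^ n"
    and z: "z \<notin> loop_region"
  shows "cmod (poly p z) \<le> C * cmod z ^ n"
proof -
  define r where "r = (\<lambda>x. \<Sum>k\<le>n. coeff p k * x ^ (n - k))"
  have r: "r x = x ^ n * poly p (inverse x)" if "x \<noteq> 0" for x
  proof -
    have "poly p y = (\<Sum>k\<le>n. coeff p k * y ^ k)" for y
      unfolding poly_altdef using deg by (intro sum.mono_neutral_left) (auto intro: coeff_eq_0)
    moreover have "x ^ (n - k) = x ^ n * inverse x ^ k" if "k \<le> n" for k
      using \<open>x \<noteq> 0\<close> that by (simp add: power_diff power_inverse divide_inverse)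
    ultimately show ?thesis
      unfolding r_def by (simp add: sum_distrib_left mult_ac)
  qed
  define S where "S = {x. x = 0 \<or> inverse x \<notin> loop_region}"
  have z0: "z \<noteq> 0" using z zero_in_loop_interior loop_interior_subset by auto
  have "cmod (r (inverse z)) \<le> C"
  proof (rule maximum_modulus_frontier[where S=S and f=r])
    show "r holomorphic_on interior S" unfolding r_def by (intro holomorphic_intros)
    show "continuous_on (closure S) r" unfolding r_def by (intro continuous_intros)
    show "inverse z \<in> S" using z by (simp add: S_def)
    obtain \<epsilon> where \<epsilon>: "0 < \<epsilon>" "ball 0 \<epsilon> \<subseteq> loop_region"
      using open_loop_interior zero_in_loop_interior loop_interior_subset
      by (meson open_contains_ball subset_trans)
    show "bounded S"
      unfolding bounded_iff
    proof (intro exI[of _ "inverse \<epsilon>"] ballI)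
      fix x assume x: "x \<in> S"
      show "cmod x \<le> inverse \<epsilon>"
      proof (cases "x = 0")
        case False
        then have "inverse x \<notin> ball 0 \<epsilon>" using x \<epsilon>(2) by (auto simp: S_def)
        then have "\<epsilon> \<le> inverse (cmod x)" by (simp add: norm_inverse)
        then show ?thesis using \<epsilon>(1) le_imp_inverse_le[of \<epsilon> "inverse (cmod x)"] by simp
      qed (use \<epsilon> in simp)
    qed
    fix x assume x: "x \<in> frontier S"
    have near0: "ball 0 2 \<subseteq> S"
    proof
      fix y :: complex assume y: "y \<in> ball 0 2"
      have "1/2 < cmod (inverse y)" if "y \<noteq> 0"
        using y that less_imp_inverse_less[of "cmod y" 2] by (simp only: norm_inverse) simp
      then show "y \<in> S" using loop_region_norm(1)[of "inverse y"] by (force simp: S_def)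
    qed
    have "x \<noteq> 0"
    proof
      assume "x = 0"
      then have "x \<in> interior S" using near0 by (auto intro!: interiorI[of "ball 0 2"])
      then show False using x by (simp add: frontier_def)
    qed
    then have op: "open (- {0 :: complex} \<inter> inverse -` T)" if "open T" for T
      using that by (intro continuous_open_preimage continuous_intros) auto
    have "inverse x \<in> loop_region"
    proof (rule ccontr)
      assume "inverse x \<notin> loop_region"
      then have "x \<in> - {0} \<inter> inverse -` (- loop_region)" using \<open>x \<noteq> 0\<close> by simp
      moreover have "open (- {0} \<inter> inverse -` (- loop_region))"
        using closed_loop_region by (intro op) auto
      moreover have "- {0} \<inter> inverse -` (- loop_region) \<subseteq> S" by (auto simp: S_def)
      ultimately have "x \<in> interior S" by (meson interiorI)
      then show False using x by (simp add: frontier_def)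
    qed
    moreover have "inverse x \<notin> loop_interior"
    proof
      assume "inverse x \<in> loop_interior"
      then have "x \<in> - {0} \<inter> inverse -` loop_interior" using \<open>x \<noteq> 0\<close> by simp
      moreover have "open (- {0} \<inter> inverse -` loop_interior)"
        by (intro op open_loop_interior)
      moreover have "(- {0} \<inter> inverse -` loop_interior) \<inter> S = {}"
        using loop_interior_subset by (auto simp: S_def)
      ultimately have "x \<notin> closure S" by (metis disjoint_iff open_Int_closure_eq_empty)
      then show False using x by (simp add: frontier_def)
    qed
    ultimately have "inverse x \<in> lemniscate_plus" using loop_region_minus_boundary by blast
    then have "cmod (poly p (inverse x)) \<le> C * cmod (inverse x) ^ n" by (rule bd)
    then have "cmod x ^ n * cmod (poly p (inverse x)) \<le> cmod x ^ n * (C * cmod (inverse x) ^ n)"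
      by (intro mult_left_mono) auto
    also have "\<dots> = C * (cmod x * cmod (inverse x)) ^ n" by (simp only: power_mult_distrib mult_ac)
    also have "cmod x * cmod (inverse x) = 1" using \<open>x \<noteq> 0\<close> by (simp add: norm_inverse)
    finally show "cmod (r x) \<le> C" using r[OF \<open>x \<noteq> 0\<close>] by (simp add: norm_mult norm_power)
  qed
  then have "cmod (poly p z) / cmod z ^ n \<le> C"
    using z0 by (simp add: r norm_mult norm_power norm_inverse divide_inverse power_inverse mult.commute)
  then show ?thesis using z0 by (simp add: divide_le_eq)
qed

text \<open>
  On the right loop \<open>|1 + z| = 1 / |4 z|\<close>. If \<open>(1 + z)^n P_n(z)\<close> is close to \<open>1\<close> there, then \<open>|P_n(z)|\<close> is
  at most \<open>3/2 |4 z|^n\<close> on the loop, hence also outside of it. But the outside contains points close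
  to \<open>-1/2\<close> with \<open>|4 z (1 + z)| < 1\<close>, and at those \<open>(1 + z)^n P_n(z)\<close> tends to \<open>0\<close>.
\<close>

theorem approximation_pair_maximal:
  assumes H: "open H" "loop_region \<subseteq> H"
  shows "\<not> approximation_pair H (\<lambda>z. 1 + z)"
proof
  assume "approximation_pair H (\<lambda>z. 1 + z)"
  then have ap: "\<And>f K. f holomorphic_on H \<Longrightarrow> compact K \<Longrightarrow> K \<subseteq> H \<Longrightarrow>
        \<exists>P :: nat \<Rightarrow> complex poly. (\<forall>n. degree (P n) \<le> n) \<and>
           uniform_limit K (\<lambda>n z. (1 + z) ^ n * poly (P n) z) f sequentially"
    unfolding approximation_pair_def by blast
  have "- 1/2 \<in> lemniscate_plus" using lemniscate_loops_meet by blast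
  then have "- 1/2 \<in> H" using H lemniscate_plus_subset by blast
  then obtain \<epsilon> where \<epsilon>: "0 < \<epsilon>" "ball (- 1/2) \<epsilon> \<subseteq> H" using H(1) open_contains_ball by blast
  define \<delta> where "\<delta> = min (\<epsilon> / 2) (1/4)"
  have \<delta>: "0 < \<delta>" "\<delta> < \<epsilon>" "\<delta> \<le> 1/4" using \<epsilon> by (auto simp: \<delta>_def)
  \<comment> \<open>A real point slightly to the left of the node, inside the left loop.\<close>
  define z0 where "z0 = complex_of_real (- 1/2 - \<delta>)"
  have "dist (- 1/2) z0 < \<epsilon>"
  proof -
    have "- 1/2 - z0 = of_real \<delta>" by (simp add: z0_def)
    then have "dist (- 1/2) z0 = \<bar>\<delta>\<bar>" by (simp only: dist_norm norm_of_real)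
    then show ?thesis using \<delta> by simp
  qed
  then have z0H: "z0 \<in> H" using \<epsilon> by auto
  have z0out: "z0 \<notin> loop_region" using \<delta> by (simp add: loop_region_def z0_def)
  have q: "4 * (cmod z0 * cmod (1 + z0)) = 1 - 4 * \<delta>\<^sup>2"
  proof -
    have "cmod z0 = \<bar>- 1/2 - \<delta>\<bar>" unfolding z0_def by (rule norm_of_real)
    moreover have "1 + z0 = of_real (1/2 - \<delta>)" by (simp add: z0_def)
    then have "cmod (1 + z0) = \<bar>1/2 - \<delta>\<bar>" by (simp only: norm_of_real)
    ultimately have "cmod z0 = 1/2 + \<delta>" "cmod (1 + z0) = 1/2 - \<delta>" using \<delta> by auto
    moreover have "4 * ((1/2 + \<delta>) * (1/2 - \<delta>)) = 1 - 4 * \<delta>\<^sup>2"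
      by (simp add: power2_eq_square algebra_simps)
    ultimately show ?thesis by simp
  qed
  have K: "compact (insert z0 loop_region)" "insert z0 loop_region \<subseteq> H"
    using compact_loop_region H z0H by auto
  obtain P :: "nat \<Rightarrow> complex poly" where P: "\<And>n. degree (P n) \<le> n"
    "uniform_limit (insert z0 loop_region) (\<lambda>n z. (1 + z) ^ n * poly (P n) z) (\<lambda>_. 1) sequentially"
    using ap[OF _ K, of "\<lambda>_. 1"] by (auto intro: holomorphic_intros)
  have ev1: "\<forall>\<^sub>F n in sequentially. \<forall>z\<in>insert z0 loop_region. dist ((1 + z) ^ n * poly (P n) z) 1 < 1/2"
    using uniform_limitD[OF P(2), of "1/2"] by simp
  have "(\<lambda>n. 3/2 * (1 - 4 * \<delta>\<^sup>2) ^ n) \<longlonglongrightarrow> 3/2 * 0"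
  proof (intro tendsto_intros LIMSEQ_power_zero)
    have "4 * \<delta>\<^sup>2 \<le> 4 * (1/4)\<^sup>2" using \<delta> by (intro mult_left_mono power_mono) auto
    then show "norm (1 - 4 * \<delta>\<^sup>2) < 1" using \<delta> by (simp add: power2_eq_square)
  qed
  then have ev2: "\<forall>\<^sub>F n in sequentially. 3/2 * (1 - 4 * \<delta>\<^sup>2) ^ n < 1/2"
    by (rule order_tendstoD) simp
  from eventually_happens'[OF trivial_limit_sequentially eventually_conj[OF ev1 ev2]]
  obtain n where near: "\<And>z. z \<in> insert z0 loop_region \<Longrightarrow> cmod ((1 + z) ^ n * poly (P n) z - 1) < 1/2"
    and small: "3/2 * (1 - 4 * \<delta>\<^sup>2) ^ n < 1/2"
    by (auto simp: dist_norm)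
  have "cmod (poly (P n) z) \<le> (3/2 * 4 ^ n) * cmod z ^ n" if z: "z \<in> lemniscate_plus" for z
  proof -
    have zr: "z \<in> loop_region" using z lemniscate_plus_subset by blast
    have "cmod ((1 + z) ^ n * poly (P n) z) \<le> 3/2"
      using near[of z] zr norm_triangle_ineq2[of "(1 + z) ^ n * poly (P n) z" 1] by simp
    moreover have "4 * (cmod z * cmod (1 + z)) = 1"
      using z by (simp add: lemniscate_plus_def lemniscate_def norm_mult add.commute)
    then have one: "4 ^ n * cmod z ^ n * cmod (1 + z) ^ n = 1"
      by (metis mult.assoc power_mult_distrib power_one)
    ultimately have "(4 ^ n * cmod z ^ n) * (cmod (1 + z) ^ n * cmod (poly (P n) z)) \<le> (4 ^ n * cmod z ^ n) * (3/2)"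
      by (intro mult_left_mono) (auto simp: norm_mult norm_power)
    then show ?thesis using one by (simp add: mult.assoc[symmetric])
  qed
  then have "cmod (poly (P n) z0) \<le> (3/2 * 4 ^ n) * cmod z0 ^ n"
    using polynomial_bound_outside_loop[OF P(1) _ z0out] by blast
  then have "cmod (1 + z0) ^ n * cmod (poly (P n) z0) \<le> cmod (1 + z0) ^ n * ((3/2 * 4 ^ n) * cmod z0 ^ n)"
    by (intro mult_left_mono) auto
  also have "\<dots> = 3/2 * (4 * (cmod z0 * cmod (1 + z0))) ^ n"
    by (simp only: power_mult_distrib mult_ac)
  also have "\<dots> < 1/2" unfolding q by (rule small)
  finally have "cmod ((1 + z0) ^ n * poly (P n) z0) < 1/2" by (simp add: norm_mult norm_power)
  moreover have "1 - cmod ((1 + z0) ^ n * poly (P n) z0) \<le> cmod ((1 + z0) ^ n * poly (P n) z0 - 1)"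
    using norm_triangle_ineq2[of 1 "(1 + z0) ^ n * poly (P n) z0"] by (simp add: norm_minus_commute)
  ultimately show False using near[of z0] by simp
qed

section \<open>The theorem on the lemniscate\<close>

theorem theorem3p2:
  fixes G :: "complex set" and W :: "complex \<Rightarrow> complex" and w Q :: "complex \<Rightarrow> real"
    and s s_monic :: "nat \<Rightarrow> complex poly"
  assumes G: "open G" "connected G" "bounded G" "frontier G = lemniscate_plus"
    and W: "W = (\<lambda>z. 1 + z)"
    and w: "w = (\<lambda>z. cmod (1 + z))"
    and Q: "Q = (\<lambda>z. - ln (w z))"
    and s: "s = (\<lambda>n. taylor_poly n (\<lambda>z. (1 + z) powi (- int n)))"
    and s_monic: "s_monic = (\<lambda>n. smult (inverse (lead_coeff (s n))) (s n))"
  shows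
    "(\<forall>z \<in> closure G - {- 1/2}. \<exists>\<epsilon> :: nat \<Rightarrow> complex.
        \<epsilon> \<in> O(\<lambda>n. 1 / of_nat n) \<and>
        (\<forall>\<^sub>F n in sequentially.
           1 - (1 + z) ^ n * poly (s n) z =
           (- 1) ^ (n + 1) * z / (of_real (sqrt (real n * pi)) * (2 * z + 1)) *
           (4 * z * (1 + z)) ^ n * (1 + \<epsilon> n)))
     \<and> ((\<forall>n. degree (s_monic n) = n \<and> lead_coeff (s_monic n) = 1)
        \<and> (\<lambda>n. root n (star_norm (closure G) (\<lambda>z. (1 + z) ^ n * poly (s_monic n) z)))
             \<longlonglongrightarrow> exp (- real_of_ereal (robin_constant (closure G) Q))
        \<and> exp (- real_of_ereal (robin_constant (closure G) Q)) = 1/4)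
     \<and> weak_star_conv (\<lambda>n. zero_counting_measure n (s n)) (equilibrium_measure (closure G) Q)
     \<and> (approximation_pair G W
        \<and> (\<forall>H. open H \<and> connected H \<and> closure G \<subseteq> H \<longrightarrow> \<not> approximation_pair H W))"
proof -
  have G_eq: "G = loop_interior" and cl: "closure G = loop_region"
    using domain_of_lemniscate_plus[OF G(1,3,4)] by auto
  have s_eq: "s = (\<lambda>n. binom_taylor n n)"
    unfolding s by (simp add: taylor_poly_one_plus_powi)
  have Q_eq: "Q = (\<lambda>z. - ln (cmod (1 + z)))" unfolding Q w ..
  have exp_robin: "exp (- real_of_ereal (robin_constant (closure G) Q)) = 1/4"
    unfolding cl Q_eq robin_constant_loop by (simp add: exp_minus)
  have asymptotics: "\<forall>z \<in> closure G - {- 1/2}. \<exists>\<epsilon> :: nat \<Rightarrow> complex.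
        \<epsilon> \<in> O(\<lambda>n. 1 / of_nat n) \<and>
        (\<forall>\<^sub>F n in sequentially.
           1 - (1 + z) ^ n * poly (s n) z =
           (- 1) ^ (n + 1) * z / (of_real (sqrt (real n * pi)) * (2 * z + 1)) *
           (4 * z * (1 + z)) ^ n * (1 + \<epsilon> n))"
    unfolding cl s_eq taylor_defect_def[symmetric]
    using taylor_defect_asymptotics by blast
  have monic: "degree (s_monic n) = n \<and> lead_coeff (s_monic n) = 1" for n
  proof -
    have "n > 0 \<or> n = 0" by auto
    then have "degree (s n) = n" "lead_coeff (s n) = neg_binom n n"
      unfolding s_eq by (rule degree_binom_taylor)+
    moreover have "neg_binom n n \<noteq> 0" by (cases "n = 0") (auto simp: neg_binom_nonzero)
    ultimately show ?thesis unfolding s_monic by simp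
  qed
  have norms: "(\<lambda>n. root n (star_norm (closure G) (\<lambda>z. (1 + z) ^ n * poly (s_monic n) z)))
      \<longlonglongrightarrow> exp (- real_of_ereal (robin_constant (closure G) Q))"
    unfolding exp_robin unfolding cl s_monic s_eq by (rule star_norm_limit)
  have zeros: "weak_star_conv (\<lambda>n. zero_counting_measure n (s n)) (equilibrium_measure (closure G) Q)"
    unfolding cl Q_eq equilibrium_measure_loop s_eq by (rule zero_counting_measure_converges)
  have approx: "approximation_pair G W"
    unfolding G_eq W by (rule approximation_pair_loop_interior)
  have maximal: "\<not> approximation_pair H W" if "open H" "closure G \<subseteq> H" for H
    unfolding W using that unfolding cl by (rule approximation_pair_maximal)
  show ?thesis
    using asymptotics monic norms exp_robin zeros approx maximal by blast
qed

end
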